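(* Let $k$ be a perfect field of characteristic $p>0$ and let $g\in R=k[x_1,\dots,x_n]$ be a non-constant polynomial. Let $\lambda$ be an $F$-jumping exponent of $g$ in $(0,1]\cap\mathbb{Z}_{(p)}$. Then $-\lambda$ is a root of the $b$-function $b_g$ of $g$. Moreover, every root of $b_g$ is of the form $-\lambda$ for some $F$-jumping exponent $\lambda$ of $g$ in $(0,1]\cap\mathbb{Z}_{(p)}$.
   Context: Let $k$ be a field of characteristic $p>0$, $R$ a smooth commutative $k$-algebra, $f\in R$. $D_R$ is the ring of Grothendieck ($k$-linear) differential operators of $R$, and similarly $D_{R[t]}$ for the polynomial ring $R[t]$. For $e\ge 0$, $\frac{d}{dt}^{[p^e]}\in D_{R[t]}$ is the $R$-linear divided power operator with $\frac{d}{dt}^{[p^e]}(t^n)=\binom{n}{p^e}t^{n-p^e}$ (with $\binom{n}{m}=0$ for $n<m$), and $\nu_e:=\frac{d}{dt}^{[p^e]}\,t^{p^e}$ is the $e$-th higher Euler operator. $D_R[\nu_e;e\in\mathbb{N}]\subset D_{R[t]}$ is the subring generated by $D_R$ and all $\nu_e$. $B_f:=R[t][\frac{1}{f-t}]/R[t]$ (a left $D_{R[t]}$-module), $\delta_f\in B_f$ is the class of $\frac{1}{f-t}$, $M_f:=D_R[\nu_e;e\in\mathbb{N}]\,\delta_f\subset B_f$. The subset $tM_f$ is a $D_R[\nu_e;e\in\mathbb{N}]$-submodule of $M_f$, and $N_f:=M_f/tM_f$. Let $A_k$ be the $k$-algebra of functions $\mathbb{N}\to k$ generated by the binomial coefficient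 functions $\binom{s}{n}: l\mapsto\binom{l}{n} \bmod p$; it is generated by the $\binom{s}{p^e}$, $e\ge0$. $N_f^\gamma$ is $N_f$ viewed as an $A_k$-module with $\binom{s}{p^e}$ acting as $-\nu_e$ (this is well defined). The $b$-function $b_f$ is the annihilator of $N_f^\gamma$ in $A_k$, an ideal of $A_k$. Roots: the maximal ideals of $A_k$ are in bijection with $\mathbb{Z}_p$, the $p$-adic integer $z=\sum_{e\ge0}z_ep^e$ ($0\le z_e\le p-1$) corresponding to the ideal $\mathfrak{m}_z$ generated by $\{\binom{s}{p^e}-z_e;\ e\ge0\}$. The roots of an ideal $I\subset A_k$ are the $z\in\mathbb{Z}_p$ with $I\subset\mathfrak{m}_z$. Elements of $\mathbb{Z}_{(p)}\subset\mathbb{Q}$ are regarded as elements of $\mathbb{Z}_p$. Test ideals: for an ideal $J\subset R$ and $e\ge0$, $J^{[p^e]}$ is the ideal generated by the $p^e$-th powers of elements of $J$, and $J^{[1/p^e]}$ is the intersection of all ideals $I$ of $R$ with $I^{[p^e]}\supset J$. For real $\lambda\ge0$, $\tau(f^\lambda):=\bigcup_{e\ge0}(f^{\lceil\lambda p^e\rceil}R)^{[1/p^e]}$ (an increasing union). An $F$-jumping exponent of $f$ is a real $\lambda>0$ such that $\tau(f^{\lambda-\epsilon})\ne\tau(f^\lambda)$ for all $\epsilon>0$ with $\lambda-\epsilon>0$. *)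

theory Defs
  imports
    "HOL-Library.Poly_Mapping"
    "HOL-Library.FuncSet"
    "HOL-Computational_Algebra.Polynomial"
    "HOL-Computational_Algebra.Fraction_Field"
    "HOL-Number_Theory.Cong"
    "HOL-Algebra.Module"
    "HOL-Algebra.Coset"
    "HOL-Algebra.Ideal"
    "HOL-Algebra.Generated_Rings"
    "HOL-Algebra.Algebraic_Closure_Type"
begin

definition perfect_field :: "'k::field itself \<Rightarrow> bool" where
  "perfect_field _ \<longleftrightarrow> CHAR('k) = 0 \<or> surj (\<lambda>x::'k. x ^ CHAR('k))"

text \<open>
  \<open>('n, 'k) mpoly\<close> is the polynomial ring over \<open>'k\<close> with one variable for each element of
  \<open>'n\<close>. The order on \<open>'n\<close> is irrelevant; the library needs it to know that this is a domain.
\<close>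

type_synonym ('n, 'k) mpoly = "('n \<Rightarrow>\<^sub>0 nat) \<Rightarrow>\<^sub>0 'k"

definition mconst :: "'k::zero \<Rightarrow> ('n, 'k) mpoly" where
  "mconst c = Poly_Mapping.single 0 c"

section \<open>Differential operators\<close>

text \<open>
  \<open>S\<close> is a subring of an ambient ring and \<open>K \<subseteq> S\<close> the subring of scalars.
  Endomorphisms of \<open>S\<close> are represented by functions that are \<open>undefined\<close> off \<open>S\<close>.
  \<open>diff_ops_lt K S m\<close> are the operators of order less than \<open>m\<close>.
\<close>

definition linear_endos :: "'a::comm_ring_1 set \<Rightarrow> 'a set \<Rightarrow> ('a \<Rightarrow> 'a) set" where
  "linear_endos K S = {P \<in> S \<rightarrow>\<^sub>E S.
     (\<forall>x\<in>S. \<forall>y\<in>S. P (x + y) = P x + P y) \<and> (\<forall>c\<in>K. \<forall>x\<in>S. P (c * x) = c * P x)}"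

primrec diff_ops_lt :: "'a::comm_ring_1 set \<Rightarrow> 'a set \<Rightarrow> nat \<Rightarrow> ('a \<Rightarrow> 'a) set" where
  "diff_ops_lt K S 0 = {\<lambda>x\<in>S. 0}"
| "diff_ops_lt K S (Suc m) =
     {P \<in> linear_endos K S. \<forall>a\<in>S. (\<lambda>x\<in>S. P (a * x) - a * P x) \<in> diff_ops_lt K S m}"

definition diff_ops :: "'a::comm_ring_1 set \<Rightarrow> 'a set \<Rightarrow> ('a \<Rightarrow> 'a) set" where
  "diff_ops K S = (\<Union>m. diff_ops_lt K S m)"

definition diff_op_ring :: "'a::comm_ring_1 set \<Rightarrow> 'a set \<Rightarrow> ('a \<Rightarrow> 'a) ring" where
  "diff_op_ring K S = \<lparr>carrier = diff_ops K S, monoid.mult = compose S, one = (\<lambda>x\<in>S. x),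
     zero = (\<lambda>x\<in>S. 0), add = (\<lambda>P Q. \<lambda>x\<in>S. P x + Q x)\<rparr>"

definition D_R :: "(('n::{finite,linorder}, 'k::field) mpoly \<Rightarrow> ('n, 'k) mpoly) set" where
  "D_R = diff_ops (range mconst) UNIV"

definition D_Rt_ring ::
    "(('n::{finite,linorder}, 'k::field) mpoly poly \<Rightarrow> ('n, 'k) mpoly poly) ring" where
  "D_Rt_ring = diff_op_ring (range (\<lambda>c. [:mconst c:])) UNIV"

definition divided_deriv :: "nat \<Rightarrow> 'r::comm_ring_1 poly \<Rightarrow> 'r poly" where
  "divided_deriv m q =
     (\<Sum>n\<le>Polynomial.degree q.
        Polynomial.monom (of_nat (n choose m) * Polynomial.coeff q n) (n - m))"

definition euler_op :: "nat \<Rightarrow> nat \<Rightarrow> 'r::comm_ring_1 poly \<Rightarrow> 'r poly" where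
  "euler_op p e q = divided_deriv (p ^ e) (Polynomial.monom 1 (p ^ e) * q)"

text \<open>\<open>map_poly P\<close> is the \<open>t\<close>-linear extension of \<open>P \<in> D_R\<close> to \<open>R[t]\<close>.\<close>

definition D_R_euler ::
    "nat \<Rightarrow> (('n::{finite,linorder}, 'k::field) mpoly poly \<Rightarrow> ('n, 'k) mpoly poly) set" where
  "D_R_euler p = generate_ring D_Rt_ring (map_poly ` D_R \<union> range (euler_op p))"

section \<open>The modules \<open>B_f\<close>, \<open>M_f\<close> and \<open>N_f\<close>\<close>

text \<open>The subring \<open>R[t][1/(f - t)]\<close> of the fraction field of \<open>R[t]\<close>; note \<open>f - t = [:f, -1:]\<close>.\<close>

definition loc :: "('n::{finite,linorder}, 'k::field) mpoly \<Rightarrow> ('n, 'k) mpoly poly fract set" where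
  "loc f = {Fract a ([:f, -1:] ^ m) | a m. True}"

definition loc_group ::
    "('n::{finite,linorder}, 'k::field) mpoly \<Rightarrow> ('n, 'k) mpoly poly fract monoid" where
  "loc_group f = \<lparr>carrier = loc f, monoid.mult = (+), one = 0\<rparr>"

definition Rt_in_loc :: "('n::{finite,linorder}, 'k::field) mpoly poly fract set" where
  "Rt_in_loc = range (\<lambda>a. Fract a 1)"

text \<open>
  The action of \<open>D_Rt_ring\<close> on the localisation: a differential operator of \<open>R[t]\<close> extends
  uniquely to a differential operator of the localisation.
\<close>

definition extend_op :: "('n::{finite,linorder}, 'k::field) mpoly \<Rightarrow>
    (('n, 'k) mpoly poly \<Rightarrow> ('n, 'k) mpoly poly) \<Rightarrow>
    ('n, 'k) mpoly poly fract \<Rightarrow> ('n, 'k) mpoly poly fract" where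
  "extend_op f P = (THE Q. Q \<in> diff_ops (range (\<lambda>c. Fract [:mconst c:] 1)) (loc f) \<and>
     (\<forall>a. Q (Fract a 1) = Fract (P a) 1))"

text \<open>The endomorphism of \<open>G/H\<close> induced by an endomorphism \<open>T\<close> of \<open>G\<close> with \<open>T ` H \<subseteq> H\<close>.\<close>

definition quot_map ::
    "('a, 'c) monoid_scheme \<Rightarrow> 'a set \<Rightarrow> ('a \<Rightarrow> 'a) \<Rightarrow> 'a set \<Rightarrow> 'a set" where
  "quot_map G H T = (\<lambda>C\<in>carrier (G Mod H). H <#>\<^bsub>G\<^esub> (T ` C))"

definition B_mod ::
    "('n::{finite,linorder}, 'k::field) mpoly \<Rightarrow> ('n, 'k) mpoly poly fract set monoid" where
  "B_mod f = loc_group f Mod Rt_in_loc"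

definition act_B :: "('n::{finite,linorder}, 'k::field) mpoly \<Rightarrow>
    (('n, 'k) mpoly poly \<Rightarrow> ('n, 'k) mpoly poly) \<Rightarrow>
    ('n, 'k) mpoly poly fract set \<Rightarrow> ('n, 'k) mpoly poly fract set" where
  "act_B f P = quot_map (loc_group f) Rt_in_loc (extend_op f P)"

definition delta ::
    "('n::{finite,linorder}, 'k::field) mpoly \<Rightarrow> ('n, 'k) mpoly poly fract set" where
  "delta f = Rt_in_loc #>\<^bsub>loc_group f\<^esub> Fract 1 [:f, -1:]"

definition M_mod ::
    "nat \<Rightarrow> ('n::{finite,linorder}, 'k::field) mpoly \<Rightarrow> ('n, 'k) mpoly poly fract set set" where
  "M_mod p f = (\<lambda>P. act_B f P (delta f)) ` D_R_euler p"

definition tM_mod ::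
    "nat \<Rightarrow> ('n::{finite,linorder}, 'k::field) mpoly \<Rightarrow> ('n, 'k) mpoly poly fract set set" where
  "tM_mod p f = act_B f (\<lambda>q. [:0, 1:] * q) ` M_mod p f"

definition M_group ::
    "nat \<Rightarrow> ('n::{finite,linorder}, 'k::field) mpoly \<Rightarrow> ('n, 'k) mpoly poly fract set monoid" where
  "M_group p f = (B_mod f)\<lparr>carrier := M_mod p f\<rparr>"

definition N_mod ::
    "nat \<Rightarrow> ('n::{finite,linorder}, 'k::field) mpoly \<Rightarrow> ('n, 'k) mpoly poly fract set set monoid" where
  "N_mod p f = M_group p f Mod tM_mod p f"

definition act_N :: "nat \<Rightarrow> ('n::{finite,linorder}, 'k::field) mpoly \<Rightarrow>
    (('n, 'k) mpoly poly \<Rightarrow> ('n, 'k) mpoly poly) \<Rightarrow>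
    ('n, 'k) mpoly poly fract set set \<Rightarrow> ('n, 'k) mpoly poly fract set set" where
  "act_N p f P = quot_map (M_group p f) (tM_mod p f) (act_B f P)"

section \<open>The \<open>b\<close>-function\<close>

definition fun_ring :: "(nat \<Rightarrow> 'k::field) ring" where
  "fun_ring = \<lparr>carrier = UNIV, monoid.mult = (\<lambda>\<phi> \<psi> l. \<phi> l * \<psi> l), one = (\<lambda>l. 1),
     zero = (\<lambda>l. 0), add = (\<lambda>\<phi> \<psi> l. \<phi> l + \<psi> l)\<rparr>"

definition binom_fun :: "nat \<Rightarrow> nat \<Rightarrow> 'k::field" where
  "binom_fun n = (\<lambda>l. of_nat (l choose n))"

definition A_ring :: "(nat \<Rightarrow> 'k::field) ring" where
  "A_ring = fun_ring\<lparr>carrier :=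
     generate_ring fun_ring (range (\<lambda>c l. c) \<union> range binom_fun)\<rparr>"

text \<open>
  \<open>N_f\<close> with scalar multiplication \<open>\<rho>\<close>; the multiplicative fields of the module record are unused.
\<close>

definition N_with_smult :: "nat \<Rightarrow> ('n::{finite,linorder}, 'k::field) mpoly \<Rightarrow>
    ((nat \<Rightarrow> 'k) \<Rightarrow> ('n, 'k) mpoly poly fract set set \<Rightarrow> ('n, 'k) mpoly poly fract set set) \<Rightarrow>
    (nat \<Rightarrow> 'k, ('n, 'k) mpoly poly fract set set) module" where
  "N_with_smult p f \<rho> = \<lparr>carrier = carrier (N_mod p f),
     monoid.mult = undefined, one = undefined,
     zero = \<one>\<^bsub>N_mod p f\<^esub>, add = monoid.mult (N_mod p f), module.smult = \<rho>\<rparr>"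

text \<open>
  The \<open>A\<close>-module structure is the unique one that extends the \<open>k\<close>-vector space structure and
  for which \<open>binom_fun (p ^ e)\<close> acts as the negative of the Euler operator.
\<close>

definition gamma_smult :: "nat \<Rightarrow> ('n::{finite,linorder}, 'k::field) mpoly \<Rightarrow>
    (nat \<Rightarrow> 'k) \<Rightarrow> ('n, 'k) mpoly poly fract set set \<Rightarrow> ('n, 'k) mpoly poly fract set set" where
  "gamma_smult p f = (THE \<rho>.
     \<rho> \<in> carrier A_ring \<rightarrow>\<^sub>E (carrier (N_mod p f) \<rightarrow>\<^sub>E carrier (N_mod p f)) \<and>
     module A_ring (N_with_smult p f \<rho>) \<and>
     (\<forall>c. \<rho> (\<lambda>l. c) = act_N p f (\<lambda>q. [:mconst c:] * q)) \<and>
     (\<forall>e. \<rho> (binom_fun (p ^ e)) = act_N p f (\<lambda>q. - euler_op p e q)))"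

definition N_gamma :: "nat \<Rightarrow> ('n::{finite,linorder}, 'k::field) mpoly \<Rightarrow>
    (nat \<Rightarrow> 'k, ('n, 'k) mpoly poly fract set set) module" where
  "N_gamma p f = N_with_smult p f (gamma_smult p f)"

definition b_function ::
    "nat \<Rightarrow> ('n::{finite,linorder}, 'k::field) mpoly \<Rightarrow> (nat \<Rightarrow> 'k) set" where
  "b_function p f = {\<phi> \<in> carrier A_ring.
     \<forall>m\<in>carrier (N_gamma p f). \<phi> \<odot>\<^bsub>N_gamma p f\<^esub> m = \<zero>\<^bsub>N_gamma p f\<^esub>}"

section \<open>\<open>p\<close>-adic integers and roots\<close>

text \<open>
  The \<open>p\<close>-adic integers as the inverse limit of the rings of integers modulo \<open>p ^ n\<close>, each class
  given by its representative in \<open>{0..<p ^ n}\<close>. Thus \<open>z (Suc e)\<close> is the truncation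
  \<open>z\<^sub>0 + \<dots> + z\<^sub>e p ^ e\<close> of the digit expansion.
\<close>

definition padic_ints :: "nat \<Rightarrow> (nat \<Rightarrow> int) set" where
  "padic_ints p = {z. \<forall>n. z n \<in> {0..<int p ^ n} \<and> [z (Suc n) = z n] (mod int p ^ n)}"

definition padic_digit :: "nat \<Rightarrow> (nat \<Rightarrow> int) \<Rightarrow> nat \<Rightarrow> int" where
  "padic_digit p z e = z (Suc e) div int p ^ e"

definition Z_loc :: "nat \<Rightarrow> real set" where
  "Z_loc p = {of_int a / of_int b | a b. \<not> int p dvd b}"

definition padic_of_Z_loc :: "nat \<Rightarrow> real \<Rightarrow> nat \<Rightarrow> int" where
  "padic_of_Z_loc p x n = (THE c. c \<in> {0..<int p ^ n} \<and>
     (\<exists>a b. \<not> int p dvd b \<and> x = of_int a / of_int b \<and> [b * c = a] (mod int p ^ n)))"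

definition max_ideal_at :: "nat \<Rightarrow> (nat \<Rightarrow> int) \<Rightarrow> (nat \<Rightarrow> 'k::field) set" where
  "max_ideal_at p z =
     Idl\<^bsub>A_ring\<^esub> (range (\<lambda>e l. binom_fun (p ^ e) l - of_int (padic_digit p z e)))"

definition Zp_roots :: "nat \<Rightarrow> (nat \<Rightarrow> 'k::field) set \<Rightarrow> (nat \<Rightarrow> int) set" where
  "Zp_roots p I = {z \<in> padic_ints p. I \<subseteq> max_ideal_at p z}"

section \<open>Test ideals\<close>

definition frob_power :: "nat \<Rightarrow> nat \<Rightarrow> 'r::comm_ring_1 set \<Rightarrow> 'r set" where
  "frob_power p e J = Idl\<^bsub>ring_of_type_algebra\<^esub> ((\<lambda>a. a ^ (p ^ e)) ` J)"

definition frob_root :: "nat \<Rightarrow> nat \<Rightarrow> 'r::comm_ring_1 set \<Rightarrow> 'r set" where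
  "frob_root p e J = \<Inter>{I. ideal I ring_of_type_algebra \<and> J \<subseteq> frob_power p e I}"

definition test_ideal :: "nat \<Rightarrow> 'r::comm_ring_1 \<Rightarrow> real \<Rightarrow> 'r set" where
  "test_ideal p f r =
     (\<Union>e. frob_root p e (PIdl\<^bsub>ring_of_type_algebra\<^esub> (f ^ nat \<lceil>r * real p ^ e\<rceil>)))"

definition F_jumping :: "nat \<Rightarrow> 'r::comm_ring_1 \<Rightarrow> real \<Rightarrow> bool" where
  "F_jumping p f r \<longleftrightarrow>
     r > 0 \<and> (\<forall>\<epsilon>>0. r - \<epsilon> > 0 \<longrightarrow> test_ideal p f (r - \<epsilon>) \<noteq> test_ideal p f r)"

end

theory Submission
  imports Defs "HOL-Number_Theory.Residues"
begin

text \<open>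
  Write \<open>q = p ^ e\<close> and let \<open>D\<^sup>e\<close> be the ring of operators on \<open>R = k[x]\<close> that are linear over
  the \<open>q\<close>-th powers. As \<open>k\<close> is perfect, \<open>D_R\<close> is the union of the \<open>D\<^sup>e\<close>
  (\<open>diff_op_frob_linear\<close>, \<open>frob_linear_diff_op\<close>). The ring generated by \<open>D_R\<close> and the Euler
  operators consists of the operators that act on each \<open>R t ^ n\<close> separately, by an element of some
  \<open>D\<^sup>e\<close> that depends only on \<open>n mod q\<close> (\<open>D_R_euler_eq\<close>). At level \<open>e\<close> the generator is
  \<open>1 / (f - t) = (f - t) ^ (q - 1) / (f - t) ^ q =
    (\<Sum>i<q. f ^ (q - 1 - i) * t ^ i) / (f ^ q - t ^ q)\<close>,
  whose denominator is a constant for such operators, while \<open>t\<close> acts on it as \<open>f\<close>. With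
  \<open>a = q - 1 - i\<close> this splits the level \<open>e\<close> part of \<open>N_f\<close> into the quotients
  \<open>D\<^sup>e f ^ a / D\<^sup>e f ^ (a + 1)\<close> for \<open>a < q\<close>, and \<open>binom_fun (p ^ j)\<close> acts on the one of index
  \<open>a\<close> as the \<open>j\<close>-th digit of \<open>a\<close>. So a locally constant function lies in the
  \<open>b\<close>-function if and only if, at some level, it vanishes at every \<open>a\<close> for which
  \<open>f ^ a \<notin> D\<^sup>e f ^ (a + 1)\<close> (\<open>b_function_iff\<close>). Calling such an \<open>a\<close> a jump of level \<open>e\<close>, the
  roots are the \<open>p\<close>-adic integers all of whose truncations are jumps (\<open>Zp_roots_b_function\<close>).

  On the other side, \<open>D\<^sup>e u\<close> determines and is determined by the ideal of the values at \<open>u\<close> of all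
  \<open>p\<^sup>-\<^sup>e\<close>-linear maps, which is the Frobenius root of \<open>u R\<close> (\<open>frob_root_principal\<close>,
  \<open>cartier_ideal_subset_iff\<close>). Hence \<open>a\<close> is a jump of level \<open>e\<close> exactly if there is an
  \<open>F\<close>-jumping exponent in the interval from \<open>a / q\<close> (excluded) to \<open>(a + 1) / q\<close> (included)
  (\<open>F_jumping_iff\<close>, \<open>jump_imp_jumping_exponent\<close>). Bounding the exponents of the monomials that occur
  shows that there are finitely many jumping exponents in the unit interval
  (\<open>finite_jumping_set\<close>), and multiplication by \<open>p\<close> modulo \<open>1\<close> carries one to
  another (\<open>jumping_set_multiply\<close>).

  If \<open>\<lambda>\<close> is a jumping exponent whose denominator divides \<open>q - 1\<close>, then \<open>(q - 1) \<lambda>\<close> is a jump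
  of level \<open>e\<close> and is congruent to \<open>- \<lambda>\<close> modulo \<open>q\<close>; such \<open>e\<close> are arbitrarily large, and
  therefore \<open>- \<lambda>\<close> is a root. Conversely a root \<open>z\<close> produces jumping exponents \<open>\<lambda>\<close> and
  \<open>\<mu> = q \<lambda> - (z mod q)\<close> for every \<open>e\<close>; by finiteness the same pair serves infinitely many
  \<open>e\<close>, and this forces \<open>z = - \<mu>\<close>.
\<close>

section \<open>Differential operators and Frobenius powers\<close>

declare restrict_UNIV [simp]

definition ad :: "'a::comm_ring_1 \<Rightarrow> ('a \<Rightarrow> 'a) \<Rightarrow> 'a \<Rightarrow> 'a" where
  "ad a P = (\<lambda>x. P (a * x) - a * P x)"

lemma ad_funpow:
  "(ad a ^^ n) P x = (\<Sum>k\<le>n. of_nat (n choose k) * (- a) ^ (n - k) * P (a ^ k * x))"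
proof (induction n arbitrary: x)
  case 0
  then show ?case by simp
next
  case (Suc n)
  define g where "g k = P (a ^ k * x)" for k
  have step: "(ad a ^^ Suc n) P x = (\<Sum>k\<le>n. of_nat (n choose k) * (- a) ^ (n - k) * g (Suc k))
      + (\<Sum>k\<le>n. of_nat (n choose k) * (- a) ^ (Suc n - k) * g k)"
  proof -
    have "(ad a ^^ Suc n) P x = (ad a ^^ n) P (a * x) - a * (ad a ^^ n) P x"
      by (simp add: ad_def)
    also have "(ad a ^^ n) P (a * x) = (\<Sum>k\<le>n. of_nat (n choose k) * (- a) ^ (n - k) * g (Suc k))"
      by (simp add: Suc.IH g_def mult_ac)
    also have "- (a * (ad a ^^ n) P x) = (\<Sum>k\<le>n. of_nat (n choose k) * (- a) ^ (Suc n - k) * g k)"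
      unfolding Suc.IH sum_distrib_left sum_negf [symmetric] g_def
      by (intro sum.cong) (auto simp: Suc_diff_le)
    ultimately show ?thesis
      by (metis (no_types, lifting) diff_conv_add_uminus)
  qed
  have "(\<Sum>k\<le>Suc n. of_nat (Suc n choose k) * (- a) ^ (Suc n - k) * g k)
     = (- a) ^ Suc n * g 0 +
       (\<Sum>k\<le>n. of_nat (n choose k) * (- a) ^ (n - k) * g (Suc k)) +
       (\<Sum>k\<le>n. of_nat (n choose Suc k) * (- a) ^ (n - k) * g (Suc k))"
    by (subst sum.atMost_Suc_shift) (simp add: algebra_simps sum.distrib)
  moreover have "(\<Sum>k\<le>Suc n. of_nat (n choose k) * (- a) ^ (Suc n - k) * g k)
     = (- a) ^ Suc n * g 0 + (\<Sum>k\<le>n. of_nat (n choose Suc k) * (- a) ^ (n - k) * g (Suc k))"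
    by (subst sum.atMost_Suc_shift) simp
  moreover have "(\<Sum>k\<le>Suc n. of_nat (n choose k) * (- a) ^ (Suc n - k) * g k)
      = (\<Sum>k\<le>n. of_nat (n choose k) * (- a) ^ (Suc n - k) * g k)"
    by (simp add: binomial_eq_0)
  ultimately show ?case
    using step by (simp add: g_def add_ac)
qed

lemma ad_funpow_CHAR:
  fixes a :: "'a::comm_ring_1"
  assumes "Factorial_Ring.prime CHAR('a)"
  shows "ad a ^^ CHAR('a) = ad (a ^ CHAR('a))"
proof (intro ext)
  fix P :: "'a \<Rightarrow> 'a" and x
  let ?p = "CHAR('a)"
  have p: "?p > 0" using assms by (simp add: prime_gt_0_nat)
  have zero: "of_nat (?p choose k) = (0::'a)" if "0 < k" "k < ?p" for k
  proof -
    have "?p dvd (?p choose k)"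
      by (rule dvd_choose_prime) (use that assms in auto)
    then show ?thesis by (simp only: of_nat_eq_0_iff_char_dvd)
  qed
  have "(0::'a) = (a + - a) ^ ?p" using p by (simp add: power_0_left)
  also have "\<dots> = a ^ ?p + (- a) ^ ?p" by (rule freshmans_dream[OF assms refl])
  finally have neg: "(- a) ^ ?p = - (a ^ ?p)" by (simp add: eq_neg_iff_add_eq_0 add.commute)
  have "(ad a ^^ ?p) P x = (\<Sum>k\<in>{0, ?p}. of_nat (?p choose k) * (- a) ^ (?p - k) * P (a ^ k * x))"
    unfolding ad_funpow by (intro sum.mono_neutral_right) (use zero in auto)
  also have "\<dots> = ad (a ^ ?p) P x"
    using p by (simp add: ad_def neg)
  finally show "(ad a ^^ ?p) P x = ad (a ^ ?p) P x" .
qed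

text \<open>
  \<open>ad a\<close> is the difference of two commuting operators, so its \<open>p ^ e\<close>-th power is the difference
  of theirs.
\<close>

lemma ad_funpow_CHAR_power:
  fixes a :: "'a::comm_ring_1"
  assumes "Factorial_Ring.prime CHAR('a)"
  shows "ad a ^^ (CHAR('a) ^ e) = ad (a ^ (CHAR('a) ^ e))"
proof (induction e)
  case (Suc e)
  have "ad a ^^ (CHAR('a) ^ Suc e) = (ad a ^^ (CHAR('a) ^ e)) ^^ CHAR('a)"
    by (simp only: funpow_mult power_Suc2)
  also have "\<dots> = ad (a ^ (CHAR('a) ^ e)) ^^ CHAR('a)" by (simp only: Suc)
  also have "\<dots> = ad ((a ^ (CHAR('a) ^ e)) ^ CHAR('a))" by (rule ad_funpow_CHAR[OF assms])
  finally show ?case by (simp only: power_mult[symmetric] power_Suc2)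
qed simp

definition subring_set :: "'a::comm_ring_1 set \<Rightarrow> bool" where
  "subring_set S \<longleftrightarrow> 0 \<in> S \<and> 1 \<in> S \<and> (\<forall>x\<in>S. \<forall>y\<in>S. x + y \<in> S \<and> x - y \<in> S \<and> x * y \<in> S)"

lemma subring_setD:
  assumes "subring_set S"
  shows "0 \<in> S" "1 \<in> S" "\<And>x y. x \<in> S \<Longrightarrow> y \<in> S \<Longrightarrow> x + y \<in> S"
    "\<And>x y. x \<in> S \<Longrightarrow> y \<in> S \<Longrightarrow> x - y \<in> S" "\<And>x y. x \<in> S \<Longrightarrow> y \<in> S \<Longrightarrow> x * y \<in> S"
  using assms by (auto simp: subring_set_def)

lemma subring_set_UNIV: "subring_set UNIV"
  by (simp add: subring_set_def)

lemma subring_set_power: "subring_set S \<Longrightarrow> x \<in> S \<Longrightarrow> x ^ n \<in> S"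
  by (induction n) (auto simp: subring_setD)

lemma ad_funpow_cong:
  assumes "subring_set S" "a \<in> S" "\<And>x. x \<in> S \<Longrightarrow> P x = P' x" "x \<in> S"
  shows "(ad a ^^ n) P x = (ad a ^^ n) P' x"
  using assms by (simp add: ad_funpow subring_setD(5) subring_set_power)

lemma ad_funpow_vanishes:
  assumes "subring_set S" "a \<in> S" "P \<in> diff_ops_lt K S m" "m \<le> n" "x \<in> S"
  shows "(ad a ^^ n) P x = 0"
  using assms(3,4)
proof (induction m arbitrary: P n)
  case 0
  then have "\<And>x. x \<in> S \<Longrightarrow> P x = (\<lambda>x. 0) x" by simp
  from ad_funpow_cong[OF assms(1,2) this assms(5)] show ?case by (simp add: ad_funpow)
next
  case (Suc m)
  then obtain n' where n: "n = Suc n'" "m \<le> n'" by (cases n) auto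
  have D: "restrict (ad a P) S \<in> diff_ops_lt K S m"
    using Suc.prems(1) assms(2) by (simp add: ad_def)
  have "(ad a ^^ n) P x = (ad a ^^ n') (ad a P) x"
    by (simp add: n funpow_swap1)
  also have "\<dots> = (ad a ^^ n') (restrict (ad a P) S) x"
    by (rule ad_funpow_cong[OF assms(1,2) _ assms(5)]) simp
  also have "\<dots> = 0" by (rule Suc.IH[OF D n(2)])
  finally show ?case .
qed
text \<open>
  The \<open>p ^ e\<close>-th iterate of \<open>ad a\<close> kills every operator of smaller order, and it is
  \<open>ad (a ^ (p ^ e))\<close>.
\<close>

lemma diff_op_commutes_Frobenius_power:
  fixes a x :: "'a::comm_ring_1"
  assumes "Factorial_Ring.prime CHAR('a)" "subring_set S" "P \<in> diff_ops_lt K S m" "m \<le> CHAR('a) ^ e"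
    and "a \<in> S" "x \<in> S"
  shows "P (a ^ (CHAR('a) ^ e) * x) = a ^ (CHAR('a) ^ e) * P x"
proof -
  have "(ad a ^^ (CHAR('a) ^ e)) P x = 0"
    by (rule ad_funpow_vanishes[OF assms(2,5,3,4,6)])
  then show ?thesis by (simp add: ad_funpow_CHAR_power[OF assms(1)] ad_def)
qed

lemma diff_ops_lt_linear:
  "P \<in> diff_ops_lt K S m \<Longrightarrow> subring_set S \<Longrightarrow> K \<subseteq> S \<Longrightarrow> P \<in> linear_endos K S"
  by (cases m) (auto simp: linear_endos_def subring_setD subsetD)

lemma diff_ops_lt_zero: "subring_set S \<Longrightarrow> K \<subseteq> S \<Longrightarrow> (\<lambda>x\<in>S. 0) \<in> diff_ops_lt K S m"
proof (induction m)
  case (Suc m)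
  then have "(\<lambda>x\<in>S. 0) \<in> linear_endos K S" by (auto simp: linear_endos_def subring_setD subsetD)
  moreover have "(\<lambda>x\<in>S. (\<lambda>x\<in>S. 0) (a * x) - a * (\<lambda>x\<in>S. 0) x) = (\<lambda>x\<in>S. 0)" if "a \<in> S" for a
    using that Suc.prems by (auto simp: fun_eq_iff restrict_def subring_setD)
  ultimately show ?case using Suc by (simp del: restrict_apply)
qed simp

lemma diff_ops_lt_mult_left:
  assumes "subring_set S" "K \<subseteq> S" "s \<in> S" "P \<in> diff_ops_lt K S m"
  shows "(\<lambda>x\<in>S. s * P x) \<in> diff_ops_lt K S m"
  using assms(4)
proof (induction m arbitrary: P)
  case 0
  then show ?case by (auto simp: fun_eq_iff)
next
  case (Suc m)
  have P: "P \<in> linear_endos K S" using Suc.prems by simp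
  have "(\<lambda>x\<in>S. s * P x) \<in> linear_endos K S"
  proof -
    have "s * P (c * x) = c * (s * P x)" if "c \<in> K" "x \<in> S" for c x
      using P that by (simp add: linear_endos_def mult_ac)
    moreover have "s * P (x + y) = s * P x + s * P y" if "x \<in> S" "y \<in> S" for x y
      using P that by (simp add: linear_endos_def algebra_simps)
    moreover have "c * x \<in> S" if "c \<in> K" "x \<in> S" for c x
      using that assms by (auto simp: subring_setD)
    moreover have "s * P x \<in> S" if "x \<in> S" for x
      using that assms P by (auto simp: linear_endos_def subring_setD PiE_iff)
    ultimately show ?thesis using assms
      by (simp add: linear_endos_def subring_setD)
  qed
  moreover have "(\<lambda>x\<in>S. (\<lambda>x\<in>S. s * P x) (a * x) - a * (\<lambda>x\<in>S. s * P x) x) \<in> diff_ops_lt K S m" if "a \<in> S" for a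
  proof -
    have "(\<lambda>x\<in>S. P (a * x) - a * P x) \<in> diff_ops_lt K S m" using Suc.prems that by simp
    from Suc.IH[OF this] have "(\<lambda>x\<in>S. s * (\<lambda>x\<in>S. P (a * x) - a * P x) x) \<in> diff_ops_lt K S m" .
    also have "(\<lambda>x\<in>S. s * (\<lambda>x\<in>S. P (a * x) - a * P x) x) =
        (\<lambda>x\<in>S. (\<lambda>x\<in>S. s * P x) (a * x) - a * (\<lambda>x\<in>S. s * P x) x)"
      using that assms by (auto simp: fun_eq_iff algebra_simps subring_setD)
    finally show ?thesis .
  qed
  ultimately show ?case by (simp del: restrict_apply)
qed

lemma linear_endos_UNIV_iff:
  "P \<in> linear_endos K UNIV \<longleftrightarrow> (\<forall>x y. P (x + y) = P x + P y) \<and> (\<forall>c\<in>K. \<forall>x. P (c * x) = c * P x)"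
  by (auto simp: linear_endos_def)

lemma diff_ops_lt_UNIV_Suc:
  "P \<in> diff_ops_lt K UNIV (Suc m) \<longleftrightarrow>
     P \<in> linear_endos K UNIV \<and> (\<forall>a. ad a P \<in> diff_ops_lt K UNIV m)"
  by (simp add: ad_def)

lemma diff_ops_lt_add:
  assumes "P \<in> diff_ops_lt K UNIV m" "Q \<in> diff_ops_lt K UNIV m"
  shows "(\<lambda>x. P x + Q x) \<in> diff_ops_lt K UNIV m"
  using assms
proof (induction m arbitrary: P Q)
  case 0
  then show ?case by simp
next
  case (Suc m)
  have "ad a (\<lambda>x. P x + Q x) = (\<lambda>x. ad a P x + ad a Q x)" for a
    by (auto simp: ad_def algebra_simps)
  then show ?case
    using Suc unfolding diff_ops_lt_UNIV_Suc linear_endos_UNIV_iff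
    by (auto simp: algebra_simps)
qed

lemma diff_ops_lt_mult_right:
  assumes "P \<in> diff_ops_lt K UNIV m"
  shows "(\<lambda>x. P (s * x)) \<in> diff_ops_lt K UNIV m"
  using assms
proof (induction m arbitrary: P)
  case 0
  then show ?case by simp
next
  case (Suc m)
  have "ad a (\<lambda>x. P (s * x)) = (\<lambda>x. ad a P (s * x))" for a
    by (auto simp: ad_def algebra_simps)
  then show ?case
    using Suc unfolding diff_ops_lt_UNIV_Suc linear_endos_UNIV_iff
    by (auto simp: algebra_simps)
qed
text \<open>
  For a given bound the elements \<open>a\<close> for which \<open>ad a P\<close> obeys it form a ring, so it suffices to
  look at generators. As the operations \<open>ad v\<close> commute with each other, each application of one of
  them lowers one of the exponents \<open>\<mu> v\<close> by one.
\<close>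

lemma diff_ops_lt_from_generators:
  assumes "finite V" "V \<noteq> {}" "K \<subseteq> L"
    and gen: "\<And>C. (\<And>x y. x \<in> C \<Longrightarrow> y \<in> C \<Longrightarrow> x + y \<in> C) \<Longrightarrow> (\<And>x y. x \<in> C \<Longrightarrow> y \<in> C \<Longrightarrow> x * y \<in> C)
               \<Longrightarrow> L \<subseteq> C \<Longrightarrow> V \<subseteq> C \<Longrightarrow> C = UNIV"
    and add: "\<And>x y. P (x + y) = P x + P y" and lin: "\<And>c x. c \<in> L \<Longrightarrow> P (c * x) = c * P x"
    and nil: "\<And>v. v \<in> V \<Longrightarrow> (ad v ^^ \<mu> v) P = (\<lambda>x. 0)"
  shows "P \<in> diff_ops_lt K UNIV (sum \<mu> V)"
  using add lin nil
proof (induction "sum \<mu> V" arbitrary: P \<mu> rule: less_induct)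
  case (less \<mu> P)
  note add = less.prems(1) and lin = less.prems(2) and nil = less.prems(3)
  show ?case
  proof (cases "\<exists>v\<in>V. \<mu> v = 0")
    case True
    then have "P = (\<lambda>x\<in>UNIV. 0)" using nil by fastforce
    then show ?thesis using diff_ops_lt_zero[OF subring_set_UNIV, of K] by simp
  next
    case False
    obtain v0 where "v0 \<in> V" using assms(2) by blast
    then have "sum \<mu> V \<noteq> 0" using False assms(1) by auto
    then obtain N where N: "sum \<mu> V = Suc N" using not0_implies_Suc by blast
    define C where "C = {a. ad a P \<in> diff_ops_lt K UNIV N}"
    have "C = UNIV"
    proof (rule gen)
      show "x + y \<in> C" if "x \<in> C" "y \<in> C" for x y
      proof -
        have "ad (x + y) P = (\<lambda>u. ad x P u + ad y P u)"
          by (auto simp: ad_def algebra_simps add)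
        then show ?thesis using that diff_ops_lt_add unfolding C_def by fastforce
      qed
      show "x * y \<in> C" if "x \<in> C" "y \<in> C" for x y
      proof -
        have "ad (x * y) P = (\<lambda>u. ad x P (y * u) + x * ad y P u)"
          by (auto simp: ad_def algebra_simps add)
        moreover have "(\<lambda>u. ad x P (y * u)) \<in> diff_ops_lt K UNIV N"
          using that(1) diff_ops_lt_mult_right unfolding C_def by fastforce
        moreover have "(\<lambda>u. x * ad y P u) \<in> diff_ops_lt K UNIV N"
          using that(2) diff_ops_lt_mult_left[OF subring_set_UNIV, of K x "ad y P" N] unfolding C_def by simp
        ultimately show ?thesis using diff_ops_lt_add unfolding C_def by fastforce
      qed
      show "L \<subseteq> C"
      proof
        fix c assume "c \<in> L"
        then have "ad c P = (\<lambda>x\<in>UNIV. 0)" by (auto simp: ad_def lin)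
        then show "c \<in> C" using diff_ops_lt_zero[OF subring_set_UNIV, of K] by (simp add: C_def)
      qed
      show "V \<subseteq> C"
      proof
        fix v assume v: "v \<in> V"
        let ?\<mu> = "\<mu>(v := \<mu> v - 1)"
        have pos: "\<mu> v > 0" using False v by simp
        have "sum \<mu> V = sum \<mu> (V - {v}) + \<mu> v"
          using assms(1) v by (simp add: sum.remove add.commute)
        moreover have "sum ?\<mu> V = sum ?\<mu> (V - {v}) + ?\<mu> v"
          using assms(1) v by (simp add: sum.remove add.commute)
        moreover have "sum ?\<mu> (V - {v}) = sum \<mu> (V - {v})" by (intro sum.cong) auto
        ultimately have sumN: "sum ?\<mu> V = N" using N pos by simp
        have comm: "ad v (ad w Q) = ad w (ad v Q)" for w and Q :: "'a \<Rightarrow> 'a"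
          by (auto simp: ad_def algebra_simps)
        have comm': "(ad w ^^ n) (ad v P) = ad v ((ad w ^^ n) P)" for w n
          by (induction n) (auto simp: comm)
        have "ad v P \<in> diff_ops_lt K UNIV (sum ?\<mu> V)"
        proof (rule less.hyps)
          show "sum ?\<mu> V < sum \<mu> V" using sumN N by simp
          show "ad v P (x + y) = ad v P x + ad v P y" for x y
            by (simp add: ad_def algebra_simps add)
          show "ad v P (c * x) = c * ad v P x" if "c \<in> L" for c x
          proof -
            have "P (v * (c * x)) = c * P (v * x)" using lin[OF that, of "v * x"] by (simp add: mult_ac)
            then show ?thesis using lin[OF that, of x] by (simp add: ad_def algebra_simps)
          qed
          show "(ad w ^^ ?\<mu> w) (ad v P) = (\<lambda>x. 0)" if w: "w \<in> V" for w
          proof (cases "w = v")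
            case True
            have "(ad v ^^ (\<mu> v - 1)) (ad v P) = (ad v ^^ Suc (\<mu> v - 1)) P"
              by (simp only: comm' funpow.simps o_apply)
            then show ?thesis using nil[OF v] True pos by simp
          next
            case False
            then have "(ad w ^^ ?\<mu> w) (ad v P) = ad v (\<lambda>x. 0)"
              using nil[OF w] by (simp add: comm')
            then show ?thesis by (simp add: ad_def)
          qed
        qed
        then show "v \<in> C" by (simp only: C_def mem_Collect_eq sumN)
      qed
    qed
    then show ?thesis
      using add lin assms(3) unfolding N diff_ops_lt_UNIV_Suc linear_endos_UNIV_iff
      by (auto simp: C_def)
  qed
qed

section \<open>Extension to a localisation\<close>

definition localisation :: "'a::idom \<Rightarrow> 'a fract set" where
  "localisation h = {Fract a (h ^ m) | a m. True}"
text \<open>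
  Over the denominators \<open>h ^ (n * q)\<close> an operator that commutes with \<open>h ^ q\<close> acts on the numerators.
\<close>

definition loc_ext :: "nat \<Rightarrow> 'a::idom \<Rightarrow> ('a \<Rightarrow> 'a) \<Rightarrow> 'a fract \<Rightarrow> 'a fract" where
  "loc_ext q h P = (\<lambda>u\<in>localisation h.
     THE v. \<exists>b n. u = Fract b (h ^ (n * q)) \<and> v = Fract (P b) (h ^ (n * q)))"

lemma localisation_common_denominator:
  assumes "q > 0" "h \<noteq> 0" "x \<in> localisation h"
  obtains b n where "x = Fract b (h ^ (n * q))"
proof -
  obtain a m where x: "x = Fract a (h ^ m)" using assms(3) by (auto simp: localisation_def)
  have "m * q = m + (m * q - m)" using assms(1) by simp
  then have "h ^ (m * q) = h ^ m * h ^ (m * q - m)" by (metis power_add)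
  then have "x = Fract (a * h ^ (m * q - m)) (h ^ (m * q))"
    using assms(2) by (simp add: x eq_fract)
  then show ?thesis by (rule that)
qed

lemma localisation_common_denominators:
  assumes "q > 0" "h \<noteq> 0" "x \<in> localisation h" "y \<in> localisation h"
  obtains b c n where "x = Fract b (h ^ (n * q))" "y = Fract c (h ^ (n * q))"
proof -
  obtain b n where x: "x = Fract b (h ^ (n * q))"
    by (rule localisation_common_denominator[OF assms(1-3)])
  obtain c m where y: "y = Fract c (h ^ (m * q))"
    by (rule localisation_common_denominator[OF assms(1,2,4)])
  have "x = Fract (b * h ^ (m * q)) (h ^ ((n + m) * q))" "y = Fract (c * h ^ (n * q)) (h ^ ((n + m) * q))"
    using assms(2) by (simp_all add: x y eq_fract add_mult_distrib power_add)
  then show ?thesis by (rule that)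
qed

lemma subring_set_localisation:
  assumes "h \<noteq> 0" shows "subring_set (localisation h)"
proof -
  have "x + y \<in> localisation h \<and> x - y \<in> localisation h \<and> x * y \<in> localisation h"
    if xy: "x \<in> localisation h" "y \<in> localisation h" for x y
  proof -
    obtain b c n where "x = Fract b (h ^ (n * 1))" "y = Fract c (h ^ (n * 1))"
      by (rule localisation_common_denominators[OF zero_less_one assms xy])
    then have "x + y = Fract (b + c) (h ^ n)" "x - y = Fract (b - c) (h ^ n)"
        "x * y = Fract (b * c) (h ^ (n + n))"
      using assms by (simp_all add: eq_fract power_add algebra_simps)
    then show ?thesis unfolding localisation_def by blast
  qed
  moreover have "0 = Fract 0 (h ^ 0)" "1 = Fract 1 (h ^ 0)"
    by (simp_all add: Zero_fract_def One_fract_def)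
  ultimately show ?thesis unfolding subring_set_def localisation_def by blast
qed

lemma Fract_1_in_localisation: "Fract a 1 \<in> localisation h"
  unfolding localisation_def using power_0[of h] by (metis (mono_tags, lifting) mem_Collect_eq)

lemma Fract_in_localisation: "Fract a (h ^ m) \<in> localisation h"
  unfolding localisation_def by auto

lemma commutes_power:
  fixes h :: "'a::comm_ring_1"
  assumes "\<And>x. P (h ^ q * x) = h ^ q * P x"
  shows "P (h ^ (n * q) * x) = h ^ (n * q) * P x"
proof (induction n)
  case (Suc n)
  have "P (h ^ (Suc n * q) * x) = P (h ^ q * (h ^ (n * q) * x))"
    by (simp add: power_add mult.assoc)
  then show ?case by (simp add: assms Suc power_add mult.assoc)
qed simp

lemma loc_ext_Fract:
  assumes "h \<noteq> 0" "\<And>x. P (h ^ q * x) = h ^ q * P x"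
  shows "loc_ext q h P (Fract b (h ^ (n * q))) = Fract (P b) (h ^ (n * q))"
proof -
  have "(THE v. \<exists>c m. Fract b (h ^ (n * q)) = Fract c (h ^ (m * q)) \<and> v = Fract (P c) (h ^ (m * q)))
      = Fract (P b) (h ^ (n * q))"
  proof (rule the_equality)
    fix v assume "\<exists>c m. Fract b (h ^ (n * q)) = Fract c (h ^ (m * q)) \<and> v = Fract (P c) (h ^ (m * q))"
    then obtain c m where *: "Fract b (h ^ (n * q)) = Fract c (h ^ (m * q))" "v = Fract (P c) (h ^ (m * q))"
      by blast
    from *(1) have "h ^ (m * q) * b = h ^ (n * q) * c"
      using assms(1) by (simp add: eq_fract mult.commute)
    then have "h ^ (m * q) * P b = h ^ (n * q) * P c"
      by (metis commutes_power[of P h q, OF assms(2)])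
    then show "v = Fract (P b) (h ^ (n * q))"
      using assms(1) by (simp add: *(2) eq_fract mult.commute)
  qed blast
  then show ?thesis by (simp add: loc_ext_def Fract_in_localisation)
qed

lemma loc_ext_linear:
  assumes h: "h \<noteq> 0" and q: "q > 0" and comm: "\<And>x. P (h ^ q * x) = h ^ q * P x"
    and P: "P \<in> linear_endos K UNIV"
  shows "loc_ext q h P \<in> linear_endos ((\<lambda>c. Fract c 1) ` K) (localisation h)"
proof -
  note ext = loc_ext_Fract[of h P q, OF h comm]
  have closed: "loc_ext q h P x \<in> localisation h" if "x \<in> localisation h" for x
    by (rule localisation_common_denominator[OF q h that]) (simp add: ext Fract_in_localisation)
  have add: "loc_ext q h P (x + y) = loc_ext q h P x + loc_ext q h P y"
    if xy: "x \<in> localisation h" "y \<in> localisation h" for x y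
  proof -
    obtain b c n where *: "x = Fract b (h ^ (n * q))" "y = Fract c (h ^ (n * q))"
      by (rule localisation_common_denominators[OF q h xy])
    have sum: "Fract b (h ^ (n * q)) + Fract c (h ^ (n * q)) = Fract (b + c) (h ^ (n * q))" for b c
      using h by (simp add: eq_fract algebra_simps)
    show ?thesis using P unfolding * sum ext by (simp add: linear_endos_def sum)
  qed
  have scal: "loc_ext q h P (Fract c 1 * x) = Fract c 1 * loc_ext q h P x"
    if x: "x \<in> localisation h" and c: "c \<in> K" for x c
  proof -
    obtain b n where *: "x = Fract b (h ^ (n * q))"
      by (rule localisation_common_denominator[OF q h x])
    show ?thesis using P c unfolding * by (simp add: ext linear_endos_def)
  qed
  show ?thesis
    using closed add scal by (auto simp: linear_endos_def loc_ext_def)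
qed
text \<open>
  The commutator of the extension with \<open>b / h ^ (n * q)\<close> is the extension of the commutator
  with \<open>b\<close>, divided by \<open>h ^ (n * q)\<close>.
\<close>

lemma loc_ext_diff_op:
  assumes h: "h \<noteq> 0" and q: "q > 0" and comm: "\<And>x. P (h ^ q * x) = h ^ q * P x"
    and P: "P \<in> diff_ops_lt K UNIV m"
  shows "loc_ext q h P \<in> diff_ops_lt ((\<lambda>c. Fract c 1) ` K) (localisation h) m"
  using comm P
proof (induction m arbitrary: P)
  case 0
  have "loc_ext q h P x = 0" if "x \<in> localisation h" for x
    by (rule localisation_common_denominator[OF q h that])
       (use 0 h in \<open>simp add: loc_ext_Fract Zero_fract_def eq_fract\<close>)
  then show ?case by (auto simp: loc_ext_def)
next
  case (Suc m)
  let ?S = "localisation h" and ?K = "(\<lambda>c. Fract c 1) ` K"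
  note ext = loc_ext_Fract[of h P q, OF h Suc.prems(1)]
  have sub: "?K \<subseteq> ?S" by (auto simp: Fract_1_in_localisation)
  have "(\<lambda>x\<in>?S. loc_ext q h P (u * x) - u * loc_ext q h P x) \<in> diff_ops_lt ?K ?S m"
    if uS: "u \<in> ?S" for u
  proof -
    obtain b n where u: "u = Fract b (h ^ (n * q))"
      by (rule localisation_common_denominator[OF q h uS])
    have D: "ad b P \<in> diff_ops_lt K UNIV m" using Suc.prems(2) unfolding diff_ops_lt_UNIV_Suc by blast
    have comm: "ad b P (h ^ q * x) = h ^ q * ad b P x" for x
      using Suc.prems(1)[of "b * x"] Suc.prems(1)[of x] by (simp add: ad_def algebra_simps)
    have "(\<lambda>x\<in>?S. Fract 1 (h ^ (n * q)) * loc_ext q h (ad b P) x) \<in> diff_ops_lt ?K ?S m"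
      by (rule diff_ops_lt_mult_left[OF subring_set_localisation[OF h] sub Fract_in_localisation
            Suc.IH[OF comm D]])
    also have "(\<lambda>x\<in>?S. Fract 1 (h ^ (n * q)) * loc_ext q h (ad b P) x) =
        (\<lambda>x\<in>?S. loc_ext q h P (u * x) - u * loc_ext q h P x)"
    proof (intro restrict_ext)
      fix x assume xS: "x \<in> ?S"
      obtain c k where x: "x = Fract c (h ^ (k * q))"
        by (rule localisation_common_denominator[OF q h xS])
      have ux: "u * x = Fract (b * c) (h ^ ((n + k) * q))"
        by (simp add: u x add_mult_distrib power_add)
      have "loc_ext q h P (u * x) - u * loc_ext q h P x = Fract (ad b P c) (h ^ ((n + k) * q))"
      proof -
        have "loc_ext q h P (u * x) = Fract (P (b * c)) (h ^ ((n + k) * q))"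
          unfolding ux by (rule ext)
        moreover have "u * loc_ext q h P x = Fract (b * P c) (h ^ ((n + k) * q))"
          unfolding x ext by (simp add: u add_mult_distrib power_add)
        ultimately show ?thesis using h by (simp add: ad_def eq_fract algebra_simps)
      qed
      then show "Fract 1 (h ^ (n * q)) * loc_ext q h (ad b P) x = loc_ext q h P (u * x) - u * loc_ext q h P x"
        unfolding x by (simp add: loc_ext_Fract[of h "ad b P" q, OF h comm] add_mult_distrib power_add)
    qed
    finally show ?thesis .
  qed
  then show ?case
    using loc_ext_linear[of h q P K, OF h q Suc.prems(1)] Suc.prems(2) by (simp del: restrict_apply)
qed

lemma CHAR_fract [simp]: "CHAR('a::idom fract) = CHAR('a)"
proof (rule CHAR_eqI)
  show "of_nat CHAR('a) = (0 :: 'a fract)"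
    by (simp add: of_nat_fract Zero_fract_def)
  fix n assume "of_nat n = (0 :: 'a fract)"
  then have "of_nat n = (0::'a)" by (simp add: of_nat_fract Zero_fract_def eq_fract)
  then show "CHAR('a) dvd n" by (simp add: of_nat_eq_0_iff_char_dvd)
qed

text \<open>
  An operator on the localisation commutes with a high Frobenius power of \<open>h\<close>, so its values on the
  original ring determine it.
\<close>

lemma loc_ext_unique:
  fixes h :: "'a::idom"
  assumes p: "Factorial_Ring.prime CHAR('a)" and h: "h \<noteq> 0" and q: "q = CHAR('a) ^ e"
    and comm: "\<And>x. P (h ^ q * x) = h ^ q * P x"
    and Q: "Q \<in> diff_ops ((\<lambda>c. Fract c 1) ` K) (localisation h)"
    and QP: "\<And>a. Q (Fract a 1) = Fract (P a) 1"
  shows "Q = loc_ext q h P"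
proof
  fix u
  let ?S = "localisation h" and ?p = "CHAR('a)"
  have q0: "q > 0" using p q by (simp add: prime_gt_0_nat)
  have sub: "(\<lambda>c. Fract c 1) ` K \<subseteq> ?S" by (auto simp: Fract_1_in_localisation)
  obtain m where Qm: "Q \<in> diff_ops_lt ((\<lambda>c. Fract c 1) ` K) ?S m"
    using Q by (auto simp: diff_ops_def)
  show "Q u = loc_ext q h P u"
  proof (cases "u \<in> ?S")
    case False
    then show ?thesis
      using diff_ops_lt_linear[OF Qm subring_set_localisation[OF h] sub]
      by (auto simp: linear_endos_def loc_ext_def)
  next
    case True
    obtain b n where u: "u = Fract b (h ^ (n * q))"
      by (rule localisation_common_denominator[OF q0 h True])
    have "m < ?p ^ m" using p by (intro power_gt_expt) (simp add: prime_gt_Suc_0_nat)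
    also have "\<dots> \<le> ?p ^ (e + m)" using p by (intro power_increasing) (simp_all add: Suc_le_eq prime_gt_0_nat)
    finally have m: "m \<le> CHAR('a fract) ^ (e + m)" by simp
    define r where "r = ?p ^ m"
    have r: "?p ^ (e + m) = r * q" "r > 0" using p by (simp_all add: r_def q power_add prime_gt_0_nat)
    have pw: "Fract (h ^ i) 1 ^ j = Fract (h ^ (i * j)) 1" for i j
      by (induction j) (simp_all add: One_fract_def power_add)
    have Hu: "Fract (h ^ (n * (r * q))) 1 * u = Fract (h ^ ((n * (r - 1)) * q) * b) 1"
    proof -
      have "n * (r * q) = n * q + (n * (r - 1)) * q" using r(2)
        by (cases r) (simp_all add: algebra_simps)
      then show ?thesis using h by (simp add: u eq_fract power_add)
    qed
    have "Q (Fract (h ^ n) 1 ^ (CHAR('a fract) ^ (e + m)) * u) = Fract (h ^ n) 1 ^ (CHAR('a fract) ^ (e + m)) * Q u"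
      by (rule diff_op_commutes_Frobenius_power[OF _ subring_set_localisation[OF h] Qm m])
         (simp_all add: p Fract_1_in_localisation True)
    then have "Fract (h ^ (n * (r * q))) 1 * Q u = Q (Fract (h ^ (n * (r * q))) 1 * u)"
      by (simp add: pw r)
    also have "\<dots> = Fract (h ^ ((n * (r - 1)) * q) * P b) 1"
      by (simp add: Hu QP commutes_power[of P h q, OF comm])
    also have "\<dots> = Fract (h ^ (n * (r * q))) 1 * Fract (P b) (h ^ (n * q))"
    proof -
      have "n * (r * q) = n * q + (n * (r - 1)) * q" using r(2)
        by (cases r) (simp_all add: algebra_simps)
      then show ?thesis using h by (simp add: eq_fract power_add)
    qed
    also have "Fract (P b) (h ^ (n * q)) = loc_ext q h P u"
      unfolding u by (rule loc_ext_Fract[of h P q, OF h comm, symmetric])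
    finally show ?thesis
      using h by (simp add: Zero_fract_def eq_fract)
  qed
qed

section \<open>Binomial functions in characteristic \<open>p\<close>\<close>

lemma coeff_one_plus_X_power:
  "Polynomial.coeff ([:1, 1:] ^ n) k = (of_nat (n choose k) :: 'a::comm_ring_1)"
proof (induction n arbitrary: k)
  case 0
  then show ?case by (cases k) auto
next
  case (Suc n)
  have "[:1, 1:] ^ Suc n = ([:1, 1:] ^ n + pCons 0 ([:1, 1:] ^ n) :: 'a poly)" by simp
  then show ?case by (cases k) (simp_all only: coeff_add coeff_pCons_0 coeff_pCons_Suc Suc binomial_n_0 binomial_Suc_Suc of_nat_add, simp_all add: add.commute)
qed
text \<open>
  Compare coefficients in \<open>(1 + X) ^ (l + q) = (1 + X) ^ l * (1 + X ^ q)\<close>.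
\<close>

lemma choose_add_CHAR_power:
  fixes q :: nat
  assumes "Factorial_Ring.prime CHAR('a::comm_ring_1)" and q: "q = CHAR('a) ^ e"
  shows "(of_nat ((l + q) choose k) :: 'a) =
    of_nat (l choose k) + (if q \<le> k then of_nat (l choose (k - q)) else 0)"
proof -
  have "[:1, 1:] ^ q = ([:1:] ^ q + [:0, 1:] ^ q :: 'a poly)"
    using freshmans_dream'[of q e "[:1:] :: 'a poly" "[:0,1:]"] assms by simp
  then have "[:1, 1:] ^ q = (1 + Polynomial.monom 1 q :: 'a poly)"
    by (simp add: monom_altdef flip: one_pCons)
  then have "[:1, 1:] ^ (l + q) = ([:1, 1:] ^ l + Polynomial.monom 1 q * [:1, 1:] ^ l :: 'a poly)"
    by (simp only: power_add) (simp add: algebra_simps)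
  then have "Polynomial.coeff ([:1, 1:] ^ (l + q)) k =
     (Polynomial.coeff ([:1, 1:] ^ l) k + Polynomial.coeff (Polynomial.monom 1 q * [:1, 1:] ^ l) k :: 'a)"
    by (simp only: coeff_add)
  then show ?thesis by (simp add: coeff_one_plus_X_power coeff_monom_mult)
qed
text \<open>
  The case of Lucas' theorem that says that \<open>binom_fun (p ^ e)\<close> is the \<open>e\<close>-th digit.
\<close>

lemma choose_CHAR_power:
  fixes q :: nat
  assumes "Factorial_Ring.prime CHAR('a::comm_ring_1)" and q: "q = CHAR('a) ^ e"
  shows "(of_nat (l choose q) :: 'a) = of_nat (l div q)"
proof (induction l rule: less_induct)
  case (less l)
  have q0: "q > 0" using assms by (simp add: prime_gt_0_nat)
  show ?case
  proof (cases "l < q")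
    case True
    then show ?thesis by (simp add: binomial_eq_0)
  next
    case False
    then have "(of_nat (l choose q) :: 'a) = of_nat ((l - q) choose q) + 1"
      using choose_add_CHAR_power[OF assms, of "l - q" q] by simp
    also have "of_nat ((l - q) choose q) = (of_nat ((l - q) div q) :: 'a)"
      using less False q0 by simp
    finally show ?thesis using False q0 by (simp add: le_div_geq add.commute)
  qed
qed

definition periodic :: "nat \<Rightarrow> (nat \<Rightarrow> 'b) \<Rightarrow> bool" where
  "periodic q \<phi> \<longleftrightarrow> (\<forall>l. \<phi> (l + q) = \<phi> l)"

lemma periodic_mult: assumes "periodic q \<phi>" shows "\<phi> (l + q * m) = \<phi> l"
proof (induction m)
  case (Suc m)
  have "\<phi> (l + q * Suc m) = \<phi> ((l + q * m) + q)" by (simp add: add_ac)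
  then show ?case using Suc assms by (simp add: periodic_def)
qed simp

lemma periodic_mod: assumes "periodic q \<phi>" shows "\<phi> (l mod q) = \<phi> l"
  using periodic_mult[OF assms, of "l mod q" "l div q"] by simp

lemma periodic_cong: "periodic q \<phi> \<Longrightarrow> l mod q = m mod q \<Longrightarrow> \<phi> l = \<phi> m"
  by (metis periodic_mod)

lemma periodic_dvd: "periodic q \<phi> \<Longrightarrow> q dvd r \<Longrightarrow> periodic r \<phi>"
  by (auto simp: periodic_def periodic_mult elim!: dvdE)

lemma cring_fun_ring: "cring (fun_ring :: (nat \<Rightarrow> 'k::field) ring)"
proof (rule cringI)
  show "abelian_group (fun_ring :: (nat \<Rightarrow> 'k) ring)"
  proof (rule abelian_groupI)
    fix \<phi> :: "nat \<Rightarrow> 'k"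
    show "\<exists>\<psi>\<in>carrier fun_ring. \<psi> \<oplus>\<^bsub>fun_ring\<^esub> \<phi> = \<zero>\<^bsub>fun_ring\<^esub>"
      by (rule bexI[of _ "\<lambda>l. - \<phi> l"]) (auto simp: fun_ring_def)
  qed (auto simp: fun_ring_def add_ac)
  show "Group.comm_monoid (fun_ring :: (nat \<Rightarrow> 'k) ring)"
    by (rule comm_monoidI) (auto simp: fun_ring_def mult_ac)
qed (auto simp: fun_ring_def algebra_simps)

lemma a_inv_fun_ring: "\<ominus>\<^bsub>fun_ring\<^esub> (\<phi> :: nat \<Rightarrow> 'k::field) = (\<lambda>l. - \<phi> l)"
proof -
  interpret cring "fun_ring :: (nat \<Rightarrow> 'k) ring" by (rule cring_fun_ring)
  show ?thesis by (rule minus_equality) (auto simp: fun_ring_def)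
qed

lemma cring_A_ring: "cring (A_ring :: (nat \<Rightarrow> 'k::field) ring)"
proof -
  interpret cring "fun_ring :: (nat \<Rightarrow> 'k) ring" by (rule cring_fun_ring)
  have "range (\<lambda>c l. c) \<union> range binom_fun \<subseteq> carrier (fun_ring :: (nat \<Rightarrow> 'k) ring)"
    by (simp add: fun_ring_def)
  from generate_ring_is_ring[OF this] interpret A: ring "A_ring :: (nat \<Rightarrow> 'k) ring"
    by (simp add: A_ring_def)
  show ?thesis
    by (rule cring.intro[OF A.ring_axioms], rule A.monoid_comm_monoidI)
      (simp add: A_ring_def fun_ring_def mult.commute)
qed

lemma A_ring_simps:
  "\<phi> \<oplus>\<^bsub>A_ring\<^esub> \<psi> = (\<lambda>l. \<phi> l + \<psi> l)" "\<phi> \<otimes>\<^bsub>A_ring\<^esub> \<psi> = (\<lambda>l. \<phi> l * \<psi> l)"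
  "\<zero>\<^bsub>A_ring\<^esub> = (\<lambda>l. 0)" "\<one>\<^bsub>A_ring\<^esub> = (\<lambda>l. 1)"
  by (simp_all add: A_ring_def fun_ring_def)
text \<open>
  Sorting its arguments by their \<open>e\<close>-th digit, a function of period \<open>p ^ (e + 1)\<close> is a combination
  of functions of period \<open>p ^ e\<close> and indicator functions of that digit, and these indicator
  functions are polynomials in \<open>binom_fun (p ^ e)\<close>.
\<close>

lemma periodic_closed_under_generators:
  fixes \<phi> :: "nat \<Rightarrow> 'k::field"
  assumes p: "Factorial_Ring.prime CHAR('k)"
    and const: "\<And>c. (\<lambda>l. c) \<in> C" and binom: "\<And>e. binom_fun (CHAR('k) ^ e) \<in> C"
    and add: "\<And>\<phi> \<psi>. \<phi> \<in> C \<Longrightarrow> \<psi> \<in> C \<Longrightarrow> (\<lambda>l. \<phi> l + \<psi> l) \<in> C"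
    and mult: "\<And>\<phi> \<psi>. \<phi> \<in> C \<Longrightarrow> \<psi> \<in> C \<Longrightarrow> (\<lambda>l. \<phi> l * \<psi> l) \<in> C"
    and per: "periodic (CHAR('k) ^ e) \<phi>"
  shows "\<phi> \<in> C"
  using per
proof (induction e arbitrary: \<phi>)
  case 0
  then have "\<phi> l = \<phi> 0" for l using periodic_mod[of 1 \<phi> l] by simp
  then have "\<phi> = (\<lambda>l. \<phi> 0)" by blast
  then show ?case using const by metis
next
  case (Suc e)
  let ?p = "CHAR('k)" and ?q = "CHAR('k) ^ e"
  have p0: "?p > 0" using p by (simp add: prime_gt_0_nat)
  have sum: "(\<lambda>l. \<Sum>i\<in>I. F i l) \<in> C" if "\<And>i. i \<in> I \<Longrightarrow> F i \<in> C" for I :: "nat set" and F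
    using that by (induction I rule: infinite_finite_induct) (auto intro: const add)
  have prod: "(\<lambda>l. \<Prod>i\<in>I. F i l) \<in> C" if "\<And>i. i \<in> I \<Longrightarrow> F i \<in> C" for I :: "nat set" and F
    using that by (induction I rule: infinite_finite_induct) (auto intro: const mult)
  \<comment> \<open>the indicator function of the residues with \<open>e\<close>-th digit \<open>d\<close>, by Lagrange interpolation\<close>
  define ind where "ind d l = (\<Prod>d'\<in>{..<?p} - {d}. (binom_fun ?q l + - of_nat d') * inverse (of_nat d - of_nat d' :: 'k))"
    for d l
  have ind_C: "ind d \<in> C" for d
    unfolding ind_def by (intro prod mult add const binom)
  have inj: "of_nat d = (of_nat d' :: 'k) \<longleftrightarrow> d mod ?p = d' mod ?p" for d d'
    using of_nat_eq_iff_cong_CHAR[where ?'a = 'k] by (simp add: Cong.cong_def)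
  have ind: "ind d l = (if l div ?q mod ?p = d then 1 else 0)" if "d < ?p" for d l
  proof -
    let ?a = "l div ?q mod ?p"
    have a: "binom_fun ?q l = (of_nat ?a :: 'k)" "?a < ?p"
      using choose_CHAR_power[OF p refl, of l e] inj[of "l div ?q" ?a] p0 by (simp_all add: binom_fun_def)
    show ?thesis
    proof (cases "?a = d")
      case True
      have "(of_nat d + - of_nat d') * inverse (of_nat d - of_nat d' :: 'k) = 1" if "d' \<in> {..<?p} - {d}" for d'
        using inj[of d d'] that \<open>d < ?p\<close> by simp
      then show ?thesis unfolding ind_def a(1) using True by simp
    next
      case False
      then have "ind d l = 0" unfolding ind_def a(1)
        using a(2) by (intro prod_zero) (auto intro!: bexI[of _ ?a])
      then show ?thesis using False by simp
    qed
  qed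
  have "\<phi> = (\<lambda>l. \<Sum>d<?p. ind d l * \<phi> (l mod ?q + d * ?q))"
  proof
    fix l
    let ?a = "l div ?q mod ?p"
    have "(\<Sum>d<?p. ind d l * \<phi> (l mod ?q + d * ?q)) = (\<Sum>d<?p. if d = ?a then \<phi> (l mod ?q + d * ?q) else 0)"
      by (intro sum.cong) (auto simp: ind)
    also have "\<dots> = \<phi> (l mod ?q + ?a * ?q)" using p0 by simp
    also have "l mod ?q + ?a * ?q = l mod (?p ^ Suc e)"
      using mod_mult2_eq[of l ?q ?p] by (simp add: ac_simps)
    also have "\<phi> (l mod (?p ^ Suc e)) = \<phi> l" by (rule periodic_mod[OF Suc.prems])
    finally show "\<phi> l = (\<Sum>d<?p. ind d l * \<phi> (l mod ?q + d * ?q))" by simp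
  qed
  also have "\<dots> \<in> C"
    by (intro sum mult ind_C Suc.IH) (simp add: periodic_def)
  finally show ?case .
qed
text \<open>
  These are the locally constant functions on the \<open>p\<close>-adic integers, restricted to the dense subset
  of natural numbers.
\<close>

lemma carrier_A_ring:
  assumes p: "Factorial_Ring.prime CHAR('k::field)"
  shows "(\<phi> :: nat \<Rightarrow> 'k) \<in> carrier A_ring \<longleftrightarrow> (\<exists>e. periodic (CHAR('k) ^ e) \<phi>)"
proof
  let ?p = "CHAR('k)"
  have common: "\<exists>e. periodic (?p ^ e) \<phi> \<and> periodic (?p ^ e) \<psi>"
    if "periodic (?p ^ e1) \<phi>" "periodic (?p ^ e2) \<psi>" for \<phi> \<psi> :: "nat \<Rightarrow> 'k" and e1 e2
    using that by (meson le_imp_power_dvd max.cobounded1 max.cobounded2 periodic_dvd)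
  assume "\<phi> \<in> carrier A_ring"
  then have "\<phi> \<in> generate_ring fun_ring (range (\<lambda>c l. c) \<union> range binom_fun)"
    by (simp add: A_ring_def)
  then show "\<exists>e. periodic (?p ^ e) \<phi>"
  proof induction
    case one
    then show ?case by (simp add: fun_ring_def periodic_def)
  next
    case (incl \<phi>)
    then show ?case
    proof
      assume "\<phi> \<in> range binom_fun"
      then obtain n where n: "\<phi> = binom_fun n" by blast
      have "n < ?p ^ n" using p by (intro power_gt_expt) (simp add: prime_gt_Suc_0_nat)
      then have "periodic (?p ^ n) \<phi>"
        by (simp add: n periodic_def binom_fun_def choose_add_CHAR_power[OF p refl])
      then show ?thesis by blast
    qed (auto simp: periodic_def)
  next
    case (a_inv \<phi>)
    then show ?case by (auto simp: a_inv_fun_ring periodic_def)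
  next
    case (eng_add \<phi> \<psi>)
    then obtain e where "periodic (?p ^ e) \<phi>" "periodic (?p ^ e) \<psi>" using common by blast
    then show ?case by (intro exI[of _ e]) (simp add: fun_ring_def periodic_def)
  next
    case (eng_mult \<phi> \<psi>)
    then obtain e where "periodic (?p ^ e) \<phi>" "periodic (?p ^ e) \<psi>" using common by blast
    then show ?case by (intro exI[of _ e]) (simp add: fun_ring_def periodic_def)
  qed
next
  assume "\<exists>e. periodic (CHAR('k) ^ e) \<phi>"
  then obtain e where e: "periodic (CHAR('k) ^ e) \<phi>" by blast
  interpret A: cring "A_ring :: (nat \<Rightarrow> 'k) ring" by (rule cring_A_ring)
  show "\<phi> \<in> carrier A_ring"
  proof (rule periodic_closed_under_generators[OF p _ _ _ _ e])
    show "(\<lambda>l. c) \<in> carrier A_ring" for c :: 'k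
      by (auto simp: A_ring_def intro: generate_ring.incl)
    show "binom_fun (CHAR('k) ^ e) \<in> carrier (A_ring :: (nat \<Rightarrow> 'k) ring)" for e
      by (auto simp: A_ring_def intro: generate_ring.incl)
  qed (use A.add.m_closed A.m_closed in \<open>simp_all add: A_ring_simps\<close>)
qed

lemma A_ring_induct:
  fixes \<phi> :: "nat \<Rightarrow> 'k::field"
  assumes "Factorial_Ring.prime CHAR('k)" "\<phi> \<in> carrier A_ring"
    and "\<And>c. (\<lambda>l. c) \<in> C" "\<And>e. binom_fun (CHAR('k) ^ e) \<in> C"
    and "\<And>\<phi> \<psi>. \<phi> \<in> C \<Longrightarrow> \<psi> \<in> C \<Longrightarrow> (\<lambda>l. \<phi> l + \<psi> l) \<in> C"
    and "\<And>\<phi> \<psi>. \<phi> \<in> C \<Longrightarrow> \<psi> \<in> C \<Longrightarrow> (\<lambda>l. \<phi> l * \<psi> l) \<in> C"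
  shows "\<phi> \<in> C"
  using assms periodic_closed_under_generators[of C] carrier_A_ring[OF assms(1)] by metis

section \<open>Evaluation at \<open>p\<close>-adic integers\<close>

lemma padic_mod:
  assumes "z \<in> padic_ints p" "n \<le> m"
  shows "z m mod int p ^ n = z n"
  using assms(2)
proof (induction m rule: dec_induct)
  case base
  have "z n \<in> {0..<int p ^ n}" using assms(1) by (simp add: padic_ints_def)
  then show ?case by simp
next
  case (step m)
  have "[z (Suc m) = z m] (mod int p ^ m)" using assms(1) by (simp add: padic_ints_def)
  then have "[z (Suc m) = z m] (mod int p ^ n)"
    by (rule cong_dvd_modulus) (simp add: step.hyps le_imp_power_dvd)
  then show ?case using step.IH by (simp add: Cong.cong_def)
qed

lemma padic_digit_nat:
  assumes "z \<in> padic_ints p" "Factorial_Ring.prime CHAR('k::field)" "p = CHAR('k)"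
    and that: "e < n"
  shows "(of_int (padic_digit p z e) :: 'k) = of_nat (nat (z n) div p ^ e)"
proof -
  have z: "z n \<ge> 0" "z (Suc e) \<ge> 0" using assms(1) by (simp_all add: padic_ints_def)
  have "padic_digit p z e = (z n mod (int p ^ e * int p)) div int p ^ e"
    using padic_mod[OF assms(1), of "Suc e" n] that by (simp add: padic_digit_def mult.commute)
  also have "\<dots> = z n div int p ^ e mod int p"
    using assms by (simp add: zmod_zmult2_eq prime_gt_0_nat)
  also have "\<dots> = int (nat (z n) div p ^ e mod p)"
    using z by (simp add: zmod_int zdiv_int)
  finally have "(of_int (padic_digit p z e) :: 'k) = of_nat (nat (z n) div p ^ e mod p)" by simp
  also have "\<dots> = of_nat (nat (z n) div p ^ e)"
    using of_nat_eq_iff_cong_CHAR[where ?'a = 'k] by (simp add: Cong.cong_def assms(3))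
  finally show ?thesis .
qed
text \<open>
  The ideal at \<open>z\<close> is the kernel of the evaluation at \<open>z\<close>, and a function of period \<open>p ^ e\<close> sees
  only \<open>z e = z mod p ^ e\<close>.
\<close>

lemma mem_max_ideal_at:
  fixes \<phi> :: "nat \<Rightarrow> 'k::field"
  assumes p: "Factorial_Ring.prime CHAR('k)" "p = CHAR('k)" and z: "z \<in> padic_ints p"
    and per: "periodic (p ^ e) \<phi>"
  shows "\<phi> \<in> max_ideal_at p z \<longleftrightarrow> \<phi> (nat (z e)) = 0"
proof -
  interpret A: cring "A_ring :: (nat \<Rightarrow> 'k) ring" by (rule cring_A_ring)
  define at_z where "at_z \<psi> \<longleftrightarrow> (\<exists>n. \<forall>m\<ge>n. \<psi> (nat (z m)) = 0)" for \<psi> :: "nat \<Rightarrow> 'k"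
  let ?G = "range (\<lambda>e l. binom_fun (p ^ e) l - of_int (padic_digit p z e)) :: (nat \<Rightarrow> 'k) set"
  have stable: "\<psi> (nat (z m)) = \<psi> (nat (z n))" if "periodic (p ^ n) \<psi>" "n \<le> m" for \<psi> :: "nat \<Rightarrow> 'k" and n m
  proof (rule periodic_cong[OF that(1)])
    have "z m \<ge> 0" "z n \<ge> 0" using z by (simp_all add: padic_ints_def)
    then show "nat (z m) mod p ^ n = nat (z n) mod p ^ n"
      using padic_mod[OF z that(2)] padic_mod[OF z order.refl, of n]
      by (metis nat_mod_distrib of_nat_0_le_iff of_nat_power nat_int)
  qed
  have at_z: "at_z \<psi> \<longleftrightarrow> \<psi> (nat (z n)) = 0" if "periodic (p ^ n) \<psi>" for \<psi> :: "nat \<Rightarrow> 'k" and n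
    using stable[OF that] unfolding at_z_def by (metis nle_le)
  have binom: "at_z (\<lambda>l. binom_fun (p ^ e) l - of_int (padic_digit p z e))" for e
    unfolding at_z_def
  proof (intro exI[of _ "Suc e"] allI impI)
    fix m assume "Suc e \<le> m"
    then show "binom_fun (p ^ e) (nat (z m)) - (of_int (padic_digit p z e) :: 'k) = 0"
      using padic_digit_nat[OF z p, of e m] choose_CHAR_power[OF p(1), of "p ^ e" e "nat (z m)"] p(2)
      by (simp add: binom_fun_def)
  qed
  have binom_A: "(\<lambda>l. binom_fun (p ^ e) l - of_int (padic_digit p z e)) \<in> carrier (A_ring :: (nat \<Rightarrow> 'k) ring)" for e
  proof -
    have "CHAR('k) ^ e < CHAR('k) ^ Suc e"
      using p(1) by (intro power_strict_increasing) (simp_all add: prime_gt_Suc_0_nat)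
    then have "periodic (CHAR('k) ^ Suc e) (\<lambda>l. binom_fun (p ^ e) l - (of_int (padic_digit p z e) :: 'k))"
      by (simp add: periodic_def binom_fun_def p(2) choose_add_CHAR_power[OF p(1) refl] del: power_Suc)
    then show ?thesis unfolding carrier_A_ring[OF p(1)] by blast
  qed
  have G: "?G \<subseteq> carrier A_ring" using binom_A by auto
  have ideal_at: "ideal {\<psi> \<in> carrier A_ring. at_z \<psi>} (A_ring :: (nat \<Rightarrow> 'k) ring)"
  proof (rule idealI[OF A.ring_axioms])
    have at_add: "at_z (\<lambda>l. \<phi> l + \<psi> l)" if "at_z \<phi>" "at_z \<psi>" for \<phi> \<psi>
    proof -
      from that obtain n m where "\<forall>i\<ge>n. \<phi> (nat (z i)) = 0" "\<forall>i\<ge>m. \<psi> (nat (z i)) = 0" by (auto simp: at_z_def)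
      then show ?thesis unfolding at_z_def by (intro exI[of _ "max n m"]) simp
    qed
    have inv: "\<ominus>\<^bsub>A_ring\<^esub> \<psi> = (\<lambda>l. - \<psi> l)" if "\<psi> \<in> carrier A_ring" for \<psi> :: "nat \<Rightarrow> 'k"
    proof (rule A.minus_equality)
      show "(\<lambda>l. - \<psi> l) \<in> carrier A_ring" using that carrier_A_ring[OF p(1)] by (auto simp: periodic_def)
    qed (use that in \<open>auto simp: A_ring_simps\<close>)
    show "subgroup {\<psi> \<in> carrier A_ring. at_z \<psi>} (add_monoid (A_ring :: (nat \<Rightarrow> 'k) ring))"
    proof (rule A.add.subgroupI)
      show "\<ominus>\<^bsub>A_ring\<^esub> \<psi> \<in> {\<psi> \<in> carrier A_ring. at_z \<psi>}"
        if "\<psi> \<in> {\<psi> \<in> carrier A_ring. at_z \<psi>}" for \<psi>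
        using that A.a_inv_closed[of \<psi>] by (auto simp: inv at_z_def)
      show "\<phi> \<oplus>\<^bsub>A_ring\<^esub> \<psi> \<in> {\<psi> \<in> carrier A_ring. at_z \<psi>}"
        if "\<phi> \<in> {\<psi> \<in> carrier A_ring. at_z \<psi>}" "\<psi> \<in> {\<psi> \<in> carrier A_ring. at_z \<psi>}" for \<phi> \<psi>
        using that A.add.m_closed[of \<phi> \<psi>] at_add by (auto simp: A_ring_simps)
      show "{\<psi> \<in> carrier A_ring. at_z \<psi>} \<noteq> {}"
        using A.zero_closed by (auto simp: A_ring_simps at_z_def)
    qed auto
    fix \<psi> \<chi> :: "nat \<Rightarrow> 'k"
    assume a: "\<psi> \<in> {\<psi> \<in> carrier A_ring. at_z \<psi>}" and x: "\<chi> \<in> carrier A_ring"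
    show "\<chi> \<otimes>\<^bsub>A_ring\<^esub> \<psi> \<in> {\<psi> \<in> carrier A_ring. at_z \<psi>}"
      using a x A.m_closed[of \<chi> \<psi>] by (auto simp: A_ring_simps at_z_def)
    show "\<psi> \<otimes>\<^bsub>A_ring\<^esub> \<chi> \<in> {\<psi> \<in> carrier A_ring. at_z \<psi>}"
      using a x A.m_closed[of \<psi> \<chi>] by (auto simp: A_ring_simps at_z_def)
  qed
  have "max_ideal_at p z \<subseteq> {\<psi> \<in> carrier A_ring. at_z \<psi>}"
    unfolding max_ideal_at_def using binom binom_A by (intro A.genideal_minimal[OF ideal_at]) auto
  moreover have "\<phi> \<in> max_ideal_at p z" if "\<phi> (nat (z e)) = 0"
  proof -
    let ?I = "max_ideal_at p z :: (nat \<Rightarrow> 'k) set"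
    interpret I: ideal ?I A_ring
      unfolding max_ideal_at_def by (rule A.genideal_ideal[OF G])
    have GI: "?G \<subseteq> ?I" unfolding max_ideal_at_def by (rule A.genideal_self[OF G])
    \<comment> \<open>modulo the ideal, every function is congruent to a constant\<close>
    define C where "C = {\<psi> \<in> carrier A_ring. \<exists>c :: 'k. (\<lambda>l. \<psi> l - c) \<in> ?I}"
    have const: "(\<lambda>l. c) \<in> carrier A_ring" for c :: 'k by (auto simp: carrier_A_ring[OF p(1)] periodic_def)
    have phi_A: "\<phi> \<in> carrier A_ring" using per p by (auto simp: carrier_A_ring)
    have "\<phi> \<in> C"
    proof (rule A_ring_induct[OF p(1) phi_A])
      show "(\<lambda>l. c) \<in> C" for c
        using const[of c] I.zero_closed by (auto simp: C_def A_ring_simps intro!: exI[of _ c])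
      show "binom_fun (CHAR('k) ^ e) \<in> C" for e
      proof -
        have "binom_fun (CHAR('k) ^ e) \<in> carrier (A_ring :: (nat \<Rightarrow> 'k) ring)"
          by (auto simp: A_ring_def intro: generate_ring.incl)
        then show ?thesis using GI by (auto simp: C_def p(2))
      qed
      fix \<phi> \<psi> assume "\<phi> \<in> C" "\<psi> \<in> C"
      then obtain c d where *: "\<phi> \<in> carrier A_ring" "\<psi> \<in> carrier A_ring"
        "(\<lambda>l. \<phi> l - c) \<in> ?I" "(\<lambda>l. \<psi> l - d) \<in> ?I" by (auto simp: C_def)
      have "(\<lambda>l. (\<phi> l + \<psi> l) - (c + d)) \<in> ?I"
        using I.a_closed[OF *(3,4)] by (simp add: A_ring_simps algebra_simps)
      then show "(\<lambda>l. \<phi> l + \<psi> l) \<in> C"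
        using A.add.m_closed[OF *(1,2)] by (auto simp: C_def A_ring_simps)
      have "(\<lambda>l. (\<phi> l * \<psi> l) - (c * d)) \<in> ?I"
        using I.a_closed[OF I.I_r_closed[OF *(3,2)] I.I_l_closed[OF *(4) const[of c]]]
        by (simp add: A_ring_simps algebra_simps)
      then show "(\<lambda>l. \<phi> l * \<psi> l) \<in> C"
        using A.m_closed[OF *(1,2)] by (auto simp: C_def A_ring_simps)
    qed
    then obtain c where c: "(\<lambda>l. \<phi> l - c) \<in> ?I" by (auto simp: C_def)
    have "periodic (p ^ e) (\<lambda>l. \<phi> l - c)" using per by (simp add: periodic_def)
    moreover have "at_z (\<lambda>l. \<phi> l - c)"
      using c \<open>?I \<subseteq> {\<psi> \<in> carrier A_ring. at_z \<psi>}\<close> by blast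
    ultimately have "c = 0" using at_z[of e "\<lambda>l. \<phi> l - c"] that by simp
    then show ?thesis using c by simp
  qed
  ultimately show ?thesis using at_z[OF per] by blast
qed

section \<open>Operators linear over a Frobenius power\<close>

lemma poly_mapping_add_induct [case_names zero add]:
  fixes f :: "'a \<Rightarrow>\<^sub>0 'b::comm_monoid_add"
  assumes "P 0" and "\<And>f a b. P f \<Longrightarrow> P (f + Poly_Mapping.single a b)"
  shows "P f"
proof (induction f rule: update_induct)
  case (update f a b)
  have "Poly_Mapping.update a b f = f + Poly_Mapping.single a b"
    using update.hyps(1)
    by (intro poly_mapping_eqI) (auto simp: lookup_update lookup_add lookup_single when_def in_keys_iff)
  then show ?case using assms(2) update.IH by simp
qed (fact assms(1))

definition mvar :: "'n \<Rightarrow> ('n, 'k::zero_neq_one) mpoly" where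
  "mvar i = Poly_Mapping.single (Poly_Mapping.single i 1) 1"

lemma mconst_simps:
  "mconst 0 = 0" "mconst 1 = 1" "mconst (a + b) = mconst a + mconst b"
  "mconst (a * b) = mconst a * mconst b" "mconst (- a) = - mconst a" "mconst (a ^ n) = mconst a ^ n"
  "mconst (of_nat m) = of_nat m"
  for a b :: "'k::comm_ring_1"
proof -
  show *: "mconst (a * b) = mconst a * mconst b" "mconst 1 = 1" for a b :: 'k
    by (simp_all add: mconst_def mult_single)
  show "mconst (a ^ n) = mconst a ^ n" by (induction n) (simp_all add: *)
qed (simp_all add: mconst_def single_add single_uminus)

lemma CHAR_mpoly [simp]: "CHAR(('n \<Rightarrow>\<^sub>0 nat) \<Rightarrow>\<^sub>0 'k::comm_ring_1) = CHAR('k)"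
proof (rule CHAR_eqI)
  have eq: "of_nat n = (0 :: ('n, 'k) mpoly) \<longleftrightarrow> of_nat n = (0::'k)" for n
  proof -
    have *: "(of_nat n :: ('n, 'k) mpoly) = Poly_Mapping.single 0 (of_nat n)" by simp
    then have "Poly_Mapping.lookup (of_nat n :: ('n, 'k) mpoly) 0 = of_nat n" by (simp only: lookup_single_eq)
    moreover have "(of_nat n :: ('n, 'k) mpoly) = 0" if "of_nat n = (0::'k)"
      unfolding * that by simp
    ultimately show ?thesis by fastforce
  qed
  show "of_nat CHAR('k) = (0 :: ('n, 'k) mpoly)" by (simp add: eq)
  show "CHAR('k) dvd n" if "of_nat n = (0 :: ('n, 'k) mpoly)" for n
    using that by (simp add: eq of_nat_eq_0_iff_char_dvd)
qed

lemma mpoly_generated: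
  assumes add: "\<And>x y. x \<in> C \<Longrightarrow> y \<in> C \<Longrightarrow> x + y \<in> C" and mult: "\<And>x y. x \<in> C \<Longrightarrow> y \<in> C \<Longrightarrow> x * y \<in> C"
    and const: "\<And>c. mconst c \<in> C" and var: "\<And>i. mvar i \<in> C"
  shows "(u :: ('n, 'k::comm_ring_1) mpoly) \<in> C"
proof -
  have mono: "Poly_Mapping.single m 1 \<in> C" for m :: "'n \<Rightarrow>\<^sub>0 nat"
  proof (induction m rule: poly_mapping_add_induct)
    case zero
    show ?case using const[of 1] by (simp add: mconst_def)
  next
    case (add m i n)
    have "Poly_Mapping.single (m + Poly_Mapping.single i n) (1::'k) \<in> C" for n
    proof (induction n)
      case 0
      then show ?case using add by simp
    next
      case (Suc n)
      have "Poly_Mapping.single (m + Poly_Mapping.single i (Suc n)) (1::'k) =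
         Poly_Mapping.single (m + Poly_Mapping.single i n) 1 * mvar i"
        using single_add[of i n 1] by (simp add: mvar_def mult_single add.assoc)
      then show ?case using mult[OF Suc var[of i]] by simp
    qed
    then show ?case .
  qed
  show ?thesis
  proof (induction u rule: poly_mapping_add_induct)
    case zero
    show ?case using const[of 0] by (simp add: mconst_def)
  next
    case (add u m c)
    have "Poly_Mapping.single m c = mconst c * Poly_Mapping.single m 1"
      by (simp add: mconst_def mult_single)
    then show ?case using assms(1)[OF add mult[OF const mono]] by simp
  qed
qed

definition frob_linear :: "nat \<Rightarrow> ('a::comm_ring_1 \<Rightarrow> 'a) set" where
  "frob_linear q = {P. (\<forall>x y. P (x + y) = P x + P y) \<and> (\<forall>a x. P (a ^ q * x) = a ^ q * P x)}"

lemma frob_linear_zero: "P \<in> frob_linear q \<Longrightarrow> P 0 = 0"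
proof -
  assume "P \<in> frob_linear q"
  then have "P (0 + 0) = P 0 + P 0" unfolding frob_linear_def by blast
  then show "P 0 = 0" by simp
qed

lemma frob_linear_closed:
  shows "P \<in> frob_linear q \<Longrightarrow> Q \<in> frob_linear q \<Longrightarrow> (\<lambda>x. P x + Q x) \<in> frob_linear q"
    "P \<in> frob_linear q \<Longrightarrow> (\<lambda>x. - P x) \<in> frob_linear q"
    "P \<in> frob_linear q \<Longrightarrow> Q \<in> frob_linear q \<Longrightarrow> (\<lambda>x. P (Q x)) \<in> frob_linear q"
    "P \<in> frob_linear q \<Longrightarrow> (\<lambda>x. c * P x) \<in> frob_linear q"
  unfolding frob_linear_def
  by (simp_all add: distrib_left mult.left_commute)

lemma frob_linear_mult: "(*) c \<in> frob_linear q"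
  unfolding frob_linear_def by (simp add: distrib_left mult.left_commute)

lemma frob_linear_dvd:
  assumes "P \<in> frob_linear q" "q dvd r" shows "P \<in> frob_linear r"
proof -
  obtain k where "r = k * q" using assms(2) by (metis dvdE mult.commute)
  then show ?thesis using assms(1) by (simp add: frob_linear_def power_mult)
qed

lemma surj_power_CHAR_power:
  assumes "surj (\<lambda>x::'k::field. x ^ p)" shows "surj (\<lambda>x::'k. x ^ (p ^ e))"
proof (induction e)
  case (Suc e)
  have "(\<lambda>x::'k. x ^ (p ^ Suc e)) = (\<lambda>x. x ^ p) \<circ> (\<lambda>x. x ^ (p ^ e))"
    by (auto simp: power_mult[symmetric] mult.commute)
  moreover have "surj ((\<lambda>x::'k. x ^ p) \<circ> (\<lambda>x. x ^ (p ^ e)))" by (rule comp_surj[OF Suc assms])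
  ultimately show ?case by (simp only:)
qed simp

lemma commutes_imp_ad_funpow_zero:
  fixes v :: "'a::comm_ring_1"
  assumes "Factorial_Ring.prime CHAR('a)" "q = CHAR('a) ^ e" "\<And>x. P (v ^ q * x) = v ^ q * P x"
  shows "(ad v ^^ q) P = (\<lambda>x. 0)"
  using assms by (simp add: ad_funpow_CHAR_power) (simp add: ad_def)

text \<open>
  The polynomial ring is finite over its subring of \<open>q\<close>-th powers, so an operator linear over this
  subring has finite order; perfectness of \<open>k\<close> puts the scalars among the \<open>q\<close>-th powers.
\<close>

lemma frob_linear_diff_op:
  fixes P :: "('n::{finite,linorder}, 'k::field) mpoly \<Rightarrow> ('n, 'k) mpoly"
  assumes p: "Factorial_Ring.prime CHAR('k)" and perf: "surj (\<lambda>x::'k. x ^ CHAR('k))"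
    and q: "q = CHAR('k) ^ e" and P: "P \<in> frob_linear q"
  shows "P \<in> D_R"
proof -
  have "P \<in> diff_ops_lt (range mconst) UNIV (sum (\<lambda>_. q) (range (mvar :: 'n \<Rightarrow> ('n, 'k) mpoly)))"
  proof (rule diff_ops_lt_from_generators[where L = "range mconst"])
    show "C = UNIV" if "\<And>x y. x \<in> C \<Longrightarrow> y \<in> C \<Longrightarrow> x + y \<in> C" "\<And>x y. x \<in> C \<Longrightarrow> y \<in> C \<Longrightarrow> x * y \<in> C"
      "range mconst \<subseteq> C" "range mvar \<subseteq> C" for C :: "('n, 'k) mpoly set"
      using mpoly_generated[of C] that by blast
    show "P (c * x) = c * P x" if c: "c \<in> range mconst" for c x
    proof -
      obtain d where "c = mconst d" using c by blast
      moreover obtain d' where "d = d' ^ q" using surj_power_CHAR_power[OF perf, of e] q by (meson surjD)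
      ultimately have "c = mconst d' ^ q" by (simp add: mconst_simps)
      then show ?thesis using P by (simp add: frob_linear_def)
    qed
    show "(ad v ^^ q) P = (\<lambda>x. 0)" for v
      by (rule commutes_imp_ad_funpow_zero[of q e]) (use p q P in \<open>auto simp: frob_linear_def\<close>)
  qed (use P in \<open>auto simp: frob_linear_def\<close>)
  then show ?thesis by (auto simp: D_R_def diff_ops_def)
qed

lemma diff_op_frob_linear:
  fixes P :: "('n::{finite,linorder}, 'k::field) mpoly \<Rightarrow> ('n, 'k) mpoly"
  assumes p: "Factorial_Ring.prime CHAR('k)" and "P \<in> D_R"
  shows "\<exists>e. P \<in> frob_linear (CHAR('k) ^ e)"
proof -
  obtain m where m: "P \<in> diff_ops_lt (range mconst) UNIV m" using assms(2) by (auto simp: D_R_def diff_ops_def)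
  have "m < CHAR('k) ^ m" using p by (intro power_gt_expt) (simp add: prime_gt_Suc_0_nat)
  then have "P (a ^ (CHAR('k) ^ m) * x) = a ^ (CHAR('k) ^ m) * P x" for a x
    using diff_op_commutes_Frobenius_power[OF _ subring_set_UNIV m, of m a x] p by simp
  moreover have "P (x + y) = P x + P y" for x y
    using diff_ops_lt_linear[OF m subring_set_UNIV] by (simp add: linear_endos_def)
  ultimately show ?thesis by (auto simp: frob_linear_def)
qed

section \<open>The ring generated by \<open>D_R\<close> and the Euler operators\<close>

definition coeffwise :: "(nat \<Rightarrow> 'a::zero \<Rightarrow> 'a) \<Rightarrow> 'a poly \<Rightarrow> 'a poly" where
  "coeffwise P u = Abs_poly (\<lambda>n. P n (Polynomial.coeff u n))"

lemma coeff_coeffwise: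
  assumes "\<And>n. P n 0 = 0"
  shows "Polynomial.coeff (coeffwise P u) n = P n (Polynomial.coeff u n)"
  unfolding coeffwise_def
  by (subst coeff_Abs_poly[of "Polynomial.degree u"]) (simp_all add: assms coeff_eq_0)
text \<open>
  The components of an operator on \<open>R[t]\<close> that preserves the \<open>t\<close>-degree: \<open>P n\<close> is its action on the
  coefficient of \<open>t ^ n\<close>. Periodicity makes the operator linear over \<open>t ^ q\<close>.
\<close>

definition level_family :: "nat \<Rightarrow> (nat \<Rightarrow> 'a::comm_ring_1 \<Rightarrow> 'a) \<Rightarrow> bool" where
  "level_family q P \<longleftrightarrow> (\<forall>n. P n \<in> frob_linear q) \<and> periodic q P"

lemma level_family_dvd: "level_family q P \<Longrightarrow> q dvd r \<Longrightarrow> level_family r P"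
  by (auto simp: level_family_def intro: frob_linear_dvd periodic_dvd)

lemma level_family_zero: "level_family q P \<Longrightarrow> P n 0 = 0"
  by (auto simp: level_family_def intro: frob_linear_zero)

lemma coeff_coeffwise_level:
  "level_family q P \<Longrightarrow> Polynomial.coeff (coeffwise P u) n = P n (Polynomial.coeff u n)"
  by (rule coeff_coeffwise) (rule level_family_zero)

lemma level_family_closed:
  assumes "level_family q P" "level_family q Q"
  shows "level_family q (\<lambda>n x. P n x + Q n x)" "level_family q (\<lambda>n x. P n (Q n x))"
     "level_family q (\<lambda>n x. - P n x)" "level_family q (\<lambda>n. P (n + m))"
proof -
  show "level_family q (\<lambda>n x. P n x + Q n x)" "level_family q (\<lambda>n x. P n (Q n x))"
     "level_family q (\<lambda>n x. - P n x)"
    using assms unfolding level_family_def periodic_def by (simp_all add: frob_linear_closed)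
  have "P (n + q + m) = P (n + m)" for n
    using assms(1) unfolding level_family_def periodic_def by (metis add.assoc add.commute)
  then show "level_family q (\<lambda>n. P (n + m))"
    using assms(1) unfolding level_family_def periodic_def by simp
qed

lemma coeffwise_closed:
  assumes "level_family q P" "level_family q Q"
  shows "(\<lambda>u. coeffwise P u + coeffwise Q u) = coeffwise (\<lambda>n x. P n x + Q n x)"
    "(\<lambda>u. coeffwise P (coeffwise Q u)) = coeffwise (\<lambda>n x. P n (Q n x))"
    "(\<lambda>u. - coeffwise P u) = coeffwise (\<lambda>n x. - P n x)"
  using coeff_coeffwise_level[OF assms(1)] coeff_coeffwise_level[OF assms(2)]
    coeff_coeffwise_level[OF level_family_closed(1)[OF assms]]
    coeff_coeffwise_level[OF level_family_closed(2)[OF assms]]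
    coeff_coeffwise_level[OF level_family_closed(3)[OF assms]]
  by (auto intro!: poly_eqI)

definition level_ops :: "nat \<Rightarrow> ('a::comm_ring_1 poly \<Rightarrow> 'a poly) set" where
  "level_ops q = {coeffwise P | P. level_family q P}"

lemma level_ops_dvd: "q dvd r \<Longrightarrow> level_ops q \<subseteq> level_ops r"
  by (auto simp: level_ops_def intro: level_family_dvd)

lemma level_ops_closed:
  assumes "S \<in> level_ops q" "T \<in> level_ops q"
  shows "(\<lambda>u. S u + T u) \<in> level_ops q" "(\<lambda>u. S (T u)) \<in> level_ops q" "(\<lambda>u. - S u) \<in> level_ops q"
proof -
  obtain P Q where S: "S = coeffwise P" "level_family q P" and T: "T = coeffwise Q" "level_family q Q"
    using assms by (auto simp: level_ops_def)
  show "(\<lambda>u. S u + T u) \<in> level_ops q" "(\<lambda>u. S (T u)) \<in> level_ops q" "(\<lambda>u. - S u) \<in> level_ops q"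
    unfolding S(1) T(1) coeffwise_closed[OF S(2) T(2)] level_ops_def
    using level_family_closed[OF S(2) T(2)] by blast+
qed

lemma coeffwise_power_mult:
  fixes a u :: "'a::comm_ring_1 poly"
  assumes p: "Factorial_Ring.prime CHAR('a)" and q: "q = CHAR('a) ^ e" and P: "level_family q P"
  shows "coeffwise P (a ^ q * u) = a ^ q * coeffwise P u"
proof -
  have add: "coeffwise P (u + v) = coeffwise P u + coeffwise P v" for u v
    using P by (intro poly_eqI) (simp add: coeff_coeffwise_level[OF P] level_family_def frob_linear_def)
  have const: "coeffwise P ([:r:] ^ q * u) = [:r:] ^ q * coeffwise P u" for r u
  proof -
    have "[:r:] ^ q = [:r ^ q:]" by (simp flip: poly_const_pow)
    then show ?thesis
      using P by (intro poly_eqI) (simp add: coeff_coeffwise_level[OF P] level_family_def frob_linear_def)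
  qed
  have tq: "coeffwise P ([:0, 1:] ^ q * u) = [:0, 1:] ^ q * coeffwise P u" for u
  proof (rule poly_eqI)
    fix n
    have "[:0, 1:] ^ q = (Polynomial.monom 1 q :: 'a poly)" by (simp add: monom_altdef)
    moreover have "P n = P (n - q)" if "q \<le> n"
      using P that unfolding level_family_def periodic_def by (metis le_add_diff_inverse2)
    moreover have "P n 0 = 0" using P by (rule level_family_zero)
    ultimately show "Polynomial.coeff (coeffwise P ([:0, 1:] ^ q * u)) n = Polynomial.coeff ([:0, 1:] ^ q * coeffwise P u) n"
      by (simp add: coeff_coeffwise_level[OF P] coeff_monom_mult)
  qed
  show ?thesis
  proof (induction a arbitrary: u)
    case 0
    have "coeffwise P 0 = 0" using add[of 0 0] by simp
    moreover have "q > 0" using p q by (simp add: prime_gt_0_nat)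
    ultimately show ?case by (simp add: power_0_left)
  next
    case (pCons r a)
    have "pCons r a = [:r:] + [:0, 1:] * a" by simp
    then have "pCons r a ^ q = [:r:] ^ q + [:0, 1:] ^ q * a ^ q"
      using freshmans_dream'[of q e "[:r:]" "[:0, 1:] * a"] p q by (simp only: power_mult_distrib semiring_char_poly)
    then show ?case by (simp only: distrib_right add const mult.assoc tq pCons.IH)
  qed
qed

lemma level_ops_frob_linear:
  fixes T :: "'a::comm_ring_1 poly \<Rightarrow> 'a poly"
  assumes p: "Factorial_Ring.prime CHAR('a)" and q: "q = CHAR('a) ^ e" and "T \<in> level_ops q"
  shows "T \<in> frob_linear q"
proof -
  obtain P where T: "T = coeffwise P" and P: "level_family q P" using assms(3) by (auto simp: level_ops_def)
  have "coeffwise P (u + v) = coeffwise P u + coeffwise P v" for u v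
    using P by (intro poly_eqI) (simp add: coeff_coeffwise_level[OF P] level_family_def frob_linear_def)
  then show ?thesis using coeffwise_power_mult[OF p q P] by (simp add: T frob_linear_def)
qed

lemma frob_linear_diff_op_Rt:
  fixes T :: "('n::{finite,linorder}, 'k::field) mpoly poly \<Rightarrow> ('n, 'k) mpoly poly"
  assumes p: "Factorial_Ring.prime CHAR('k)" and perf: "surj (\<lambda>x::'k. x ^ CHAR('k))"
    and q: "q = CHAR('k) ^ e" and T: "T \<in> frob_linear q"
  shows "T \<in> diff_ops (range (\<lambda>c. [:mconst c:])) UNIV"
proof -
  let ?V = "insert [:0, 1:] ((\<lambda>i. [:mvar i:]) ` UNIV) :: ('n, 'k) mpoly poly set"
  have "T \<in> diff_ops_lt (range (\<lambda>c. [:mconst c:])) UNIV (sum (\<lambda>_. q) ?V)"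
  proof (rule diff_ops_lt_from_generators[where L = "range (\<lambda>c. [:mconst c:])"])
    show "C = UNIV" if C: "\<And>x y. x \<in> C \<Longrightarrow> y \<in> C \<Longrightarrow> x + y \<in> C" "\<And>x y. x \<in> C \<Longrightarrow> y \<in> C \<Longrightarrow> x * y \<in> C"
      "range (\<lambda>c. [:mconst c:]) \<subseteq> C" "?V \<subseteq> C" for C :: "('n, 'k) mpoly poly set"
    proof -
      have const: "[:r:] \<in> C" for r
      proof -
        have "r \<in> {r. [:r:] \<in> C}"
        proof (rule mpoly_generated)
          show "x + y \<in> {r. [:r:] \<in> C}" if "x \<in> {r. [:r:] \<in> C}" "y \<in> {r. [:r:] \<in> C}" for x y
            using C(1)[of "[:x:]" "[:y:]"] that by simp
          show "x * y \<in> {r. [:r:] \<in> C}" if "x \<in> {r. [:r:] \<in> C}" "y \<in> {r. [:r:] \<in> C}" for x y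
            using C(2)[of "[:x:]" "[:y:]"] that by (simp add: mult.commute)
        qed (use C(3,4) in auto)
        then show ?thesis by simp
      qed
      have "u \<in> C" for u
      proof (induction u)
        case 0
        then show ?case using const[of 0] by simp
      next
        case (pCons r u)
        have "[:r:] + [:0, 1:] * u \<in> C" using C(1,2,4) const pCons.IH by blast
        then show ?case by simp
      qed
      then show ?thesis by blast
    qed
    show "T (c * x) = c * T x" if c: "c \<in> range (\<lambda>c. [:mconst c:])" for c x
    proof -
      obtain d where "c = [:mconst d:]" using c by blast
      moreover obtain d' where "d = d' ^ q" using surj_power_CHAR_power[OF perf, of e] q by (meson surjD)
      ultimately have "c = [:mconst d':] ^ q" by (simp add: mconst_simps poly_const_pow)
      then show ?thesis using T by (simp add: frob_linear_def)
    qed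
    show "(ad v ^^ q) T = (\<lambda>x. 0)" for v
      by (rule commutes_imp_ad_funpow_zero[of q e]) (use p q T in \<open>auto simp: frob_linear_def\<close>)
  qed (use T in \<open>auto simp: frob_linear_def\<close>)
  then show ?thesis by (auto simp: diff_ops_def)
qed

lemma coeff_divided_deriv:
  "Polynomial.coeff (divided_deriv m u) n = of_nat ((n + m) choose m) * Polynomial.coeff u (n + m)"
proof -
  have "Polynomial.coeff (divided_deriv m u) n =
    (\<Sum>i\<le>Polynomial.degree u. if i = n + m then of_nat (i choose m) * Polynomial.coeff u i else 0)"
    unfolding divided_deriv_def coeff_sum
    by (intro sum.cong) (auto simp: coeff_monom binomial_eq_0)
  then show ?thesis by (simp add: coeff_eq_0)
qed

lemma euler_op_coeffwise: "euler_op p e = coeffwise (\<lambda>n. (*) (of_nat ((n + p ^ e) choose (p ^ e))))"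
  by (auto intro!: poly_eqI simp: euler_op_def coeff_divided_deriv coeff_coeffwise coeff_monom_mult)

lemma euler_op_level:
  assumes p: "Factorial_Ring.prime CHAR('a::comm_ring_1)"
  shows "(euler_op CHAR('a) e :: 'a poly \<Rightarrow> 'a poly) \<in> level_ops (CHAR('a) ^ Suc e)"
proof -
  have "CHAR('a) ^ e < CHAR('a) ^ Suc e"
    using p by (intro power_strict_increasing) (simp_all add: prime_gt_Suc_0_nat)
  then have "(of_nat ((n + CHAR('a) ^ Suc e + CHAR('a) ^ e) choose CHAR('a) ^ e) :: 'a) =
     of_nat ((n + CHAR('a) ^ e) choose CHAR('a) ^ e)" for n
    using choose_add_CHAR_power[OF p refl, of "n + CHAR('a) ^ e" "Suc e" "CHAR('a) ^ e"]
    by (simp add: add_ac del: power_Suc)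
  then have "level_family (CHAR('a) ^ Suc e) (\<lambda>n. (*) (of_nat ((n + CHAR('a) ^ e) choose (CHAR('a) ^ e))) :: 'a \<Rightarrow> 'a)"
    by (auto simp: level_family_def frob_linear_mult periodic_def simp del: power_Suc)
  then show ?thesis unfolding euler_op_coeffwise level_ops_def by blast
qed

definition diag :: "(nat \<Rightarrow> 'k::comm_ring_1) \<Rightarrow> ('n, 'k) mpoly poly \<Rightarrow> ('n, 'k) mpoly poly" where
  "diag \<psi> = coeffwise (\<lambda>n. (*) (mconst (\<psi> n)))"

lemma coeff_diag: "Polynomial.coeff (diag \<psi> u) n = mconst (\<psi> n) * Polynomial.coeff u n"
  by (simp add: diag_def coeff_coeffwise)

lemma diag_level: "periodic q \<psi> \<Longrightarrow> diag \<psi> \<in> level_ops q"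
  unfolding diag_def level_ops_def level_family_def
  by (auto simp: frob_linear_mult periodic_def intro!: exI[of _ "\<lambda>n. (*) (mconst (\<psi> n))"])

lemma D_Rt_a_inv:
  assumes "P \<in> carrier D_Rt_ring" "(\<lambda>u. - P u) \<in> carrier D_Rt_ring"
  shows "\<ominus>\<^bsub>D_Rt_ring\<^esub> P = (\<lambda>u. - P u)"
  unfolding a_inv_def m_inv_def
proof (rule the_equality)
  fix Q
  assume "Q \<in> carrier (add_monoid D_Rt_ring) \<and> P \<otimes>\<^bsub>add_monoid D_Rt_ring\<^esub> Q = \<one>\<^bsub>add_monoid D_Rt_ring\<^esub> \<and>
      Q \<otimes>\<^bsub>add_monoid D_Rt_ring\<^esub> P = \<one>\<^bsub>add_monoid D_Rt_ring\<^esub>"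
  then have "(\<lambda>u. P u + Q u) = (\<lambda>u. 0)" by (simp add: D_Rt_ring_def diff_op_ring_def)
  then show "Q = (\<lambda>u. - P u)" by (metis eq_neg_iff_add_eq_0 add.commute)
qed (use assms in \<open>auto simp: D_Rt_ring_def diff_op_ring_def\<close>)
text \<open>
  Both kinds of generators have the stated form, and it is preserved by the ring operations.
  Conversely, multiplication of the coefficients by a periodic function is a polynomial in the Euler
  operators; with the indicator functions of the residues modulo \<open>p ^ e\<close> one separates the
  components of an operator.
\<close>

lemma D_R_euler_eq:
  assumes p: "Factorial_Ring.prime CHAR('k::field)" and perf: "surj (\<lambda>x::'k. x ^ CHAR('k))"
  shows "(D_R_euler CHAR('k) :: (('n::{finite,linorder}, 'k) mpoly poly \<Rightarrow> ('n, 'k) mpoly poly) set)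
    = (\<Union>e. level_ops (CHAR('k) ^ e))" (is "?G = ?L")
proof
  let ?p = "CHAR('k)" and ?D = "D_Rt_ring :: (('n, 'k) mpoly poly \<Rightarrow> ('n, 'k) mpoly poly) ring"
  have L_carrier: "T \<in> carrier ?D" if "T \<in> ?L" for T
  proof -
    obtain e where e: "T \<in> level_ops (?p ^ e)" using \<open>T \<in> ?L\<close> by blast
    have "T \<in> frob_linear (?p ^ e)"
      by (rule level_ops_frob_linear[OF _ _ e]) (simp_all add: p)
    then show ?thesis
      using frob_linear_diff_op_Rt[OF p perf refl] by (simp add: D_Rt_ring_def diff_op_ring_def)
  qed
  have common: "\<exists>e. S \<in> level_ops (?p ^ e) \<and> T \<in> level_ops (?p ^ e)"
    if "S \<in> ?L" "T \<in> ?L" for S T :: "('n, 'k) mpoly poly \<Rightarrow> ('n, 'k) mpoly poly"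
  proof -
    obtain e e' where "S \<in> level_ops (?p ^ e)" "T \<in> level_ops (?p ^ e')" using \<open>S \<in> ?L\<close> \<open>T \<in> ?L\<close> by blast
    then have "S \<in> level_ops (?p ^ max e e')" "T \<in> level_ops (?p ^ max e e')"
      using level_ops_dvd[OF le_imp_power_dvd, of e "max e e'" ?p]
        level_ops_dvd[OF le_imp_power_dvd, of e' "max e e'" ?p] by auto
    then show ?thesis by blast
  qed
  have L_neg: "(\<lambda>u. - T u) \<in> ?L" if "T \<in> ?L" for T :: "('n, 'k) mpoly poly \<Rightarrow> ('n, 'k) mpoly poly"
    using that level_ops_closed(3) by blast
  show "?G \<subseteq> ?L"
  proof
    fix T assume "T \<in> ?G"
    then have "T \<in> generate_ring ?D (map_poly ` D_R \<union> range (euler_op ?p))" by (simp add: D_R_euler_def)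
    then show "T \<in> ?L"
    proof induction
      case one
      have "\<one>\<^bsub>?D\<^esub> = diag (\<lambda>n. 1 :: 'k)"
        by (auto intro!: ext poly_eqI simp: coeff_diag mconst_simps D_Rt_ring_def diff_op_ring_def)
      moreover have "diag (\<lambda>n. 1 :: 'k) \<in> level_ops (?p ^ 0)"
        by (rule diag_level) (simp add: periodic_def)
      ultimately show ?case by (metis UN_I UNIV_I)
    next
      case (incl T)
      then show ?case
      proof
        assume "T \<in> map_poly ` D_R"
        then obtain P where P: "T = map_poly P" "P \<in> D_R" by blast
        then obtain e where e: "P \<in> frob_linear (?p ^ e)" using diff_op_frob_linear[OF p] by blast
        have "T = coeffwise (\<lambda>_. P)"
          using e frob_linear_zero[OF e] by (auto intro!: poly_eqI simp: P(1) coeff_coeffwise coeff_map_poly)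
        moreover have "level_family (?p ^ e) (\<lambda>_. P)" using e by (simp add: level_family_def periodic_def)
        ultimately show ?thesis by (auto simp: level_ops_def)
      next
        assume "T \<in> range (euler_op ?p)"
        then obtain e where "T = euler_op ?p e" by blast
        then show ?thesis
          using euler_op_level[where ?'a = "('n, 'k) mpoly", of e] p by (intro UN_I[of "Suc e"]) simp_all
      qed
    next
      case (a_inv T)
      then show ?case using D_Rt_a_inv[OF L_carrier L_carrier[OF L_neg], of T] L_neg[of T] by simp
    next
      case (eng_add S T)
      then obtain e where "S \<in> level_ops (?p ^ e)" "T \<in> level_ops (?p ^ e)" using common by blast
      then have "(\<lambda>u. S u + T u) \<in> ?L" using level_ops_closed(1) by blast
      then show ?case by (simp add: D_Rt_ring_def diff_op_ring_def)
    next
      case (eng_mult S T)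
      then obtain e where "S \<in> level_ops (?p ^ e)" "T \<in> level_ops (?p ^ e)" using common by blast
      then have "(\<lambda>u. S (T u)) \<in> ?L" using level_ops_closed(2) by blast
      then show ?case by (simp add: D_Rt_ring_def diff_op_ring_def compose_def)
    qed
  qed
  have G_add: "(\<lambda>u. S u + T u) \<in> ?G" if "S \<in> ?G" "T \<in> ?G" for S T
    using generate_ring.eng_add[of S ?D _ T] that by (simp add: D_R_euler_def) (simp add: D_Rt_ring_def diff_op_ring_def)
  have G_mult: "(\<lambda>u. S (T u)) \<in> ?G" if "S \<in> ?G" "T \<in> ?G" for S T
    using generate_ring.eng_mult[of S ?D _ T] that by (simp add: D_R_euler_def) (simp add: D_Rt_ring_def diff_op_ring_def compose_def)
  have G_one: "(\<lambda>u. u) \<in> ?G"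
    using generate_ring.one[of ?D] by (simp add: D_R_euler_def) (simp add: D_Rt_ring_def diff_op_ring_def)
  have G_neg: "(\<lambda>u. - T u) \<in> ?G" if "T \<in> ?G" for T
  proof -
    have "T \<in> ?L" using that \<open>?G \<subseteq> ?L\<close> by blast
    then show ?thesis using generate_ring.a_inv[of T ?D] that D_Rt_a_inv[OF L_carrier L_carrier[OF L_neg], of T]
      by (simp add: D_R_euler_def)
  qed
  have G_zero: "(\<lambda>u. 0) \<in> ?G" using G_add[OF G_one G_neg[OF G_one]] by simp
  have G_sum: "(\<lambda>u. \<Sum>i\<in>I. F i u) \<in> ?G" if "\<And>i. i \<in> I \<Longrightarrow> F i \<in> ?G" for I :: "nat set" and F
    using that by (induction I rule: infinite_finite_induct) (auto intro: G_zero G_add)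
  have G_map: "map_poly P \<in> ?G" if "P \<in> frob_linear (?p ^ e)" for P e
    using generate_ring.incl[of "map_poly P" _ ?D] frob_linear_diff_op[OF p perf refl that] by (simp add: D_R_euler_def)
  have G_diag: "diag \<psi> \<in> ?G" if "periodic (?p ^ e) \<psi>" for \<psi> e
  proof -
    have "\<psi> \<in> {\<psi>. diag \<psi> \<in> ?G}"
    proof (rule periodic_closed_under_generators[OF p _ _ _ _ that])
      show "(\<lambda>l. c) \<in> {\<psi>. diag \<psi> \<in> ?G}" for c
      proof -
        have "(diag (\<lambda>l. c) :: ('n, 'k) mpoly poly \<Rightarrow> _) = map_poly ((*) (mconst c))"
          by (auto intro!: poly_eqI simp: coeff_diag coeff_map_poly)
        then show ?thesis using G_map[OF frob_linear_mult] by simp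
      qed
      show "binom_fun (?p ^ e) \<in> {\<psi>. diag \<psi> \<in> ?G}" for e
      proof -
        have "(diag (binom_fun (?p ^ e)) :: ('n, 'k) mpoly poly \<Rightarrow> _) = (\<lambda>u. euler_op ?p e u + - u)"
          using choose_add_CHAR_power[OF p refl, of _ e "?p ^ e"]
          by (auto intro!: poly_eqI simp: coeff_diag coeff_coeffwise euler_op_coeffwise binom_fun_def
              mconst_simps algebra_simps simp flip: of_nat_add mconst_simps(7))
        moreover have "euler_op ?p e \<in> ?G"
          using generate_ring.incl[of "euler_op ?p e" _ ?D] by (simp add: D_R_euler_def)
        ultimately show ?thesis using G_add[OF _ G_neg[OF G_one]] by simp
      qed
      show "(\<lambda>l. \<phi> l + \<psi> l) \<in> {\<psi>. diag \<psi> \<in> ?G}" if "\<phi> \<in> {\<psi>. diag \<psi> \<in> ?G}" "\<psi> \<in> {\<psi>. diag \<psi> \<in> ?G}" for \<phi> \<psi>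
      proof -
        have "(diag (\<lambda>l. \<phi> l + \<psi> l) :: ('n, 'k) mpoly poly \<Rightarrow> _) = (\<lambda>u. diag \<phi> u + diag \<psi> u)"
          by (auto intro!: poly_eqI simp: coeff_diag mconst_simps algebra_simps)
        then show ?thesis using that G_add by simp
      qed
      show "(\<lambda>l. \<phi> l * \<psi> l) \<in> {\<psi>. diag \<psi> \<in> ?G}" if "\<phi> \<in> {\<psi>. diag \<psi> \<in> ?G}" "\<psi> \<in> {\<psi>. diag \<psi> \<in> ?G}" for \<phi> \<psi>
      proof -
        have "(diag (\<lambda>l. \<phi> l * \<psi> l) :: ('n, 'k) mpoly poly \<Rightarrow> _) = (\<lambda>u. diag \<phi> (diag \<psi> u))"
          by (auto intro!: poly_eqI simp: coeff_diag mconst_simps algebra_simps)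
        then show ?thesis using that G_mult by simp
      qed
    qed
    then show ?thesis by simp
  qed
  show "?L \<subseteq> ?G"
  proof
    fix T assume "T \<in> ?L"
    then obtain e P where T: "T = coeffwise P" and P: "level_family (?p ^ e) P" by (auto simp: level_ops_def)
    define ind :: "nat \<Rightarrow> nat \<Rightarrow> 'k" where "ind c n = (if n mod ?p ^ e = c then 1 else 0)" for c n
    have "T = (\<lambda>u. \<Sum>c<?p ^ e. map_poly (P c) (diag (ind c) u))"
    proof (intro ext poly_eqI)
      fix u n
      have P0: "P c 0 = 0" for c using P by (rule level_family_zero)
      have "Polynomial.coeff (\<Sum>c<?p ^ e. map_poly (P c) (diag (ind c) u)) n =
          (\<Sum>c<?p ^ e. if c = n mod ?p ^ e then P c (Polynomial.coeff u n) else 0)"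
        unfolding coeff_sum
        by (intro sum.cong) (auto simp: coeff_map_poly P0 coeff_diag ind_def mconst_simps)
      also have "\<dots> = P (n mod ?p ^ e) (Polynomial.coeff u n)"
        using p by (simp add: prime_gt_0_nat)
      also have "P (n mod ?p ^ e) = P n" using P by (simp add: level_family_def periodic_mod)
      finally show "Polynomial.coeff (T u) n = Polynomial.coeff (\<Sum>c<?p ^ e. map_poly (P c) (diag (ind c) u)) n"
        by (simp add: T coeff_coeffwise_level[OF P])
    qed
    moreover have "(\<lambda>u. map_poly (P c) (diag (ind c) u)) \<in> ?G" for c
    proof -
      have "map_poly (P c) \<in> ?G" using P by (intro G_map[of _ e]) (simp add: level_family_def)
      moreover have "diag (ind c) \<in> ?G" by (rule G_diag[of e]) (simp add: periodic_def ind_def)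
      ultimately show ?thesis by (rule G_mult)
    qed
    then have "(\<lambda>u. \<Sum>c<?p ^ e. map_poly (P c) (diag (ind c) u)) \<in> ?G"
      by (rule G_sum)
    ultimately show "T \<in> ?G" by (simp only:)
  qed
qed

section \<open>The module generated by \<open>1 / (f - t)\<close>\<close>

lemma quot_map_coset:
  assumes "group G" "subgroup H G" "T \<in> hom G G" "T ` H \<subseteq> H" "u \<in> carrier G"
  shows "quot_map G H T (H #>\<^bsub>G\<^esub> u) = H #>\<^bsub>G\<^esub> T u"
proof -
  interpret group G by fact
  interpret H: subgroup H G by fact
  have Hc: "\<And>x. x \<in> H \<Longrightarrow> x \<in> carrier G" by (rule H.mem_carrier)
  have Tc: "T u \<in> carrier G" "\<And>x. x \<in> H \<Longrightarrow> T x \<in> H" using assms by (auto simp: hom_def)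
  have Thom: "T (x \<otimes>\<^bsub>G\<^esub> u) = T x \<otimes>\<^bsub>G\<^esub> T u" if "x \<in> H" for x
    using assms(3,5) Hc[OF that] by (auto simp: hom_def)
  have "H <#>\<^bsub>G\<^esub> (T ` (H #>\<^bsub>G\<^esub> u)) = H #>\<^bsub>G\<^esub> T u"
  proof (intro equalityI subsetI)
    fix y assume "y \<in> H <#>\<^bsub>G\<^esub> (T ` (H #>\<^bsub>G\<^esub> u))"
    then obtain x x' where x: "x \<in> H" "x' \<in> H" "y = x \<otimes>\<^bsub>G\<^esub> T (x' \<otimes>\<^bsub>G\<^esub> u)"
      by (auto simp: set_mult_def r_coset_def)
    then have "y = (x \<otimes>\<^bsub>G\<^esub> T x') \<otimes>\<^bsub>G\<^esub> T u"
      using Hc Tc by (simp add: Thom m_assoc)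
    moreover have "x \<otimes>\<^bsub>G\<^esub> T x' \<in> H" using x Tc(2) by simp
    ultimately show "y \<in> H #>\<^bsub>G\<^esub> T u" by (auto simp: r_coset_def)
  next
    fix y assume "y \<in> H #>\<^bsub>G\<^esub> T u"
    then obtain x where x: "x \<in> H" "y = x \<otimes>\<^bsub>G\<^esub> T u" by (auto simp: r_coset_def)
    have "T u = T (\<one>\<^bsub>G\<^esub> \<otimes>\<^bsub>G\<^esub> u)" using assms(5) by simp
    then show "y \<in> H <#>\<^bsub>G\<^esub> (T ` (H #>\<^bsub>G\<^esub> u))"
      using x H.one_closed unfolding set_mult_def r_coset_def by blast
  qed
  then show ?thesis using assms(5) by (simp add: quot_map_def carrier_FactGroup)
qed

locale b_function_setup =
  fixes p :: nat and f :: "('n::{finite,linorder}, 'k::field) mpoly"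
  assumes prime_p: "Factorial_Ring.prime p" and CHAR_p: "CHAR('k) = p"
    and perfect: "surj (\<lambda>x::'k. x ^ p)"
begin

abbreviation h :: "('n, 'k) mpoly poly" where "h \<equiv> [:f, -1:]"

definition frob_ops :: "(('n, 'k) mpoly poly \<Rightarrow> ('n, 'k) mpoly poly) set" where
  "frob_ops = (\<Union>e. frob_linear (p ^ e))"
text \<open>
  The operators of \<open>D_R_euler\<close>. They lie in the larger ring \<open>frob_ops\<close>, which also contains the
  multiplication by \<open>t\<close> and for which the extension to the localisation is explicit.
\<close>

definition ops :: "(('n, 'k) mpoly poly \<Rightarrow> ('n, 'k) mpoly poly) set" where
  "ops = (\<Union>e. level_ops (p ^ e))"

lemma p_pos: "p > 0" using prime_p by (simp add: prime_gt_0_nat)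

lemma D_R_euler_ops: "D_R_euler p = ops"
  using D_R_euler_eq[where ?'k = 'k and ?'n = 'n] prime_p perfect CHAR_p by (simp add: ops_def)

lemma ops_frob_ops: "T \<in> ops \<Longrightarrow> T \<in> frob_ops"
  using level_ops_frob_linear[where ?'a = "('n, 'k) mpoly", OF _ refl] prime_p CHAR_p
  by (auto simp: ops_def frob_ops_def)

lemma p_dvd_max: "p ^ e dvd p ^ max e e'" "p ^ e' dvd p ^ max e e'"
  by (simp_all add: le_imp_power_dvd)

lemma frob_ops_common:
  assumes "S \<in> frob_ops" "T \<in> frob_ops"
  obtains e where "S \<in> frob_linear (p ^ e)" "T \<in> frob_linear (p ^ e)"
proof -
  obtain e e' where e: "S \<in> frob_linear (p ^ e)" "T \<in> frob_linear (p ^ e')"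
    using assms by (auto simp: frob_ops_def)
  show ?thesis
    by (rule that[OF frob_linear_dvd[OF e(1) p_dvd_max(1)] frob_linear_dvd[OF e(2) p_dvd_max(2)]])
qed

lemma ops_common:
  assumes "S \<in> ops" "T \<in> ops"
  obtains e where "S \<in> level_ops (p ^ e)" "T \<in> level_ops (p ^ e)"
proof -
  obtain e e' where e: "S \<in> level_ops (p ^ e)" "T \<in> level_ops (p ^ e')"
    using assms by (auto simp: ops_def)
  show ?thesis
    by (rule that[OF subsetD[OF level_ops_dvd[OF p_dvd_max(1)] e(1)] subsetD[OF level_ops_dvd[OF p_dvd_max(2)] e(2)]])
qed

lemma frob_opsI: "T \<in> frob_linear (p ^ e) \<Longrightarrow> T \<in> frob_ops"
  by (auto simp: frob_ops_def)

lemma opsI: "T \<in> level_ops (p ^ e) \<Longrightarrow> T \<in> ops"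
  by (auto simp: ops_def)

lemma frob_ops_closed:
  assumes "S \<in> frob_ops" "T \<in> frob_ops"
  shows "(\<lambda>u. S u + T u) \<in> frob_ops" "(\<lambda>u. S (T u)) \<in> frob_ops"
proof -
  obtain e where e: "S \<in> frob_linear (p ^ e)" "T \<in> frob_linear (p ^ e)"
    by (rule frob_ops_common[OF assms])
  show "(\<lambda>u. S u + T u) \<in> frob_ops" "(\<lambda>u. S (T u)) \<in> frob_ops"
    by (rule frob_opsI[OF frob_linear_closed(1)[OF e]], rule frob_opsI[OF frob_linear_closed(3)[OF e]])
qed

lemma ops_closed:
  shows "S \<in> ops \<Longrightarrow> T \<in> ops \<Longrightarrow> (\<lambda>u. S u + T u) \<in> ops"
    and "S \<in> ops \<Longrightarrow> T \<in> ops \<Longrightarrow> (\<lambda>u. S (T u)) \<in> ops"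
    and "S \<in> ops \<Longrightarrow> (\<lambda>u. - S u) \<in> ops"
proof -
  assume S: "S \<in> ops"
  show "(\<lambda>u. - S u) \<in> ops"
    by (rule ops_common[OF S S]) (rule opsI[OF level_ops_closed(3)])
  assume T: "T \<in> ops"
  show "(\<lambda>u. S u + T u) \<in> ops"
    by (rule ops_common[OF S T]) (rule opsI[OF level_ops_closed(1)])
  show "(\<lambda>u. S (T u)) \<in> ops"
    by (rule ops_common[OF S T]) (rule opsI[OF level_ops_closed(2)])
qed

lemma mult_frob_ops: "(*) c \<in> frob_ops"
  by (rule frob_opsI[of _ 0]) (rule frob_linear_mult)

lemma mult_const_ops: "(*) [:r:] \<in> ops"
proof -
  have "(*) [:r:] = coeffwise (\<lambda>_. (*) r)"
    by (auto intro!: ext poly_eqI simp: coeff_coeffwise)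
  moreover have "level_family (p ^ 0) (\<lambda>_::nat. (*) r)"
    by (simp add: level_family_def frob_linear_mult periodic_def)
  ultimately have "(*) [:r:] \<in> level_ops (p ^ 0)" by (auto simp: level_ops_def)
  then show ?thesis by (rule opsI)
qed

lemma id_ops: "(\<lambda>u. u) \<in> ops"
proof -
  have "(*) [:1:] = (\<lambda>u :: ('n, 'k) mpoly poly. u)" by auto
  then show ?thesis using mult_const_ops[of 1] by (simp only:)
qed

lemma zero_ops: "(\<lambda>u. 0) \<in> ops"
  using ops_closed(1)[OF id_ops ops_closed(3)[OF id_ops]] by simp

subsection \<open>The localisation\<close>

lemma h_nonzero: "h \<noteq> 0" by simp

lemma loc_localisation: "loc f = localisation h"
  by (simp add: loc_def localisation_def)

lemma extend_op_eq:
  assumes "T \<in> frob_linear (p ^ e)"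
  shows "extend_op f T = loc_ext (p ^ e) h T"
  unfolding extend_op_def
proof (rule the_equality)
  have prime: "Factorial_Ring.prime CHAR('k)" using prime_p CHAR_p by simp
  have K: "range (\<lambda>c. Fract [:mconst c:] 1) = (\<lambda>c. Fract c 1) ` range (\<lambda>c. [:mconst c:] :: ('n, 'k) mpoly poly)"
    by auto
  have comm: "T (h ^ p ^ e * x) = h ^ p ^ e * T x" for x
    using assms by (simp add: frob_linear_def)
  have "T \<in> diff_ops (range (\<lambda>c. [:mconst c:])) UNIV"
    using assms frob_linear_diff_op_Rt[OF prime _ refl] perfect CHAR_p by simp
  then obtain m where "T \<in> diff_ops_lt (range (\<lambda>c. [:mconst c:])) UNIV m" by (auto simp: diff_ops_def)
  from loc_ext_diff_op[of h "p ^ e" T, OF h_nonzero _ comm this]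
  have "loc_ext (p ^ e) h T \<in> diff_ops (range (\<lambda>c. Fract [:mconst c:] 1)) (loc f)"
    using p_pos unfolding K loc_localisation by (auto simp: diff_ops_def)
  moreover have "loc_ext (p ^ e) h T (Fract a 1) = Fract (T a) 1" for a
    using loc_ext_Fract[of h T "p ^ e" a 0, OF h_nonzero comm] by simp
  ultimately show "loc_ext (p ^ e) h T \<in> diff_ops (range (\<lambda>c. Fract [:mconst c:] 1)) (loc f) \<and>
     (\<forall>a. loc_ext (p ^ e) h T (Fract a 1) = Fract (T a) 1)" by blast
  fix Q assume Q: "Q \<in> diff_ops (range (\<lambda>c. Fract [:mconst c:] 1)) (loc f) \<and> (\<forall>a. Q (Fract a 1) = Fract (T a) 1)"
  show "Q = loc_ext (p ^ e) h T"
  proof (rule loc_ext_unique[where e = e])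
    show "Factorial_Ring.prime CHAR(('n, 'k) mpoly poly)" using prime by simp
    show "p ^ e = CHAR(('n, 'k) mpoly poly) ^ e" using CHAR_p by simp
    show "Q \<in> diff_ops ((\<lambda>c. Fract c 1) ` range (\<lambda>c. [:mconst c:])) (localisation h)"
      using Q unfolding K loc_localisation by blast
  qed (use Q comm in auto)
qed

lemma extend_op_Fract:
  assumes "T \<in> frob_linear (p ^ e)"
  shows "extend_op f T (Fract b (h ^ (n * p ^ e))) = Fract (T b) (h ^ (n * p ^ e))"
  unfolding extend_op_eq[OF assms]
  by (rule loc_ext_Fract) (use assms in \<open>simp_all add: frob_linear_def\<close>)

lemma extend_op_base: "T \<in> frob_ops \<Longrightarrow> extend_op f T (Fract b 1) = Fract (T b) 1"
  using extend_op_Fract[of T _ b 0] by (auto simp: frob_ops_def)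

lemma loc_cases:
  assumes "u \<in> loc f" obtains b n where "u = Fract b (h ^ (n * p ^ e))"
  using localisation_common_denominator[of "p ^ e" h u] assms h_nonzero p_pos
  by (auto simp: loc_localisation)

lemma extend_op_closed:
  assumes "T \<in> frob_ops" "u \<in> loc f" shows "extend_op f T u \<in> loc f"
proof -
  obtain e where e: "T \<in> frob_linear (p ^ e)" using assms by (auto simp: frob_ops_def)
  obtain b n where "u = Fract b (h ^ (n * p ^ e))" by (rule loc_cases[OF assms(2)])
  then show ?thesis using extend_op_Fract[OF e] Fract_in_localisation by (simp add: loc_localisation)
qed

lemma extend_op_add:
  assumes "T \<in> frob_ops" "u \<in> loc f" "v \<in> loc f"
  shows "extend_op f T (u + v) = extend_op f T u + extend_op f T v"
proof -
  obtain e where e: "T \<in> frob_linear (p ^ e)" using assms by (auto simp: frob_ops_def)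
  have pe: "p ^ e > 0" using p_pos by simp
  obtain b c n where *: "u = Fract b (h ^ (n * p ^ e))" "v = Fract c (h ^ (n * p ^ e))"
    by (rule localisation_common_denominators[OF pe h_nonzero assms(2,3)[unfolded loc_localisation]])
  have sum: "Fract b (h ^ (n * p ^ e)) + Fract c (h ^ (n * p ^ e)) = Fract (b + c) (h ^ (n * p ^ e))" for b c
    by (simp add: eq_fract algebra_simps)
  have "T (b + c) = T b + T c" using e by (simp add: frob_linear_def)
  then show ?thesis unfolding * by (simp only: sum extend_op_Fract[OF e])
qed

lemma extend_op_compose:
  assumes "S \<in> frob_ops" "T \<in> frob_ops" "u \<in> loc f"
  shows "extend_op f (\<lambda>x. S (T x)) u = extend_op f S (extend_op f T u)"
    "extend_op f (\<lambda>x. S x + T x) u = extend_op f S u + extend_op f T u"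
proof -
  obtain e where e: "S \<in> frob_linear (p ^ e)" "T \<in> frob_linear (p ^ e)"
    by (rule frob_ops_common[OF assms(1,2)])
  obtain b n where u: "u = Fract b (h ^ (n * p ^ e))" by (rule loc_cases[OF assms(3)])
  show "extend_op f (\<lambda>x. S (T x)) u = extend_op f S (extend_op f T u)"
    unfolding u by (simp only: extend_op_Fract e frob_linear_closed)
  have sum: "Fract b (h ^ (n * p ^ e)) + Fract c (h ^ (n * p ^ e)) = Fract (b + c) (h ^ (n * p ^ e))" for b c
    by (simp add: eq_fract algebra_simps)
  show "extend_op f (\<lambda>x. S x + T x) u = extend_op f S u + extend_op f T u"
    unfolding u by (simp only: extend_op_Fract e frob_linear_closed sum)
qed

lemma loc_comm_group: "comm_group (loc_group f)"
proof (rule comm_groupI)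
  note D = subring_setD[OF subring_set_localisation[OF h_nonzero], folded loc_localisation]
  show "\<exists>v\<in>carrier (loc_group f). v \<otimes>\<^bsub>loc_group f\<^esub> u = \<one>\<^bsub>loc_group f\<^esub>" if "u \<in> carrier (loc_group f)" for u
    using that D(4)[OF D(1), of u] by (intro bexI[of _ "- u"]) (auto simp: loc_group_def)
qed (use subring_setD[OF subring_set_localisation[OF h_nonzero], folded loc_localisation] in
      \<open>auto simp: loc_group_def algebra_simps\<close>)

lemma Rt_subgroup: "subgroup Rt_in_loc (loc_group f)"
proof -
  interpret comm_group "loc_group f" by (rule loc_comm_group)
  have "Rt_in_loc \<subseteq> loc f" by (auto simp: Rt_in_loc_def loc_localisation Fract_1_in_localisation)
  have inv: "inv\<^bsub>loc_group f\<^esub> (Fract a 1) = Fract (- a) 1" for a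
    by (rule inv_equality)
      (auto simp: loc_group_def loc_localisation Fract_1_in_localisation Zero_fract_def eq_fract)
  show ?thesis
  proof (rule subgroupI)
    show "Rt_in_loc \<subseteq> carrier (loc_group f)" using \<open>Rt_in_loc \<subseteq> loc f\<close> by (simp add: loc_group_def)
  qed (auto simp: Rt_in_loc_def inv, auto simp: loc_group_def)
qed

abbreviation coset :: "('n, 'k) mpoly poly fract \<Rightarrow> ('n, 'k) mpoly poly fract set" where
  "coset u \<equiv> Rt_in_loc #>\<^bsub>loc_group f\<^esub> u"

lemma coset_eq_iff:
  assumes "u \<in> loc f" "v \<in> loc f"
  shows "coset u = coset v \<longleftrightarrow> u - v \<in> Rt_in_loc"
proof -
  interpret comm_group "loc_group f" by (rule loc_comm_group)
  have "coset u = coset v \<longleftrightarrow> u \<in> coset v"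
    using repr_independence[OF _ _ Rt_subgroup, of u v] rcos_self[OF _ Rt_subgroup, of u] assms
    by (auto simp: loc_group_def)
  also have "\<dots> \<longleftrightarrow> u - v \<in> Rt_in_loc"
    by (auto simp: r_coset_def loc_group_def) (metis add.commute diff_add_cancel)
  finally show ?thesis .
qed

lemma B_comm_group: "comm_group (B_mod f)"
  unfolding B_mod_def by (rule comm_group.abelian_FactGroup[OF loc_comm_group Rt_subgroup])

lemma B_mult: "u \<in> loc f \<Longrightarrow> v \<in> loc f \<Longrightarrow> coset u \<otimes>\<^bsub>B_mod f\<^esub> coset v = coset (u + v)"
  using normal.rcos_sum[OF comm_group.normal_iff_subgroup[OF loc_comm_group, THEN iffD2, OF Rt_subgroup], of u v]
  by (simp add: B_mod_def loc_group_def)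

lemma B_cases:
  assumes "m \<in> carrier (B_mod f)" obtains u where "u \<in> loc f" "m = coset u"
  using assms unfolding B_mod_def by (auto simp: carrier_FactGroup loc_group_def)

lemma coset_B: "u \<in> loc f \<Longrightarrow> coset u \<in> carrier (B_mod f)"
  unfolding B_mod_def by (auto simp: carrier_FactGroup loc_group_def)

lemma act_B_coset:
  assumes "T \<in> frob_ops" "u \<in> loc f"
  shows "act_B f T (coset u) = coset (extend_op f T u)"
  unfolding act_B_def
proof (rule quot_map_coset)
  show "group (loc_group f)" by (rule comm_group.axioms(2)[OF loc_comm_group])
  show "extend_op f T \<in> hom (loc_group f) (loc_group f)"
    using extend_op_closed[OF assms(1)] extend_op_add[OF assms(1)] by (auto simp: hom_def loc_group_def)
  show "extend_op f T ` Rt_in_loc \<subseteq> Rt_in_loc"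
    using extend_op_base[OF assms(1)] by (auto simp: Rt_in_loc_def)
  show "u \<in> carrier (loc_group f)" using assms(2) by (simp add: loc_group_def)
qed (rule Rt_subgroup)

lemma act_B_closed: "T \<in> frob_ops \<Longrightarrow> m \<in> carrier (B_mod f) \<Longrightarrow> act_B f T m \<in> carrier (B_mod f)"
  by (auto elim!: B_cases simp: act_B_coset extend_op_closed coset_B)

lemma act_B_mult:
  assumes "T \<in> frob_ops" "m \<in> carrier (B_mod f)" "m' \<in> carrier (B_mod f)"
  shows "act_B f T (m \<otimes>\<^bsub>B_mod f\<^esub> m') = act_B f T m \<otimes>\<^bsub>B_mod f\<^esub> act_B f T m'"
proof -
  obtain u v where *: "u \<in> loc f" "m = coset u" "v \<in> loc f" "m' = coset v"
    by (metis B_cases assms(2,3))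
  moreover have "u + v \<in> loc f"
    using *(1,3) subring_setD(3)[OF subring_set_localisation[OF h_nonzero]] by (simp add: loc_localisation)
  ultimately show ?thesis using assms(1)
    by (simp add: B_mult act_B_coset extend_op_closed extend_op_add)
qed

lemma act_B_compose:
  assumes "S \<in> frob_ops" "T \<in> frob_ops" "m \<in> carrier (B_mod f)"
  shows "act_B f (\<lambda>x. S (T x)) m = act_B f S (act_B f T m)"
    "act_B f (\<lambda>x. S x + T x) m = act_B f S m \<otimes>\<^bsub>B_mod f\<^esub> act_B f T m"
  using assms frob_ops_closed[OF assms(1,2)]
  by (auto elim!: B_cases simp: act_B_coset extend_op_closed extend_op_compose B_mult)

subsection \<open>The generator\<close>

lemma delta_B: "delta f \<in> carrier (B_mod f)"
  unfolding delta_def using coset_B[of "Fract 1 h"] Fract_in_localisation[of 1 h 1] by (simp add: loc_localisation)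

definition elt :: "(('n, 'k) mpoly poly \<Rightarrow> ('n, 'k) mpoly poly) \<Rightarrow> ('n, 'k) mpoly poly fract set" where
  "elt T = act_B f T (delta f)"

lemma elt_B: "T \<in> frob_ops \<Longrightarrow> elt T \<in> carrier (B_mod f)"
  by (simp add: elt_def act_B_closed delta_B)

text \<open>At level \<open>e\<close> write the generator as \<open>(f - t) ^ (p ^ e - 1) / (f - t) ^ (p ^ e)\<close>; the denominator is
  now a scalar for the operators of that level.\<close>

lemma elt_eq:
  assumes "T \<in> frob_linear (p ^ e)"
  shows "elt T = coset (Fract (T (h ^ (p ^ e - 1))) (h ^ (p ^ e)))"
proof -
  have q: "p ^ e = Suc (p ^ e - 1)" using p_pos by simp
  have "h ^ (p ^ e) = h * h ^ (p ^ e - 1)" using q by (metis power_Suc)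
  then have "Fract 1 h = Fract (h ^ (p ^ e - 1)) (h ^ (1 * p ^ e))"
    by (simp add: eq_fract del: mult_pCons_left mult_pCons_right)
  moreover have "Fract 1 h \<in> loc f" using Fract_in_localisation[of 1 h 1] by (simp add: loc_localisation)
  moreover have "T \<in> frob_ops" using assms by (auto simp: frob_ops_def)
  ultimately show ?thesis
    using extend_op_Fract[OF assms, of "h ^ (p ^ e - 1)" 1] by (simp add: elt_def delta_def act_B_coset)
qed
text \<open>
  \<open>(f - t) ^ q = f ^ q - t ^ q\<close> is \<open>f - t\<close> times the sum of the \<open>f ^ (q - 1 - i) t ^ i\<close>.
\<close>

lemma coeff_h_power:
  "Polynomial.coeff (h ^ (p ^ e - 1)) i = (if i < p ^ e then f ^ (p ^ e - 1 - i) else 0)"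
proof -
  let ?q = "p ^ e"
  define v where "v = (\<Sum>i<?q. Polynomial.monom (f ^ (?q - 1 - i)) i)"
  have q: "?q = Suc (?q - 1)" using p_pos by simp
  have prime: "Factorial_Ring.prime CHAR(('n, 'k) mpoly poly)" "?q = CHAR(('n, 'k) mpoly poly) ^ e"
    using prime_p CHAR_p by simp_all
  have "[:f:] = h + [:0, 1:]" by simp
  then have "[:f:] ^ ?q = h ^ ?q + [:0, 1:] ^ ?q"
    using freshmans_dream'[OF prime, of h "[:0, 1:]"] by (simp only:)
  then have "h ^ ?q = - ([:0, 1:] ^ ?q - [:f:] ^ ?q)" by simp
  also have "\<dots> = - (([:0, 1:] - [:f:]) * (\<Sum>i<?q. [:f:] ^ (?q - Suc i) * [:0, 1:] ^ i))"
    by (simp only: power_diff_sumr2)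
  also have "\<dots> = h * (\<Sum>i<?q. [:f:] ^ (?q - Suc i) * [:0, 1:] ^ i)"
    unfolding mult_minus_left[symmetric] by simp
  also have "(\<Sum>i<?q. [:f:] ^ (?q - Suc i) * [:0, 1:] ^ i) = v"
    unfolding v_def by (intro sum.cong) (simp_all add: poly_const_pow monom_altdef)
  finally have "h * h ^ (?q - 1) = h * v" using q by (metis power_Suc)
  then have "h ^ (?q - 1) = v" by (metis h_nonzero mult_cancel_left)
  then show ?thesis by (simp add: v_def coeff_sum coeff_monom)
qed

lemma degree_h_power: "Polynomial.degree (h ^ n) = n"
  by (simp add: degree_power_eq)
text \<open>
  Over the common denominator \<open>(f - t) ^ (p ^ e)\<close> both numerators have smaller degree than the
  denominator, so they agree modulo \<open>R[t]\<close> only if they are equal.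
\<close>

lemma elt_eq_iff:
  assumes "level_family (p ^ e) P" "level_family (p ^ e) Q"
  shows "elt (coeffwise P) = elt (\<lambda>u. coeffwise Q ([:f:] * u)) \<longleftrightarrow>
     (\<forall>i < p ^ e. P i (f ^ (p ^ e - 1 - i)) = Q i (f ^ (p ^ e - i)))"
proof -
  let ?q = "p ^ e"
  have prime: "Factorial_Ring.prime CHAR(('n, 'k) mpoly)" "?q = CHAR(('n, 'k) mpoly) ^ e"
    using prime_p CHAR_p by simp_all
  have "coeffwise P \<in> level_ops ?q" "coeffwise Q \<in> level_ops ?q" using assms by (auto simp: level_ops_def)
  then have PQ: "coeffwise P \<in> frob_linear ?q" "coeffwise Q \<in> frob_linear ?q"
    by (auto intro: level_ops_frob_linear[OF prime])
  note lin = PQ(1) frob_linear_closed(3)[OF PQ(2) frob_linear_mult[of "[:f:]"]]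
  let ?d = "coeffwise P (h ^ (?q - 1)) - coeffwise Q ([:f:] * h ^ (?q - 1))"
  have coeff: "Polynomial.coeff ?d i = (if i < ?q then P i (f ^ (?q - 1 - i)) - Q i (f ^ (?q - i)) else 0)" for i
  proof -
    have "f * f ^ (?q - 1 - i) = f ^ (?q - i)" if "i < ?q"
      using that by (metis Suc_diff_Suc diff_Suc_eq_diff_pred power_Suc)
    then show ?thesis
      using level_family_zero[OF assms(1)] level_family_zero[OF assms(2)]
      by (simp add: coeff_coeffwise_level[OF assms(1)] coeff_coeffwise_level[OF assms(2)] coeff_h_power[unfolded One_nat_def])
  qed
  have loc: "Fract b (h ^ ?q) \<in> loc f" for b by (simp add: loc_localisation Fract_in_localisation)
  have "elt (coeffwise P) = elt (\<lambda>u. coeffwise Q ([:f:] * u)) \<longleftrightarrow>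
      Fract (coeffwise P (h ^ (?q - 1))) (h ^ ?q) - Fract (coeffwise Q ([:f:] * h ^ (?q - 1))) (h ^ ?q) \<in> Rt_in_loc"
    unfolding elt_eq[OF lin(1)] elt_eq[OF lin(2)] by (rule coset_eq_iff[OF loc loc])
  also have "\<dots> \<longleftrightarrow> Fract ?d (h ^ ?q) \<in> Rt_in_loc"
  proof -
    have "Fract b (h ^ ?q) - Fract c (h ^ ?q) = Fract (b - c) (h ^ ?q)" for b c
      by (simp add: eq_fract algebra_simps)
    then show ?thesis by (simp only:)
  qed
  also have "\<dots> \<longleftrightarrow> (\<exists>a. ?d = a * h ^ ?q)"
    unfolding Rt_in_loc_def by (auto simp: eq_fract image_iff)
  also have "\<dots> \<longleftrightarrow> ?d = 0"
  proof
    assume "\<exists>a. ?d = a * h ^ ?q"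
    then obtain a where a: "?d = a * h ^ ?q" by blast
    show "?d = 0"
    proof (rule ccontr)
      assume "?d \<noteq> 0"
      then have "a \<noteq> 0" using a by auto
      then have "Polynomial.degree ?d = Polynomial.degree a + ?q"
        unfolding a by (subst degree_mult_eq) (simp_all add: degree_h_power)
      moreover have "Polynomial.coeff ?d (Polynomial.degree ?d) \<noteq> 0"
        using \<open>?d \<noteq> 0\<close> by (simp only: leading_coeff_neq_0 not_False_eq_True)
      ultimately show False using coeff[of "Polynomial.degree ?d"] by simp
    qed
  qed auto
  also have "\<dots> \<longleftrightarrow> (\<forall>i < ?q. P i (f ^ (?q - 1 - i)) = Q i (f ^ (?q - i)))"
    unfolding poly_eq_iff coeff by auto
  finally show ?thesis .
qed

subsection \<open>The modules \<open>M_f\<close> and \<open>N_f\<close>\<close>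

lemma M_mod_eq: "M_mod p f = elt ` ops"
  by (simp add: M_mod_def D_R_euler_ops elt_def)

lemma M_subset: "M_mod p f \<subseteq> carrier (B_mod f)"
  unfolding M_mod_eq using elt_B ops_frob_ops by auto

lemma act_B_elt: "S \<in> frob_ops \<Longrightarrow> T \<in> frob_ops \<Longrightarrow> act_B f S (elt T) = elt (\<lambda>u. S (T u))"
  unfolding elt_def by (rule act_B_compose(1)[OF _ _ delta_B, symmetric])

lemma elt_add: "S \<in> frob_ops \<Longrightarrow> T \<in> frob_ops \<Longrightarrow> elt (\<lambda>u. S u + T u) = elt S \<otimes>\<^bsub>B_mod f\<^esub> elt T"
  unfolding elt_def by (rule act_B_compose(2)[OF _ _ delta_B])

lemma elt_zero: "elt (\<lambda>u. 0) = \<one>\<^bsub>B_mod f\<^esub>"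
proof -
  interpret B: comm_group "B_mod f" by (rule B_comm_group)
  have z: "(\<lambda>u. 0) \<in> frob_ops" using ops_frob_ops[OF zero_ops] .
  have "elt (\<lambda>u. 0) \<otimes>\<^bsub>B_mod f\<^esub> elt (\<lambda>u. 0) = elt (\<lambda>u. 0)"
    using elt_add[OF z z] by simp
  then show ?thesis using elt_B[OF z] B.l_cancel_one by blast
qed

lemma elt_uminus: "T \<in> ops \<Longrightarrow> inv\<^bsub>B_mod f\<^esub> (elt T) = elt (\<lambda>u. - T u)"
proof -
  interpret B: comm_group "B_mod f" by (rule B_comm_group)
  assume T: "T \<in> ops"
  note n = ops_frob_ops[OF ops_closed(3)[OF T]] and t = ops_frob_ops[OF T]
  show ?thesis
  proof (rule B.inv_equality)
    show "elt (\<lambda>u. - T u) \<otimes>\<^bsub>B_mod f\<^esub> elt T = \<one>\<^bsub>B_mod f\<^esub>"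
      using elt_add[OF n t] elt_zero by simp
  qed (use n t elt_B in auto)
qed

text \<open>
  \<open>t\<close> moves past an operator of \<open>ops\<close> at the cost of shifting its components, and it acts on the
  generator as \<open>f\<close>, because \<open>(f - t) \<sqdot> 1 / (f - t)\<close> is a polynomial.
\<close>

lemma elt_t: "elt ((*) [:0, 1:]) = elt ((*) [:f:])"
proof -
  have lin: "(*) c \<in> frob_linear (p ^ 0)" for c :: "('n, 'k) mpoly poly"
    by (rule frob_linear_mult)
  have loc: "Fract b h \<in> loc f" for b
    using Fract_in_localisation[of b h 1] by (simp add: loc_localisation)
  have "Fract [:0, 1:] h - Fract [:f:] h = Fract (-1) 1"
    by (simp add: eq_fract one_pCons algebra_simps)
  then have "Fract [:0, 1:] h - Fract [:f:] h \<in> Rt_in_loc" by (simp add: Rt_in_loc_def)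
  then show ?thesis
    using coset_eq_iff[OF loc loc, of "[:0, 1:]" "[:f:]"] elt_eq[OF lin[of "[:0, 1:]"]] elt_eq[OF lin[of "[:f:]"]]
    by simp
qed

lemma level_op_commutes_t:
  assumes "level_family q P" "level_family q Q" "\<And>n. P n = Q (Suc n)"
  shows "[:0, 1:] * coeffwise P u = coeffwise Q ([:0, 1:] * u)"
proof (rule poly_eqI)
  fix n
  show "Polynomial.coeff ([:0, 1:] * coeffwise P u) n = Polynomial.coeff (coeffwise Q ([:0, 1:] * u)) n"
    using level_family_zero[OF assms(2)]
    by (cases n) (simp_all add: coeff_coeffwise_level[OF assms(1)] coeff_coeffwise_level[OF assms(2)] assms(3))
qed

lemma shift_ops:
  assumes "T \<in> ops"
  shows "\<exists>S\<in>ops. \<forall>u. [:0, 1:] * T u = S ([:0, 1:] * u)"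
proof -
  obtain e P where T: "T = coeffwise P" and P: "level_family (p ^ e) P"
    using assms by (auto simp: ops_def level_ops_def)
  \<comment> \<open>by periodicity this is the shift of \<open>P\<close> by \<open>- 1\<close>\<close>
  define Q where "Q n = P (n + (p ^ e - 1))" for n
  have Q: "level_family (p ^ e) Q" unfolding Q_def by (rule level_family_closed(4)[OF P P])
  have "P n = Q (Suc n)" for n
  proof -
    have "Suc n + (p ^ e - 1) = n + p ^ e" using p_pos by simp
    then have "Q (Suc n) = P (n + p ^ e)" unfolding Q_def by (simp only:)
    then show ?thesis using P by (simp add: level_family_def periodic_def)
  qed
  from level_op_commutes_t[OF P Q this] show ?thesis
    using Q unfolding T ops_def level_ops_def by blast
qed

lemma unshift_ops:
  assumes "T \<in> ops"
  shows "\<exists>S\<in>ops. \<forall>u. [:0, 1:] * S u = T ([:0, 1:] * u)"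
proof -
  obtain e P where T: "T = coeffwise P" and P: "level_family (p ^ e) P"
    using assms by (auto simp: ops_def level_ops_def)
  have Q: "level_family (p ^ e) (\<lambda>n. P (n + 1))" by (rule level_family_closed(4)[OF P P])
  from level_op_commutes_t[OF Q P] show ?thesis
    using Q unfolding T ops_def level_ops_def by auto
qed

lemma elt_compose_t:
  assumes "S \<in> ops" shows "elt (\<lambda>u. S ([:0, 1:] * u)) = elt (\<lambda>u. S ([:f:] * u))"
  using elt_t act_B_elt[OF ops_frob_ops[OF assms] mult_frob_ops[of "[:0, 1:]"]]
    act_B_elt[OF ops_frob_ops[OF assms] mult_frob_ops[of "[:f:]"]] by simp
text \<open>
  By the two preceding facts \<open>N_f\<close> is the quotient of the cyclic module on the generator by the submodule generated by
  \<open>f\<close> times the generator; in particular the latter is stable under all operators.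
\<close>

lemma tM_mod_eq: "tM_mod p f = (\<lambda>T. elt (\<lambda>u. T ([:f:] * u))) ` ops"
proof (intro equalityI subsetI)
  fix m assume "m \<in> tM_mod p f"
  then obtain T where T: "T \<in> ops" "m = act_B f ((*) [:0, 1:]) (elt T)"
    unfolding tM_mod_def M_mod_eq by blast
  obtain S where S: "S \<in> ops" "\<forall>u. [:0, 1:] * T u = S ([:0, 1:] * u)"
    using shift_ops[OF T(1)] by blast
  have "m = elt (\<lambda>u. S ([:0, 1:] * u))"
    unfolding T(2) act_B_elt[OF mult_frob_ops ops_frob_ops[OF T(1)]] S(2)[rule_format] ..
  then show "m \<in> (\<lambda>T. elt (\<lambda>u. T ([:f:] * u))) ` ops"
    using elt_compose_t[OF S(1)] S(1) by blast
next
  fix m assume "m \<in> (\<lambda>T. elt (\<lambda>u. T ([:f:] * u))) ` ops"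
  then obtain T where T: "T \<in> ops" "m = elt (\<lambda>u. T ([:f:] * u))" by blast
  obtain S where S: "S \<in> ops" "\<forall>u. [:0, 1:] * S u = T ([:0, 1:] * u)"
    using unshift_ops[OF T(1)] by blast
  have "m = act_B f ((*) [:0, 1:]) (elt S)"
    unfolding T(2) elt_compose_t[OF T(1), symmetric] act_B_elt[OF mult_frob_ops ops_frob_ops[OF S(1)]] S(2)[rule_format] ..
  then show "m \<in> tM_mod p f" using S(1) unfolding tM_mod_def M_mod_eq by blast
qed

lemma compose_f_ops: "T \<in> ops \<Longrightarrow> (\<lambda>u. T ([:f:] * u)) \<in> ops"
  by (rule ops_closed(2)[OF _ mult_const_ops])

lemma tM_subset_M: "tM_mod p f \<subseteq> M_mod p f"
  unfolding tM_mod_eq M_mod_eq using compose_f_ops by blast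

lemma act_B_M: "S \<in> ops \<Longrightarrow> m \<in> M_mod p f \<Longrightarrow> act_B f S m \<in> M_mod p f"
  unfolding M_mod_eq by (auto simp: act_B_elt[OF ops_frob_ops ops_frob_ops] intro: imageI[OF ops_closed(2)])

lemma act_B_tM:
  assumes "S \<in> ops" "m \<in> tM_mod p f" shows "act_B f S m \<in> tM_mod p f"
proof -
  obtain T where T: "T \<in> ops" "m = elt (\<lambda>u. T ([:f:] * u))" using assms(2) by (auto simp: tM_mod_eq)
  have "act_B f S m = elt (\<lambda>u. S (T ([:f:] * u)))"
    unfolding T(2) by (rule act_B_elt[OF ops_frob_ops[OF assms(1)] ops_frob_ops[OF compose_f_ops[OF T(1)]]])
  moreover have "(\<lambda>u. S (T u)) \<in> ops" by (rule ops_closed(2)[OF assms(1) T(1)])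
  ultimately show ?thesis unfolding tM_mod_eq by (intro image_eqI[of _ _ "\<lambda>u. S (T u)"])
qed

lemma M_subgroup: "subgroup (M_mod p f) (B_mod f)"
proof -
  interpret B: comm_group "B_mod f" by (rule B_comm_group)
  show ?thesis
  proof (rule B.subgroupI)
    show "inv\<^bsub>B_mod f\<^esub> m \<in> M_mod p f" if "m \<in> M_mod p f" for m
      using that ops_closed(3) by (auto simp: M_mod_eq elt_uminus)
    show "m \<otimes>\<^bsub>B_mod f\<^esub> m' \<in> M_mod p f" if mm: "m \<in> M_mod p f" "m' \<in> M_mod p f" for m m'
    proof -
      obtain S T where *: "S \<in> ops" "m = elt S" "T \<in> ops" "m' = elt T" using mm by (auto simp: M_mod_eq)
      show ?thesis
        unfolding *(2,4) elt_add[OF ops_frob_ops[OF *(1)] ops_frob_ops[OF *(3)], symmetric] M_mod_eq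
        by (rule imageI[OF ops_closed(1)[OF *(1,3)]])
    qed
    show "M_mod p f \<noteq> {}" using id_ops by (auto simp: M_mod_eq)
  qed (rule M_subset)
qed

lemma tM_subgroup_B: "subgroup (tM_mod p f) (B_mod f)"
proof -
  interpret B: comm_group "B_mod f" by (rule B_comm_group)
  show ?thesis
  proof (rule B.subgroupI)
    show "inv\<^bsub>B_mod f\<^esub> m \<in> tM_mod p f" if mm: "m \<in> tM_mod p f" for m
    proof -
      obtain T where T: "T \<in> ops" "m = elt (\<lambda>u. T ([:f:] * u))" using mm by (auto simp: tM_mod_eq)
      have "inv\<^bsub>B_mod f\<^esub> m = elt (\<lambda>u. - T ([:f:] * u))"
        unfolding T(2) by (rule elt_uminus[OF compose_f_ops[OF T(1)]])
      then show ?thesis unfolding tM_mod_eq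
        by (intro image_eqI[of _ _ "\<lambda>u. - T u"] ops_closed(3)[OF T(1)])
    qed
    show "m \<otimes>\<^bsub>B_mod f\<^esub> m' \<in> tM_mod p f" if mm: "m \<in> tM_mod p f" "m' \<in> tM_mod p f" for m m'
    proof -
      obtain S T where *: "S \<in> ops" "m = elt (\<lambda>u. S ([:f:] * u))" "T \<in> ops" "m' = elt (\<lambda>u. T ([:f:] * u))"
        using mm by (auto simp: tM_mod_eq)
      have "m \<otimes>\<^bsub>B_mod f\<^esub> m' = elt (\<lambda>u. S ([:f:] * u) + T ([:f:] * u))"
        unfolding *(2,4) by (rule elt_add[symmetric]; rule ops_frob_ops[OF compose_f_ops]; fact *)
      then show ?thesis unfolding tM_mod_eq
        by (intro image_eqI[of _ _ "\<lambda>u. S u + T u"] ops_closed(1)[OF *(1,3)])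
    qed
    show "tM_mod p f \<noteq> {}" using id_ops by (auto simp: tM_mod_eq)
    show "tM_mod p f \<subseteq> carrier (B_mod f)" using tM_subset_M M_subset by blast
  qed
qed

lemma M_group_comm_group: "comm_group (M_group p f)"
proof -
  interpret B: comm_group "B_mod f" by (rule B_comm_group)
  have "group (M_group p f)"
    unfolding M_group_def by (rule B.subgroup_imp_group[OF M_subgroup])
  then show ?thesis
    by (rule group.group_comm_groupI) (use M_subset B.m_comm in \<open>auto simp: M_group_def\<close>)
qed

lemma tM_subgroup: "subgroup (tM_mod p f) (M_group p f)"
  unfolding M_group_def
  by (rule group.subgroup_incl[OF comm_group.axioms(2)[OF B_comm_group] tM_subgroup_B M_subgroup tM_subset_M])

abbreviation cls :: "('n, 'k) mpoly poly fract set \<Rightarrow> ('n, 'k) mpoly poly fract set set" where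
  "cls m \<equiv> tM_mod p f #>\<^bsub>M_group p f\<^esub> m"

lemma M_group_simps: "carrier (M_group p f) = M_mod p f"
  "monoid.mult (M_group p f) = monoid.mult (B_mod f)" "\<one>\<^bsub>M_group p f\<^esub> = \<one>\<^bsub>B_mod f\<^esub>"
  by (simp_all add: M_group_def)

lemma N_comm_group: "comm_group (N_mod p f)"
  unfolding N_mod_def by (rule comm_group.abelian_FactGroup[OF M_group_comm_group tM_subgroup])

lemma carrier_N: "carrier (N_mod p f) = cls ` M_mod p f"
  by (simp add: N_mod_def carrier_FactGroup M_group_simps)

lemma N_mult:
  "m \<in> M_mod p f \<Longrightarrow> m' \<in> M_mod p f \<Longrightarrow> cls m \<otimes>\<^bsub>N_mod p f\<^esub> cls m' = cls (m \<otimes>\<^bsub>B_mod f\<^esub> m')"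
  using normal.rcos_sum[OF comm_group.normal_iff_subgroup[OF M_group_comm_group, THEN iffD2, OF tM_subgroup], of m m']
  by (simp add: N_mod_def M_group_simps)

lemma N_one: "\<one>\<^bsub>N_mod p f\<^esub> = tM_mod p f"
  by (simp add: N_mod_def)

lemma cls_eq_zero_iff: "m \<in> M_mod p f \<Longrightarrow> cls m = \<one>\<^bsub>N_mod p f\<^esub> \<longleftrightarrow> m \<in> tM_mod p f"
proof -
  interpret comm_group "M_group p f" by (rule M_group_comm_group)
  assume m: "m \<in> M_mod p f"
  have "m \<in> cls m" using rcos_self[OF _ tM_subgroup, of m] m by (simp add: M_group_simps)
  then show ?thesis
    using coset_join2[OF _ tM_subgroup, of m] m by (auto simp: N_one M_group_simps)
qed

lemma act_N_cls:
  assumes "S \<in> ops" "m \<in> M_mod p f"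
  shows "act_N p f S (cls m) = cls (act_B f S m)"
  unfolding act_N_def
proof (rule quot_map_coset)
  show "group (M_group p f)" by (rule comm_group.axioms(2)[OF M_group_comm_group])
  show "act_B f S \<in> hom (M_group p f) (M_group p f)"
    using act_B_M[OF assms(1)] act_B_mult[OF ops_frob_ops[OF assms(1)]] M_subset
    by (auto simp: hom_def M_group_simps)
  show "act_B f S ` tM_mod p f \<subseteq> tM_mod p f" using act_B_tM[OF assms(1)] by blast
  show "m \<in> carrier (M_group p f)" using assms(2) by (simp add: M_group_simps)
qed (rule tM_subgroup)

lemma act_N_undefined: "n \<notin> carrier (N_mod p f) \<Longrightarrow> act_N p f S n = undefined"
  by (simp add: act_N_def quot_map_def N_mod_def)

lemma act_N_closed: "S \<in> ops \<Longrightarrow> n \<in> carrier (N_mod p f) \<Longrightarrow> act_N p f S n \<in> carrier (N_mod p f)"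
  by (auto simp: carrier_N act_N_cls act_B_M)

lemma act_N_add:
  assumes "S \<in> ops" "T \<in> ops" "n \<in> carrier (N_mod p f)"
  shows "act_N p f (\<lambda>u. S u + T u) n = act_N p f S n \<otimes>\<^bsub>N_mod p f\<^esub> act_N p f T n"
proof -
  obtain m where m: "m \<in> M_mod p f" "n = cls m" using assms(3) by (auto simp: carrier_N)
  have "m \<in> carrier (B_mod f)" using m M_subset by blast
  from act_B_compose(2)[OF ops_frob_ops[OF assms(1)] ops_frob_ops[OF assms(2)] this]
  have "act_N p f (\<lambda>u. S u + T u) n = cls (act_B f S m \<otimes>\<^bsub>B_mod f\<^esub> act_B f T m)"
    unfolding m(2) by (simp only: act_N_cls[OF ops_closed(1)[OF assms(1,2)] m(1)])
  then show ?thesis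
    unfolding m(2) act_N_cls[OF assms(1) m(1)] act_N_cls[OF assms(2) m(1)]
    using N_mult[OF act_B_M[OF assms(1) m(1)] act_B_M[OF assms(2) m(1)]] by simp
qed

lemma act_N_compose:
  assumes "S \<in> ops" "T \<in> ops" "n \<in> carrier (N_mod p f)"
  shows "act_N p f (\<lambda>u. S (T u)) n = act_N p f S (act_N p f T n)"
proof -
  obtain m where m: "m \<in> M_mod p f" "n = cls m" using assms(3) by (auto simp: carrier_N)
  have "m \<in> carrier (B_mod f)" using m M_subset by blast
  from act_B_compose(1)[OF ops_frob_ops[OF assms(1)] ops_frob_ops[OF assms(2)] this]
  show ?thesis
    unfolding m(2) act_N_cls[OF assms(2) m(1)] act_N_cls[OF assms(1) act_B_M[OF assms(2) m(1)]]
      act_N_cls[OF ops_closed(2)[OF assms(1,2)] m(1)] by (simp only:)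
qed

lemma act_N_hom:
  assumes "S \<in> ops" "n \<in> carrier (N_mod p f)" "n' \<in> carrier (N_mod p f)"
  shows "act_N p f S (n \<otimes>\<^bsub>N_mod p f\<^esub> n') = act_N p f S n \<otimes>\<^bsub>N_mod p f\<^esub> act_N p f S n'"
proof -
  obtain m m' where m: "m \<in> M_mod p f" "n = cls m" "m' \<in> M_mod p f" "n' = cls m'"
    using assms(2,3) by (auto simp: carrier_N)
  have B: "m \<in> carrier (B_mod f)" "m' \<in> carrier (B_mod f)" using m M_subset by blast+
  have "m \<otimes>\<^bsub>B_mod f\<^esub> m' \<in> M_mod p f" using subgroup.m_closed[OF M_subgroup m(1,3)] .
  then show ?thesis
    unfolding m(2,4) using m(1,3) B assms(1) by (simp add: N_mult act_N_cls act_B_M act_B_mult ops_frob_ops)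
qed

lemma act_N_id:
  assumes "n \<in> carrier (N_mod p f)" shows "act_N p f (\<lambda>u. u) n = n"
proof -
  obtain T where T: "T \<in> ops" "n = cls (elt T)" using assms by (auto simp: carrier_N M_mod_eq)
  then show ?thesis
    using act_B_elt[OF ops_frob_ops[OF id_ops] ops_frob_ops[OF T(1)]] act_N_cls[OF id_ops, of "elt T"]
    by (simp add: M_mod_eq)
qed

subsection \<open>The action of the binomial functions\<close>
text \<open>
  The value at \<open>- 1 - n\<close> of the continuous extension of \<open>\<phi>\<close> to the \<open>p\<close>-adic integers. The
  argument \<open>(n + 1) * (p ^ e - 1)\<close> is a natural number congruent to \<open>- 1 - n\<close> modulo \<open>p ^ e\<close>.
\<close>

definition at_neg :: "(nat \<Rightarrow> 'k) \<Rightarrow> nat \<Rightarrow> 'k" where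
  "at_neg \<phi> n = \<phi> ((n + 1) * (p ^ (SOME e. periodic (p ^ e) \<phi>) - 1))"

lemma at_neg_eq:
  assumes "periodic (p ^ e) \<phi>" "p ^ e dvd l + n + 1"
  shows "at_neg \<phi> n = \<phi> l"
proof -
  define E where "E = (SOME e. periodic (p ^ e) \<phi>)"
  have E: "periodic (p ^ E) \<phi>" unfolding E_def using assms(1) by (rule someI)
  let ?m = "min e E"
  have m: "periodic (p ^ ?m) \<phi>" using assms(1) E by (simp add: min_def)
  have "(n + 1) * (p ^ E - 1) + n + 1 = (n + 1) * p ^ E"
    using p_pos by (cases "p ^ E") (auto simp: algebra_simps)
  then have "p ^ ?m dvd (n + 1) * (p ^ E - 1) + (n + 1)"
    by (simp add: le_imp_power_dvd dvd_mult)
  moreover have "p ^ ?m dvd l + (n + 1)"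
    using assms(2) dvd_trans[OF le_imp_power_dvd[of ?m e p]] by (simp add: add.assoc)
  ultimately have "[(n + 1) * (p ^ E - 1) + (n + 1) = l + (n + 1)] (mod p ^ ?m)"
    by (simp add: Cong.cong_def dvd_eq_mod_eq_0)
  then have "(n + 1) * (p ^ E - 1) mod p ^ ?m = l mod p ^ ?m"
    using cong_add_rcancel_nat unfolding Cong.cong_def by metis
  then show ?thesis unfolding at_neg_def E_def[symmetric] by (rule periodic_cong[OF m])
qed

lemma at_neg_periodic:
  assumes "periodic (p ^ e) \<phi>" shows "periodic (p ^ e) (at_neg \<phi>)"
  unfolding periodic_def
proof
  fix n
  let ?l = "(n + 1) * (p ^ e - 1)"
  have "?l + n + 1 = (n + 1) * p ^ e"
    using p_pos by (cases "p ^ e") (auto simp: algebra_simps)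
  then have d: "p ^ e dvd ?l + n + 1" by simp
  then have "p ^ e dvd (?l + n + 1) + p ^ e" by (simp only: dvd_add_triv_right_iff)
  then have "p ^ e dvd ?l + (n + p ^ e) + 1" by (simp only: add_ac)
  then show "at_neg \<phi> (n + p ^ e) = at_neg \<phi> n"
    using at_neg_eq[OF assms d] at_neg_eq[OF assms, of ?l "n + p ^ e"] by simp
qed

text \<open>
  The function \<open>\<phi>\<close> acts through its value at \<open>- 1 - n\<close> on the part of \<open>t\<close>-degree \<open>n\<close>, because
  the Euler operator of index \<open>e\<close> multiplies \<open>t ^ n\<close> by the \<open>e\<close>-th digit of \<open>n\<close> plus one.
\<close>

definition gamma_op :: "(nat \<Rightarrow> 'k) \<Rightarrow> ('n, 'k) mpoly poly \<Rightarrow> ('n, 'k) mpoly poly" where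
  "gamma_op \<phi> = diag (at_neg \<phi>)"

lemma prime_CHAR: "Factorial_Ring.prime CHAR('k)"
  using prime_p CHAR_p by simp

lemma A_periodic: "\<phi> \<in> carrier A_ring \<longleftrightarrow> (\<exists>e. periodic (p ^ e) (\<phi> :: nat \<Rightarrow> 'k))"
  using carrier_A_ring[OF prime_CHAR] CHAR_p by simp

lemma periodic_common:
  assumes "\<phi> \<in> carrier A_ring" "\<psi> \<in> carrier A_ring"
  obtains e where "periodic (p ^ e) (\<phi> :: nat \<Rightarrow> 'k)" "periodic (p ^ e) (\<psi> :: nat \<Rightarrow> 'k)"
proof -
  obtain e e' where e: "periodic (p ^ e) \<phi>" "periodic (p ^ e') \<psi>" using assms by (auto simp: A_periodic)
  show ?thesis by (rule that[OF periodic_dvd[OF e(1) p_dvd_max(1)] periodic_dvd[OF e(2) p_dvd_max(2)]])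
qed

lemma gamma_op_level: "periodic (p ^ e) \<phi> \<Longrightarrow> gamma_op \<phi> \<in> level_ops (p ^ e)"
  unfolding gamma_op_def by (rule diag_level[OF at_neg_periodic])

lemma gamma_op_ops: "\<phi> \<in> carrier A_ring \<Longrightarrow> gamma_op \<phi> \<in> ops"
  by (auto simp: A_periodic intro: opsI gamma_op_level)

lemma at_neg_add_mult:
  assumes "\<phi> \<in> carrier A_ring" "\<psi> \<in> carrier A_ring"
  shows "at_neg (\<lambda>l. \<phi> l + \<psi> l) n = at_neg \<phi> n + at_neg \<psi> n"
    "at_neg (\<lambda>l. \<phi> l * \<psi> l) n = at_neg \<phi> n * at_neg \<psi> n"
proof -
  obtain e where e: "periodic (p ^ e) \<phi>" "periodic (p ^ e) \<psi>" by (rule periodic_common[OF assms])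
  let ?l = "(n + 1) * (p ^ e - 1)"
  have "?l + n + 1 = (n + 1) * p ^ e"
    using p_pos by (cases "p ^ e") (auto simp: algebra_simps)
  then have d: "p ^ e dvd ?l + n + 1" by simp
  have "periodic (p ^ e) (\<lambda>l. \<phi> l + \<psi> l)" "periodic (p ^ e) (\<lambda>l. \<phi> l * \<psi> l)"
    using e by (simp_all add: periodic_def)
  then show "at_neg (\<lambda>l. \<phi> l + \<psi> l) n = at_neg \<phi> n + at_neg \<psi> n"
    "at_neg (\<lambda>l. \<phi> l * \<psi> l) n = at_neg \<phi> n * at_neg \<psi> n"
    by (simp_all only: at_neg_eq[OF _ d] e)
qed

lemma gamma_op_add_mult:
  assumes "\<phi> \<in> carrier A_ring" "\<psi> \<in> carrier A_ring"
  shows "gamma_op (\<lambda>l. \<phi> l + \<psi> l) = (\<lambda>u. gamma_op \<phi> u + gamma_op \<psi> u)"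
    "gamma_op (\<lambda>l. \<phi> l * \<psi> l) = (\<lambda>u. gamma_op \<phi> (gamma_op \<psi> u))"
  by (auto intro!: ext poly_eqI simp: gamma_op_def coeff_diag at_neg_add_mult[OF assms] mconst_simps algebra_simps)

lemma gamma_op_const: "gamma_op (\<lambda>l. c) = (\<lambda>u. [:mconst c:] * u)"
  by (auto intro!: ext poly_eqI simp: gamma_op_def coeff_diag at_neg_def)

lemma gamma_op_binom: "gamma_op (binom_fun (p ^ e)) = (\<lambda>u. - euler_op p e u)"
proof (intro ext poly_eqI)
  fix u n
  let ?q = "p ^ e"
  \<comment> \<open>a natural number congruent to \<open>- 1 - n\<close> modulo \<open>p ^ (e + 1)\<close>\<close>
  define l where "l = p ^ Suc e * (n + 1) - 1 - n"
  have "1 \<le> p ^ Suc e" using p_pos by (intro one_le_power) simp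
  then have "n + 1 \<le> p ^ Suc e * (n + 1)" using mult_right_mono[of 1 "p ^ Suc e" "n + 1"] by simp
  then have l: "l + n + 1 = p ^ Suc e * (n + 1)" unfolding l_def by linarith
  have "?q < p ^ Suc e"
    using prime_p by (intro power_strict_increasing) (simp_all add: prime_gt_Suc_0_nat)
  then have per: "periodic (p ^ Suc e) (binom_fun ?q :: nat \<Rightarrow> 'k)"
    using choose_add_CHAR_power[OF prime_CHAR, of "p ^ Suc e" "Suc e" _ ?q] CHAR_p
    by (simp add: periodic_def binom_fun_def del: power_Suc)
  have "at_neg (binom_fun ?q) n = (binom_fun ?q l :: 'k)"
    by (rule at_neg_eq[OF per]) (simp only: l dvd_triv_left)
  also have "\<dots> = of_nat (l div ?q)"
    using choose_CHAR_power[OF prime_CHAR, of ?q e l] CHAR_p by (simp add: binom_fun_def)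
  also have "\<dots> = - of_nat ((n + ?q) div ?q)"
  proof -
    have q: "?q > 0" using p_pos by simp
    define a b where "a = n div ?q" and "b = n mod ?q"
    have n: "n = ?q * a + b" "b < ?q" using q by (simp_all add: a_def b_def)
    have "a < p * (n + 1)"
    proof -
      have "a \<le> n" by (simp add: a_def)
      also have "n < 1 * (n + 1)" by simp
      also have "\<dots> \<le> p * (n + 1)" using p_pos by (intro mult_right_mono) simp_all
      finally show ?thesis .
    qed
    then obtain c where "p * (n + 1) = Suc (a + c)" by (rule less_natE)
    then have c: "p * (n + 1) = a + c + 1" by (simp only: Suc_eq_plus1)
    have "l + n + 1 = ?q * (p * (n + 1))" unfolding l by (simp only: power_Suc2 mult.assoc)
    then have "l + ?q * a + b + 1 = ?q * (a + c + 1)"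
      unfolding c using n(1) by linarith
    then have "l + (b + 1) = ?q * c + ?q" by (simp add: algebra_simps)
    then have "l = c * ?q + (?q - 1 - b)" using n(2) by (simp add: algebra_simps)
    moreover have "?q - 1 - b < ?q" using q by simp
    moreover have "(c * d + r) div d = c" if "r < d" for d r using that by simp
    ultimately have "l div ?q = c" by (simp only:)
    moreover have "(n + ?q) div ?q = a + 1" using q by (simp add: a_def)
    moreover have "(of_nat (a + c + 1) :: 'k) = 0"
      unfolding c[symmetric] by (simp add: of_nat_CHAR[where ?'a = 'k, unfolded CHAR_p])
    moreover have "c + (a + 1) = a + c + 1" by simp
    ultimately show ?thesis
      by (simp only: eq_neg_iff_add_eq_0 of_nat_add[symmetric])
  qed
  also have "(of_nat ((n + ?q) div ?q) :: 'k) = of_nat ((n + ?q) choose ?q)"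
    using choose_CHAR_power[OF prime_CHAR, of ?q e "n + ?q"] CHAR_p by simp
  finally show "Polynomial.coeff (gamma_op (binom_fun ?q) u) n = Polynomial.coeff (- euler_op p e u) n"
    by (simp add: gamma_op_def coeff_diag euler_op_coeffwise coeff_coeffwise mconst_simps)
qed

definition gamma_action ::
    "(nat \<Rightarrow> 'k) \<Rightarrow> ('n, 'k) mpoly poly fract set set \<Rightarrow> ('n, 'k) mpoly poly fract set set" where
  "gamma_action = (\<lambda>\<phi>\<in>carrier A_ring. act_N p f (gamma_op \<phi>))"

lemma gamma_action_module: "module A_ring (N_with_smult p f gamma_action)"
proof (rule moduleI)
  interpret A: cring "A_ring :: (nat \<Rightarrow> 'k) ring" by (rule cring_A_ring)
  interpret N: comm_group "N_mod p f" by (rule N_comm_group)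
  show "cring (A_ring :: (nat \<Rightarrow> 'k) ring)" by (rule cring_A_ring)
  show "abelian_group (N_with_smult p f gamma_action)"
  proof (rule abelian_groupI)
    fix n assume "n \<in> carrier (N_with_smult p f gamma_action)"
    then show "\<exists>m\<in>carrier (N_with_smult p f gamma_action). m \<oplus>\<^bsub>N_with_smult p f gamma_action\<^esub> n = \<zero>\<^bsub>N_with_smult p f gamma_action\<^esub>"
      using N.l_inv_ex by (simp add: N_with_smult_def)
  qed (auto simp: N_with_smult_def N.m_ac)
  fix \<phi> \<psi> :: "nat \<Rightarrow> 'k" and n n'
  assume phi: "\<phi> \<in> carrier A_ring"
  show "\<phi> \<odot>\<^bsub>N_with_smult p f gamma_action\<^esub> n \<in> carrier (N_with_smult p f gamma_action)"
    if "n \<in> carrier (N_with_smult p f gamma_action)"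
    using that phi by (simp add: N_with_smult_def gamma_action_def act_N_closed gamma_op_ops)
  show "\<phi> \<odot>\<^bsub>N_with_smult p f gamma_action\<^esub> (n \<oplus>\<^bsub>N_with_smult p f gamma_action\<^esub> n') =
      \<phi> \<odot>\<^bsub>N_with_smult p f gamma_action\<^esub> n \<oplus>\<^bsub>N_with_smult p f gamma_action\<^esub> \<phi> \<odot>\<^bsub>N_with_smult p f gamma_action\<^esub> n'"
    if "n \<in> carrier (N_with_smult p f gamma_action)" "n' \<in> carrier (N_with_smult p f gamma_action)"
    using that phi by (simp add: N_with_smult_def gamma_action_def act_N_hom gamma_op_ops)
  assume psi: "\<psi> \<in> carrier A_ring"
  show "(\<phi> \<oplus>\<^bsub>A_ring\<^esub> \<psi>) \<odot>\<^bsub>N_with_smult p f gamma_action\<^esub> n =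
      \<phi> \<odot>\<^bsub>N_with_smult p f gamma_action\<^esub> n \<oplus>\<^bsub>N_with_smult p f gamma_action\<^esub> \<psi> \<odot>\<^bsub>N_with_smult p f gamma_action\<^esub> n"
    if "n \<in> carrier (N_with_smult p f gamma_action)"
    using that phi psi A.add.m_closed[OF phi psi]
    by (simp add: N_with_smult_def gamma_action_def A_ring_simps gamma_op_add_mult
        act_N_add[OF gamma_op_ops[OF phi] gamma_op_ops[OF psi]] gamma_op_ops)
  show "(\<phi> \<otimes>\<^bsub>A_ring\<^esub> \<psi>) \<odot>\<^bsub>N_with_smult p f gamma_action\<^esub> n =
      \<phi> \<odot>\<^bsub>N_with_smult p f gamma_action\<^esub> (\<psi> \<odot>\<^bsub>N_with_smult p f gamma_action\<^esub> n)"
    if "n \<in> carrier (N_with_smult p f gamma_action)"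
    using that phi psi A.m_closed[OF phi psi]
    by (simp add: N_with_smult_def gamma_action_def A_ring_simps gamma_op_add_mult
        act_N_compose[OF gamma_op_ops[OF phi] gamma_op_ops[OF psi]] act_N_closed gamma_op_ops)
next
  interpret A: cring "A_ring :: (nat \<Rightarrow> 'k) ring" by (rule cring_A_ring)
  fix n assume n: "n \<in> carrier (N_with_smult p f gamma_action)"
  have "gamma_op (\<lambda>l. 1) = (\<lambda>u. u)" by (simp add: gamma_op_const mconst_simps)
  then show "\<one>\<^bsub>A_ring\<^esub> \<odot>\<^bsub>N_with_smult p f gamma_action\<^esub> n = n"
    using n A.one_closed by (simp add: N_with_smult_def gamma_action_def A_ring_simps act_N_id)
qed

lemma const_A: "(\<lambda>l. c :: 'k) \<in> carrier A_ring"
  by (auto simp: A_ring_def intro: generate_ring.incl)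

lemma binom_A: "(binom_fun n :: nat \<Rightarrow> 'k) \<in> carrier A_ring"
  by (auto simp: A_ring_def intro: generate_ring.incl)
text \<open>
  The operators \<open>gamma_op \<phi>\<close> define a module structure, and there is no other since constants and
  the functions \<open>binom_fun (p ^ e)\<close> generate \<open>A_ring\<close>.
\<close>

lemma gamma_smult_eq: "gamma_smult p f = gamma_action"
  unfolding gamma_smult_def
proof (rule the_equality)
  have "gamma_action \<in> carrier A_ring \<rightarrow>\<^sub>E (carrier (N_mod p f) \<rightarrow>\<^sub>E carrier (N_mod p f))"
    by (auto simp: gamma_action_def act_N_closed gamma_op_ops act_N_undefined)
  then show "gamma_action \<in> carrier A_ring \<rightarrow>\<^sub>E (carrier (N_mod p f) \<rightarrow>\<^sub>E carrier (N_mod p f)) \<and>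
     module A_ring (N_with_smult p f gamma_action) \<and>
     (\<forall>c. gamma_action (\<lambda>l. c) = act_N p f (\<lambda>q. [:mconst c:] * q)) \<and>
     (\<forall>e. gamma_action (binom_fun (p ^ e)) = act_N p f (\<lambda>q. - euler_op p e q))"
    using gamma_action_module by (simp add: gamma_action_def const_A binom_A gamma_op_const gamma_op_binom)
next
  fix \<rho> :: "(nat \<Rightarrow> 'k) \<Rightarrow> ('n, 'k) mpoly poly fract set set \<Rightarrow> ('n, 'k) mpoly poly fract set set"
  assume rho: "\<rho> \<in> carrier A_ring \<rightarrow>\<^sub>E (carrier (N_mod p f) \<rightarrow>\<^sub>E carrier (N_mod p f)) \<and>
     module A_ring (N_with_smult p f \<rho>) \<and>
     (\<forall>c. \<rho> (\<lambda>l. c) = act_N p f (\<lambda>q. [:mconst c:] * q)) \<and>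
     (\<forall>e. \<rho> (binom_fun (p ^ e)) = act_N p f (\<lambda>q. - euler_op p e q))"
  interpret R: module A_ring "N_with_smult p f \<rho>" using rho by blast
  interpret G: module A_ring "N_with_smult p f gamma_action" by (rule gamma_action_module)
  have N: "carrier (N_with_smult p f \<rho>) = carrier (N_mod p f)" for \<rho> by (simp add: N_with_smult_def)
  let ?C = "{\<phi> \<in> carrier A_ring. \<forall>n\<in>carrier (N_mod p f). \<rho> \<phi> n = gamma_action \<phi> n}"
  have "\<phi> \<in> ?C" if "\<phi> \<in> carrier A_ring" for \<phi>
  proof (rule A_ring_induct[OF prime_CHAR that])
    show "(\<lambda>l. c) \<in> ?C" for c using rho by (simp add: const_A gamma_action_def gamma_op_const)
    show "binom_fun (CHAR('k) ^ e) \<in> ?C" for e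
      using rho by (simp add: binom_A gamma_action_def gamma_op_binom CHAR_p)
    fix \<phi> \<psi> assume "\<phi> \<in> ?C" "\<psi> \<in> ?C"
    then have *: "\<phi> \<in> carrier A_ring" "\<psi> \<in> carrier A_ring"
      "\<And>n. n \<in> carrier (N_mod p f) \<Longrightarrow> \<rho> \<phi> n = gamma_action \<phi> n"
      "\<And>n. n \<in> carrier (N_mod p f) \<Longrightarrow> \<rho> \<psi> n = gamma_action \<psi> n" by auto
    show "(\<lambda>l. \<phi> l + \<psi> l) \<in> ?C"
      using R.R.add.m_closed[OF *(1,2)] R.smult_l_distr[OF *(1,2)] G.smult_l_distr[OF *(1,2)] *(3,4)
      by (simp add: A_ring_simps N) (simp add: N_with_smult_def)
    show "(\<lambda>l. \<phi> l * \<psi> l) \<in> ?C"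
      using R.R.m_closed[OF *(1,2)] R.smult_assoc1[OF *(1,2)] G.smult_assoc1[OF *(1,2)]
        G.smult_closed[OF *(2)] *(3,4)
      by (simp add: A_ring_simps N) (simp add: N_with_smult_def)
  qed
  moreover have "\<rho> \<phi> n = gamma_action \<phi> n" if "\<phi> \<in> carrier A_ring" "n \<notin> carrier (N_mod p f)" for \<phi> n
  proof -
    have "\<rho> \<phi> \<in> carrier (N_mod p f) \<rightarrow>\<^sub>E carrier (N_mod p f)" using rho that(1) by (auto simp: PiE_iff)
    then show ?thesis using that by (auto simp: gamma_action_def act_N_undefined)
  qed
  moreover have "\<rho> \<phi> = gamma_action \<phi>" if "\<phi> \<notin> carrier A_ring" for \<phi>
    using rho that by (auto simp: gamma_action_def)
  ultimately have "\<rho> \<phi> n = gamma_action \<phi> n" for \<phi> n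
    by (cases "\<phi> \<in> carrier A_ring"; cases "n \<in> carrier (N_mod p f)") auto
  then show "\<rho> = gamma_action" by (intro ext)
qed

lemma b_function_annihilates:
  "\<phi> \<in> b_function p f \<longleftrightarrow>
     \<phi> \<in> carrier A_ring \<and> (\<forall>T\<in>ops. \<exists>S\<in>ops. elt (\<lambda>u. gamma_op \<phi> (T u)) = elt (\<lambda>u. S ([:f:] * u)))"
proof -
  have "gamma_action \<phi> (cls (elt T)) = \<one>\<^bsub>N_mod p f\<^esub> \<longleftrightarrow>
      (\<exists>S\<in>ops. elt (\<lambda>u. gamma_op \<phi> (T u)) = elt (\<lambda>u. S ([:f:] * u)))"
    if phi: "\<phi> \<in> carrier A_ring" and T: "T \<in> ops" for T
  proof -
    have eq: "gamma_action \<phi> (cls (elt T)) = cls (elt (\<lambda>u. gamma_op \<phi> (T u)))"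
      using act_N_cls[OF gamma_op_ops[OF phi], of "elt T"] T phi
        act_B_elt[OF ops_frob_ops[OF gamma_op_ops[OF phi]] ops_frob_ops[OF T]]
      by (simp add: gamma_action_def M_mod_eq)
    have "elt (\<lambda>u. gamma_op \<phi> (T u)) \<in> M_mod p f"
      unfolding M_mod_eq by (rule imageI[OF ops_closed(2)[OF gamma_op_ops[OF phi] T]])
    moreover have "elt (\<lambda>u. gamma_op \<phi> (T u)) \<in> tM_mod p f \<longleftrightarrow>
        (\<exists>S\<in>ops. elt (\<lambda>u. gamma_op \<phi> (T u)) = elt (\<lambda>u. S ([:f:] * u)))"
      unfolding tM_mod_eq by (rule image_iff)
    ultimately show ?thesis unfolding eq by (simp only: cls_eq_zero_iff)
  qed
  then show ?thesis
    by (auto simp: b_function_def N_gamma_def gamma_smult_eq N_with_smult_def carrier_N M_mod_eq)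
qed

text \<open>
  Comparing the coefficients of \<open>t ^ (p ^ e - 1 - a)\<close> turns membership in the \<open>b\<close>-function into a
  condition on the powers \<open>f ^ a\<close> and \<open>f ^ (a + 1)\<close> alone.
\<close>

theorem b_function_iff:
  "\<phi> \<in> b_function p f \<longleftrightarrow>
     (\<exists>e. periodic (p ^ e) \<phi> \<and> (\<forall>a < p ^ e. \<phi> a = 0 \<or> (\<exists>Q\<in>frob_linear (p ^ e). Q (f ^ Suc a) = f ^ a)))"
    (is "_ \<longleftrightarrow> (\<exists>e. ?R e)")
proof
  assume "\<phi> \<in> b_function p f"
  then obtain S where phi: "\<phi> \<in> carrier A_ring" and S: "S \<in> ops"
    and eq: "elt (gamma_op \<phi>) = elt (\<lambda>u. S ([:f:] * u))"
    using id_ops unfolding b_function_annihilates by fastforce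
  obtain e0 where e0: "periodic (p ^ e0) \<phi>" using phi by (auto simp: A_periodic)
  obtain e1 Q where Q: "S = coeffwise Q" "level_family (p ^ e1) Q" using S by (auto simp: ops_def level_ops_def)
  define e where "e = max e0 e1"
  have per: "periodic (p ^ e) \<phi>" unfolding e_def by (rule periodic_dvd[OF e0 p_dvd_max(1)])
  have lQ: "level_family (p ^ e) Q" unfolding e_def by (rule level_family_dvd[OF Q(2) p_dvd_max(2)])
  have lG: "level_family (p ^ e) (\<lambda>n. (*) (mconst (at_neg \<phi> n)))"
    using at_neg_periodic[OF per] by (auto simp: level_family_def frob_linear_mult periodic_def)
  have comp: "mconst (at_neg \<phi> i) * f ^ (p ^ e - 1 - i) = Q i (f ^ (p ^ e - i))" if "i < p ^ e" for i
    using eq elt_eq_iff[OF lG lQ] that by (simp add: gamma_op_def diag_def Q(1))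
  have "\<phi> a = 0 \<or> (\<exists>Q\<in>frob_linear (p ^ e). Q (f ^ Suc a) = f ^ a)" if a: "a < p ^ e" for a
  proof (cases "\<phi> a = 0")
    case False
    let ?i = "p ^ e - 1 - a"
    have i: "?i < p ^ e" "p ^ e - 1 - ?i = a" "p ^ e - ?i = Suc a" "a + ?i + 1 = p ^ e" using a by auto
    have "at_neg \<phi> ?i = \<phi> a" by (rule at_neg_eq[OF per]) (simp only: i dvd_refl)
    then have *: "mconst (\<phi> a) * f ^ a = Q ?i (f ^ Suc a)" using comp[OF i(1)] by (simp only: i)
    have "mconst (inverse (\<phi> a)) * Q ?i (f ^ Suc a) = f ^ a"
      unfolding *[symmetric] mult.assoc[symmetric] mconst_simps(4)[symmetric] using False by (simp add: mconst_simps)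
    moreover have "(\<lambda>x. mconst (inverse (\<phi> a)) * Q ?i x) \<in> frob_linear (p ^ e)"
      using lQ by (intro frob_linear_closed(4)) (simp add: level_family_def)
    ultimately show ?thesis by (intro disjI2 bexI[of _ "\<lambda>x. mconst (inverse (\<phi> a)) * Q ?i x"])
  qed simp
  then show "\<exists>e. ?R e" using per by blast
next
  assume "\<exists>e. ?R e"
  then obtain e where per: "periodic (p ^ e) \<phi>"
    and R: "\<And>a. a < p ^ e \<Longrightarrow> \<phi> a = 0 \<or> (\<exists>Q\<in>frob_linear (p ^ e). Q (f ^ Suc a) = f ^ a)" by blast
  have phi: "\<phi> \<in> carrier A_ring" using per by (auto simp: A_periodic)
  show "\<phi> \<in> b_function p f"
    unfolding b_function_annihilates
  proof (intro conjI phi ballI)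
    fix T assume "T \<in> ops"
    then obtain e1 P where P: "T = coeffwise P" "level_family (p ^ e1) P" by (auto simp: ops_def level_ops_def)
    define E where "E = max e e1"
    have perE: "periodic (p ^ E) \<phi>" unfolding E_def by (rule periodic_dvd[OF per p_dvd_max(1)])
    have lP: "level_family (p ^ E) P" unfolding E_def by (rule level_family_dvd[OF P(2) p_dvd_max(2)])
    have lG: "level_family (p ^ E) (\<lambda>n. (*) (mconst (at_neg \<phi> n)))"
      using at_neg_periodic[OF perE] by (auto simp: level_family_def frob_linear_mult periodic_def)
    have ex: "\<exists>Q\<in>frob_linear (p ^ E). Q (f ^ Suc a) = mconst (\<phi> a) * P i (f ^ a)" for i a
    proof (cases "\<phi> a = 0")
      case True
      have "(\<lambda>x. 0) \<in> frob_linear (p ^ E)" by (simp add: frob_linear_def)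
      then show ?thesis using True by (intro bexI[of _ "\<lambda>x. 0"]) (simp_all add: mconst_simps)
    next
      case False
      let ?a = "a mod p ^ e" and ?m = "a div p ^ e"
      have a: "a = ?m * p ^ e + ?a" by (rule div_mult_mod_eq[symmetric])
      have "?a < p ^ e" using p_pos by simp
      moreover have "\<phi> ?a \<noteq> 0" using False periodic_mod[OF per] by simp
      ultimately obtain Q where Q: "Q \<in> frob_linear (p ^ e)" "Q (f ^ Suc ?a) = f ^ ?a" using R by blast
      have "f ^ Suc a = (f ^ ?m) ^ (p ^ e) * f ^ Suc ?a"
        by (subst a) (simp only: power_add power_mult power_Suc mult.left_commute)
      then have "Q (f ^ Suc a) = (f ^ ?m) ^ (p ^ e) * f ^ ?a"
        using Q by (simp only: frob_linear_def mem_Collect_eq)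
      also have "\<dots> = f ^ a" by (simp only: power_mult[symmetric] power_add[symmetric] div_mult_mod_eq)
      finally have Qa: "Q (f ^ Suc a) = f ^ a" .
      have QE: "Q \<in> frob_linear (p ^ E)" unfolding E_def by (rule frob_linear_dvd[OF Q(1) p_dvd_max(1)])
      have "P i \<in> frob_linear (p ^ E)" using lP by (simp add: level_family_def)
      from frob_linear_closed(4)[OF frob_linear_closed(3)[OF this QE]]
      have "(\<lambda>x. mconst (\<phi> a) * P i (Q x)) \<in> frob_linear (p ^ E)" .
      then show ?thesis using Qa by (intro bexI[of _ "\<lambda>x. mconst (\<phi> a) * P i (Q x)"]) simp_all
    qed
    define Q where "Q i a = (SOME Q. Q \<in> frob_linear (p ^ E) \<and> Q (f ^ Suc a) = mconst (\<phi> a) * P i (f ^ a))"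
      for i a
    have "Q i a \<in> frob_linear (p ^ E) \<and> Q i a (f ^ Suc a) = mconst (\<phi> a) * P i (f ^ a)" for i a
    proof -
      have "\<exists>Q. Q \<in> frob_linear (p ^ E) \<and> Q (f ^ Suc a) = mconst (\<phi> a) * P i (f ^ a)"
        using ex[of a i] by blast
      then show ?thesis unfolding Q_def by (rule someI_ex)
    qed
    then have Q: "Q i a \<in> frob_linear (p ^ E)" "Q i a (f ^ Suc a) = mconst (\<phi> a) * P i (f ^ a)" for i a
      by simp_all
    define Q' where "Q' n = Q (n mod p ^ E) (p ^ E - 1 - n mod p ^ E)" for n
    have lQ: "level_family (p ^ E) Q'" by (simp add: level_family_def periodic_def Q'_def Q(1))
    have "mconst (at_neg \<phi> i) * P i (f ^ (p ^ E - 1 - i)) = Q' i (f ^ (p ^ E - i))" if i: "i < p ^ E" for i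
    proof -
      let ?a = "p ^ E - 1 - i"
      have a: "p ^ E - i = Suc ?a" "?a + i + 1 = p ^ E" using i by auto
      have "at_neg \<phi> i = \<phi> ?a" by (rule at_neg_eq[OF perE]) (simp only: a dvd_refl)
      then show ?thesis unfolding a(1) using i Q(2) by (simp add: Q'_def)
    qed
    then have "elt (coeffwise (\<lambda>n x. mconst (at_neg \<phi> n) * P n x)) = elt (\<lambda>u. coeffwise Q' ([:f:] * u))"
      using elt_eq_iff[OF level_family_closed(2)[OF lG lP] lQ] by blast
    moreover have "(\<lambda>u. gamma_op \<phi> (T u)) = coeffwise (\<lambda>n x. mconst (at_neg \<phi> n) * P n x)"
      unfolding gamma_op_def diag_def P(1) by (rule coeffwise_closed(2)[OF lG lP])
    ultimately have "elt (\<lambda>u. gamma_op \<phi> (T u)) = elt (\<lambda>u. coeffwise Q' ([:f:] * u))" by simp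
    moreover have "coeffwise Q' \<in> ops" using lQ by (auto simp: ops_def level_ops_def)
    ultimately show "\<exists>S\<in>ops. elt (\<lambda>u. gamma_op \<phi> (T u)) = elt (\<lambda>u. S ([:f:] * u))" by blast
  qed
qed

end

section \<open>Cartier maps and Frobenius roots of principal ideals\<close>
text \<open>
  For \<open>q = p ^ e\<close> these are the \<open>p\<^sup>-\<^sup>e\<close>-linear endomorphisms, of which the trace map of the Frobenius
  is the standard example.
\<close>

definition cartier :: "nat \<Rightarrow> ('a::comm_ring_1 \<Rightarrow> 'a) set" where
  "cartier q = {\<theta>. (\<forall>x y. \<theta> (x + y) = \<theta> x + \<theta> y) \<and> (\<forall>a x. \<theta> (a ^ q * x) = a * \<theta> x)}"

definition cartier_ideal :: "nat \<Rightarrow> 'a::comm_ring_1 \<Rightarrow> 'a set" where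
  "cartier_ideal q u = {\<theta> u | \<theta>. \<theta> \<in> cartier q}"

lemma cartierD:
  "\<theta> \<in> cartier q \<Longrightarrow> \<theta> (x + y) = \<theta> x + \<theta> y"
  "\<theta> \<in> cartier q \<Longrightarrow> \<theta> (a ^ q * x) = a * \<theta> x"
  by (simp_all add: cartier_def)

lemma cartier_zero: "\<theta> \<in> cartier q \<Longrightarrow> \<theta> 0 = 0"
  using cartierD(1)[of \<theta> q 0 0] by simp

lemma cartier_closed:
  "\<theta> \<in> cartier q \<Longrightarrow> (\<lambda>x. \<theta> (r * x)) \<in> cartier q"
  "\<theta> \<in> cartier q \<Longrightarrow> \<theta>' \<in> cartier q \<Longrightarrow> (\<lambda>x. \<theta> x + \<theta>' x) \<in> cartier q"
  "\<theta> \<in> cartier q \<Longrightarrow> (\<lambda>x. r * \<theta> x) \<in> cartier q"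
  "\<theta> \<in> cartier q \<Longrightarrow> P \<in> frob_linear q \<Longrightarrow> (\<lambda>x. \<theta> (P x)) \<in> cartier q"
  "\<theta> \<in> cartier q \<Longrightarrow> \<kappa> \<in> cartier q' \<Longrightarrow> (\<lambda>x. \<theta> (\<kappa> x)) \<in> cartier (q * q')"
  "(\<lambda>x. 0) \<in> cartier q"
proof -
  assume \<theta>: "\<theta> \<in> cartier q"
  have "\<theta> (r * (a ^ q * x)) = a * \<theta> (r * x)" for a x
    using cartierD(2)[OF \<theta>, of a "r * x"] by (simp only: mult.left_commute)
  then show "(\<lambda>x. \<theta> (r * x)) \<in> cartier q"
    using cartierD(1)[OF \<theta>] by (simp add: cartier_def distrib_left)
qed (simp_all add: cartier_def frob_linear_def distrib_left mult.left_commute power_mult)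

lemma ideal_of_type_iff:
  "ideal I (ring_of_type_algebra :: 'a::comm_ring_1 ring) \<longleftrightarrow>
     0 \<in> I \<and> (\<forall>x\<in>I. \<forall>y\<in>I. x + y \<in> I) \<and> (\<forall>x\<in>I. \<forall>r. r * x \<in> I)"
proof
  interpret R: cring "ring_of_type_algebra :: 'a ring" by (rule cring_from_type_algebra)
  have simps: "carrier ring_of_type_algebra = (UNIV :: 'a set)" "x \<otimes>\<^bsub>ring_of_type_algebra\<^esub> y = x * y"
    "x \<oplus>\<^bsub>ring_of_type_algebra\<^esub> y = x + y" "\<zero>\<^bsub>ring_of_type_algebra\<^esub> = (0::'a)" for x y :: 'a
    by (simp_all add: ring_of_type_algebra_def)
  {
    assume "ideal I (ring_of_type_algebra :: 'a ring)"
    then interpret I: ideal I "ring_of_type_algebra :: 'a ring" .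
    show "0 \<in> I \<and> (\<forall>x\<in>I. \<forall>y\<in>I. x + y \<in> I) \<and> (\<forall>x\<in>I. \<forall>r. r * x \<in> I)"
      using I.zero_closed I.a_closed I.I_l_closed by (auto simp: simps)
  next
    assume I: "0 \<in> I \<and> (\<forall>x\<in>I. \<forall>y\<in>I. x + y \<in> I) \<and> (\<forall>x\<in>I. \<forall>r. r * x \<in> I)"
    have inv: "\<ominus>\<^bsub>ring_of_type_algebra\<^esub> x = - x" for x :: 'a
      by (rule R.minus_equality) (simp_all add: simps)
    show "ideal I (ring_of_type_algebra :: 'a ring)"
    proof (rule idealI[OF R.ring_axioms])
      show "subgroup I (add_monoid (ring_of_type_algebra :: 'a ring))"
      proof (rule R.add.subgroupI)
        show "\<ominus>\<^bsub>ring_of_type_algebra\<^esub> x \<in> I" if "x \<in> I" for x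
          using I that by (metis inv mult_minus1)
      qed (use I in \<open>auto simp: simps\<close>)
    qed (use I in \<open>auto simp: simps mult.commute\<close>)
  }
qed

lemma genideal_of_type_minimal:
  "ideal I (ring_of_type_algebra :: 'a::comm_ring_1 ring) \<Longrightarrow> H \<subseteq> I \<Longrightarrow> Idl\<^bsub>ring_of_type_algebra\<^esub> H \<subseteq> I"
  by (auto simp: genideal_def)

lemma genideal_of_type:
  "ideal (Idl\<^bsub>ring_of_type_algebra\<^esub> H) (ring_of_type_algebra :: 'a::comm_ring_1 ring)"
  "H \<subseteq> Idl\<^bsub>ring_of_type_algebra\<^esub> (H :: 'a set)"
proof -
  interpret R: cring "ring_of_type_algebra :: 'a ring" by (rule cring_from_type_algebra)
  have "H \<subseteq> carrier ring_of_type_algebra" by (simp add: ring_of_type_algebra_def)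
  then show "ideal (Idl\<^bsub>ring_of_type_algebra\<^esub> H) (ring_of_type_algebra :: 'a ring)"
    "H \<subseteq> Idl\<^bsub>ring_of_type_algebra\<^esub> (H :: 'a set)"
    by (rule R.genideal_ideal, rule R.genideal_self)
qed

lemma cartier_idealI: "\<theta> \<in> cartier q \<Longrightarrow> \<theta> u \<in> cartier_ideal q u"
  by (auto simp: cartier_ideal_def)

lemma cartier_idealE:
  assumes "x \<in> cartier_ideal q u" obtains \<theta> where "\<theta> \<in> cartier q" "x = \<theta> u"
  using assms by (auto simp: cartier_ideal_def)

lemma cartier_ideal_ideal: "ideal (cartier_ideal q u) ring_of_type_algebra"
  unfolding ideal_of_type_iff
proof (intro conjI ballI allI)
  show "0 \<in> cartier_ideal q u" using cartier_idealI[OF cartier_closed(6)] .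
  fix x assume "x \<in> cartier_ideal q u"
  then obtain \<theta> where \<theta>: "\<theta> \<in> cartier q" "x = \<theta> u" by (rule cartier_idealE)
  show "r * x \<in> cartier_ideal q u" for r
    unfolding \<theta>(2) by (rule cartier_idealI[OF cartier_closed(3)[OF \<theta>(1)]])
  fix y assume "y \<in> cartier_ideal q u"
  then obtain \<theta>' where \<theta>': "\<theta>' \<in> cartier q" "y = \<theta>' u" by (rule cartier_idealE)
  show "x + y \<in> cartier_ideal q u"
    unfolding \<theta>(2) \<theta>'(2) by (rule cartier_idealI[OF cartier_closed(2)[OF \<theta>(1) \<theta>'(1)]])
qed
text \<open>
  If \<open>u\<close> is a combination of \<open>q\<close>-th powers of elements of \<open>I\<close>, a \<open>p\<^sup>-\<^sup>e\<close>-linear map sends it to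
  a combination of these elements.
\<close>

lemma cartier_ideal_least:
  assumes "ideal I (ring_of_type_algebra :: 'a::comm_ring_1 ring)" "u \<in> frob_power p e I"
  shows "cartier_ideal (p ^ e) u \<subseteq> I"
proof -
  let ?J = "{x :: 'a. \<forall>\<theta>\<in>cartier (p ^ e). \<theta> x \<in> I}"
  have J: "ideal ?J ring_of_type_algebra"
    unfolding ideal_of_type_iff
  proof (intro conjI ballI allI)
    show "0 \<in> ?J" using assms(1) by (simp add: ideal_of_type_iff cartier_zero)
    show "x + y \<in> ?J" if "x \<in> ?J" "y \<in> ?J" for x y
      using that assms(1) by (simp add: ideal_of_type_iff cartierD(1))
    show "r * x \<in> ?J" if x: "x \<in> ?J" for x r
    proof (intro CollectI ballI)
      fix \<theta> :: "'a \<Rightarrow> 'a" assume "\<theta> \<in> cartier (p ^ e)"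
      from bspec[OF CollectD[OF x] cartier_closed(1)[OF this, of r]] show "\<theta> (r * x) \<in> I" .
    qed
  qed
  have "(\<lambda>a. a ^ (p ^ e)) ` I \<subseteq> ?J"
  proof clarify
    fix a and \<theta> :: "'a \<Rightarrow> 'a" assume "a \<in> I" "\<theta> \<in> cartier (p ^ e)"
    then show "\<theta> (a ^ p ^ e) \<in> I"
      using cartierD(2)[of \<theta> "p ^ e" a 1] assms(1) unfolding ideal_of_type_iff
      by (simp add: mult.commute)
  qed
  from genideal_of_type_minimal[OF J this] have "u \<in> ?J" using assms(2) unfolding frob_power_def by (rule subsetD)
  then show ?thesis by (auto elim: cartier_idealE)
qed

section \<open>Cartier maps of a polynomial ring\<close>

definition expo :: "('n::finite \<Rightarrow> nat) \<Rightarrow> 'n \<Rightarrow>\<^sub>0 nat" where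
  "expo g = Abs_poly_mapping g"

lemma lookup_expo [simp]: "Poly_Mapping.lookup (expo g) = g"
  by (simp add: expo_def)

lemma expo_eqI: "(\<And>i. Poly_Mapping.lookup m i = g i) \<Longrightarrow> m = expo g"
  by (rule poly_mapping_eqI) simp

definition box :: "nat \<Rightarrow> ('n::finite \<Rightarrow>\<^sub>0 nat) set" where
  "box d = {m. \<forall>i. Poly_Mapping.lookup m i \<le> d}"

lemma finite_box: "finite (box d :: ('n::finite \<Rightarrow>\<^sub>0 nat) set)"
proof (rule finite_subset)
  show "(box d :: ('n \<Rightarrow>\<^sub>0 nat) set) \<subseteq> expo ` {g. \<forall>i. g i \<in> {..d}}"
  proof
    fix m :: "'n \<Rightarrow>\<^sub>0 nat" assume "m \<in> box d"
    then have "m = expo (Poly_Mapping.lookup m)" "Poly_Mapping.lookup m \<in> {g. \<forall>i. g i \<in> {..d}}"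
      by (auto simp: box_def intro: expo_eqI)
    then show "m \<in> expo ` {g. \<forall>i. g i \<in> {..d}}" by (rule image_eqI)
  qed
  have "finite {g. \<forall>i. (i \<in> (UNIV :: 'n set) \<longrightarrow> g i \<in> {..d}) \<and> (i \<notin> (UNIV :: 'n set) \<longrightarrow> g i = (0::nat))}"
    by (rule finite_set_of_finite_funs) simp_all
  then show "finite (expo ` {g :: 'n \<Rightarrow> nat. \<forall>i. g i \<in> {..d}})" by simp
qed

definition scale_expo :: "nat \<Rightarrow> ('n::finite \<Rightarrow>\<^sub>0 nat) \<Rightarrow> 'n \<Rightarrow>\<^sub>0 nat" where
  "scale_expo q m = expo (\<lambda>i. q * Poly_Mapping.lookup m i)"

definition div_expo :: "('n::finite \<Rightarrow>\<^sub>0 nat) \<Rightarrow> nat \<Rightarrow> 'n \<Rightarrow>\<^sub>0 nat" where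
  "div_expo m q = expo (\<lambda>i. Poly_Mapping.lookup m i div q)"

definition mod_expo :: "('n::finite \<Rightarrow>\<^sub>0 nat) \<Rightarrow> nat \<Rightarrow> 'n \<Rightarrow>\<^sub>0 nat" where
  "mod_expo m q = expo (\<lambda>i. Poly_Mapping.lookup m i mod q)"

lemma div_mod_expo: "scale_expo q (div_expo m q) + mod_expo m q = m"
  by (rule poly_mapping_eqI) (simp add: scale_expo_def div_expo_def mod_expo_def lookup_add)

lemma div_mod_expo_scale:
  assumes "q > 0"
  shows "div_expo (scale_expo q m + n) q = m + div_expo n q" "mod_expo (scale_expo q m + n) q = mod_expo n q"
  using assms by (auto intro!: poly_mapping_eqI simp: scale_expo_def div_expo_def mod_expo_def lookup_add)

lemma scale_expo_add_eq_iff: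
  assumes "q > 0" "\<alpha> \<in> box (q - 1)"
  shows "scale_expo q m + \<alpha> = n \<longleftrightarrow> m = div_expo n q \<and> \<alpha> = mod_expo n q"
proof
  assume "scale_expo q m + \<alpha> = n"
  moreover have "Poly_Mapping.lookup \<alpha> i < q" for i
    using assms by (metis (mono_tags, lifting) box_def Suc_pred' le_imp_less_Suc mem_Collect_eq)
  then have "div_expo \<alpha> q = 0" "mod_expo \<alpha> q = \<alpha>"
    by (auto intro!: poly_mapping_eqI simp: div_expo_def mod_expo_def)
  ultimately show "m = div_expo n q \<and> \<alpha> = mod_expo n q"
    using div_mod_expo_scale[OF assms(1), of m \<alpha>] by simp
qed (simp add: div_mod_expo)

definition root_of :: "nat \<Rightarrow> 'k::field \<Rightarrow> 'k" where
  "root_of q = inv_into UNIV (\<lambda>x. x ^ q)"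

text \<open>
  \<open>R\<close> is free over its subring of \<open>q\<close>-th powers on the monomials with exponents below \<open>q\<close>;
  \<open>cartier_coord q \<alpha> u\<close> is the \<open>q\<close>-th root of the coordinate of \<open>u\<close> at the monomial \<open>\<alpha>\<close>.
\<close>

definition cartier_coord ::
    "nat \<Rightarrow> ('n::finite \<Rightarrow>\<^sub>0 nat) \<Rightarrow> ('n, 'k::field) mpoly \<Rightarrow> ('n, 'k) mpoly" where
  "cartier_coord q \<alpha> u = Abs_poly_mapping (\<lambda>m. root_of q (Poly_Mapping.lookup u (scale_expo q m + \<alpha>)))"

context b_function_setup
begin

lemma freshman: "(x + y) ^ (p ^ e) = x ^ (p ^ e) + y ^ (p ^ e)" for x y :: "('n, 'k) mpoly"
  using freshmans_dream'[of "p ^ e" e x y] prime_p CHAR_p by simp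

lemma power_bij: "bij (\<lambda>x::'k. x ^ (p ^ e))"
proof (rule bijI)
  show "surj (\<lambda>x::'k. x ^ (p ^ e))" by (rule surj_power_CHAR_power[OF perfect])
  have fresh: "(x + y) ^ (p ^ e) = x ^ (p ^ e) + y ^ (p ^ e)" for x y :: 'k
    using freshmans_dream'[of "p ^ e" e x y] prime_p CHAR_p by simp
  show "inj (\<lambda>x::'k. x ^ (p ^ e))"
  proof (rule injI)
    fix x y :: 'k assume "x ^ (p ^ e) = y ^ (p ^ e)"
    then have "(x - y) ^ (p ^ e) = 0" using fresh[of "x - y" y] by simp
    then show "x = y" by simp
  qed
qed

lemma root_of_power: "root_of (p ^ e) (c ^ (p ^ e)) = c" "root_of (p ^ e) c ^ (p ^ e) = c" for c :: 'k
proof -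
  let ?F = "\<lambda>x::'k. x ^ (p ^ e)"
  have "inv_into UNIV ?F (?F c) = c" 
    by (rule inv_f_f[of ?F]) (rule bij_is_inj[OF power_bij])
  then show "root_of (p ^ e) (c ^ (p ^ e)) = c" by (simp add: root_of_def)
  have "?F (inv_into UNIV ?F c) = c" 
    by (rule surj_f_inv_f[of ?F]) (rule bij_is_surj[OF power_bij])
  then show "root_of (p ^ e) c ^ (p ^ e) = c" by (simp add: root_of_def)
qed

lemma root_of_simps: "root_of (p ^ e) (c + d) = root_of (p ^ e) c + root_of (p ^ e) d"
    "root_of (p ^ e) (c ^ (p ^ e) * d) = c * root_of (p ^ e) d"
    "root_of (p ^ e) 0 = (0::'k)" "root_of (p ^ e) c = 0 \<longleftrightarrow> c = 0" for c d :: 'k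
proof -
  have fresh: "(x + y) ^ (p ^ e) = x ^ (p ^ e) + y ^ (p ^ e)" for x y :: 'k
    using freshmans_dream'[of "p ^ e" e x y] prime_p CHAR_p by simp
  have "root_of (p ^ e) ((root_of (p ^ e) c + root_of (p ^ e) d) ^ (p ^ e)) = root_of (p ^ e) c + root_of (p ^ e) d"
    by (rule root_of_power)
  then show "root_of (p ^ e) (c + d) = root_of (p ^ e) c + root_of (p ^ e) d"
    by (simp only: fresh root_of_power)
  have "root_of (p ^ e) ((c * root_of (p ^ e) d) ^ (p ^ e)) = c * root_of (p ^ e) d"
    by (rule root_of_power)
  then show "root_of (p ^ e) (c ^ (p ^ e) * d) = c * root_of (p ^ e) d"
    by (simp only: power_mult_distrib root_of_power)
  show z: "root_of (p ^ e) 0 = (0::'k)" using root_of_power(1)[of e "0::'k"] p_pos by (simp add: zero_power)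
  show "root_of (p ^ e) c = 0 \<longleftrightarrow> c = 0"
  proof
    assume "root_of (p ^ e) c = 0"
    then show "c = 0" using root_of_power(2)[of e c] p_pos by (simp add: zero_power)
  qed (simp add: z)
qed

lemma lookup_cartier_coord:
  assumes "\<alpha> \<in> box (p ^ e - 1)"
  shows "Poly_Mapping.lookup (cartier_coord (p ^ e) \<alpha> u) m =
    (root_of (p ^ e) (Poly_Mapping.lookup u (scale_expo (p ^ e) m + \<alpha>)) :: 'k)"
proof -
  have q: "p ^ e > 0" using p_pos by simp
  have "{m. root_of (p ^ e) (Poly_Mapping.lookup u (scale_expo (p ^ e) m + \<alpha>)) \<noteq> (0::'k)}
      \<subseteq> (\<lambda>n. div_expo n (p ^ e)) ` Poly_Mapping.keys u"
  proof
    fix m assume "m \<in> {m. root_of (p ^ e) (Poly_Mapping.lookup u (scale_expo (p ^ e) m + \<alpha>)) \<noteq> (0::'k)}"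
    then have "scale_expo (p ^ e) m + \<alpha> \<in> Poly_Mapping.keys u" by (simp add: root_of_simps in_keys_iff)
    moreover have "m = div_expo (scale_expo (p ^ e) m + \<alpha>) (p ^ e)"
      using scale_expo_add_eq_iff[OF q assms, of m] by blast
    ultimately show "m \<in> (\<lambda>n. div_expo n (p ^ e)) ` Poly_Mapping.keys u" by (rule rev_image_eqI)
  qed
  then have "finite {m. root_of (p ^ e) (Poly_Mapping.lookup u (scale_expo (p ^ e) m + \<alpha>)) \<noteq> (0::'k)}"
    by (rule finite_subset) simp
  then show ?thesis by (simp add: cartier_coord_def)
qed

lemma cartier_coord_add:
  assumes "\<alpha> \<in> box (p ^ e - 1)"
  shows "cartier_coord (p ^ e) \<alpha> (u + v) = cartier_coord (p ^ e) \<alpha> u + cartier_coord (p ^ e) \<alpha> (v :: ('n, 'k) mpoly)"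
  by (rule poly_mapping_eqI) (simp add: lookup_cartier_coord[OF assms] lookup_add root_of_simps)

lemma cartier_coord_zero:
  assumes "\<alpha> \<in> box (p ^ e - 1)" shows "cartier_coord (p ^ e) \<alpha> (0 :: ('n, 'k) mpoly) = 0"
  by (rule poly_mapping_eqI) (simp add: lookup_cartier_coord[OF assms] root_of_simps)

lemma cartier_coord_single:
  assumes "\<alpha> \<in> box (p ^ e - 1)"
  shows "cartier_coord (p ^ e) \<alpha> (Poly_Mapping.single n (c :: 'k) :: ('n, 'k) mpoly) =
    (if mod_expo n (p ^ e) = \<alpha> then Poly_Mapping.single (div_expo n (p ^ e)) (root_of (p ^ e) c) else 0)"
proof (rule poly_mapping_eqI)
  fix m
  have q: "p ^ e > 0" using p_pos by simp
  show "Poly_Mapping.lookup (cartier_coord (p ^ e) \<alpha> (Poly_Mapping.single n c)) m =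
     Poly_Mapping.lookup (if mod_expo n (p ^ e) = \<alpha> then Poly_Mapping.single (div_expo n (p ^ e)) (root_of (p ^ e) c) else 0) m"
    using scale_expo_add_eq_iff[OF q assms, of m n]
    by (auto simp: lookup_cartier_coord[OF assms] lookup_single when_def root_of_simps)
qed

lemma single_power: "Poly_Mapping.single m (c::'k) ^ q = (Poly_Mapping.single (scale_expo q m) (c ^ q) :: ('n, 'k) mpoly)"
proof (induction q)
  case 0
  have "scale_expo 0 m = 0" by (rule poly_mapping_eqI) (simp add: scale_expo_def)
  then show ?case by simp
next
  case (Suc q)
  have "scale_expo (Suc q) m = m + scale_expo q m"
    by (rule poly_mapping_eqI) (simp add: scale_expo_def lookup_add)
  then show ?case using Suc by (simp add: mult_single)
qed

lemma cartier_coord_cartier: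
  assumes "\<alpha> \<in> box (p ^ e - 1)"
  shows "(cartier_coord (p ^ e) \<alpha> :: ('n, 'k) mpoly \<Rightarrow> _) \<in> cartier (p ^ e)"
proof -
  have q: "p ^ e > 0" using p_pos by simp
  have "cartier_coord (p ^ e) \<alpha> (a ^ (p ^ e) * x) = a * cartier_coord (p ^ e) \<alpha> x" for a x :: "('n, 'k) mpoly"
  proof (induction a rule: poly_mapping_add_induct)
    case zero
    then show ?case using p_pos by (simp add: zero_power cartier_coord_zero[OF assms])
  next
    case (add a m c)
    have "cartier_coord (p ^ e) \<alpha> (Poly_Mapping.single m c ^ (p ^ e) * x) = Poly_Mapping.single m c * cartier_coord (p ^ e) \<alpha> x"
    proof (induction x rule: poly_mapping_add_induct)
      case zero
      then show ?case by (simp add: cartier_coord_zero[OF assms])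
    next
      case (add x n d)
      have "cartier_coord (p ^ e) \<alpha> (Poly_Mapping.single m c ^ (p ^ e) * Poly_Mapping.single n d)
          = Poly_Mapping.single m c * cartier_coord (p ^ e) \<alpha> (Poly_Mapping.single n d)"
        by (simp add: single_power mult_single cartier_coord_single[OF assms] div_mod_expo_scale[OF q] root_of_simps)
      then show ?case using add by (simp add: distrib_left cartier_coord_add[OF assms])
    qed
    then show ?case using add by (simp add: freshman distrib_right cartier_coord_add[OF assms])
  qed
  then show ?thesis by (simp add: cartier_def cartier_coord_add[OF assms])
qed

lemma mod_expo_box: "mod_expo n (p ^ e) \<in> box (p ^ e - 1)"
proof -
  have "x mod p ^ e \<le> p ^ e - 1" for x using p_pos by (simp add: less_Suc_eq_le[symmetric])
  then show ?thesis by (simp add: box_def mod_expo_def)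
qed

lemma cartier_expansion:
  "u = (\<Sum>\<alpha>\<in>box (p ^ e - 1). Poly_Mapping.single \<alpha> 1 * cartier_coord (p ^ e) \<alpha> u ^ (p ^ e))"
  for u :: "('n, 'k) mpoly"
proof (induction u rule: poly_mapping_add_induct)
  case zero
  show ?case using p_pos by (simp add: cartier_coord_zero zero_power)
next
  case (add u n c)
  have "(\<Sum>\<alpha>\<in>box (p ^ e - 1). Poly_Mapping.single \<alpha> 1 * cartier_coord (p ^ e) \<alpha> (Poly_Mapping.single n c) ^ (p ^ e))
     = (\<Sum>\<alpha>\<in>box (p ^ e - 1). if \<alpha> = mod_expo n (p ^ e) then
          Poly_Mapping.single \<alpha> 1 * Poly_Mapping.single (div_expo n (p ^ e)) (root_of (p ^ e) c) ^ (p ^ e) else 0)"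
    using p_pos by (intro sum.cong) (auto simp: cartier_coord_single zero_power)
  also have "\<dots> = Poly_Mapping.single (mod_expo n (p ^ e)) 1 *
      Poly_Mapping.single (div_expo n (p ^ e)) (root_of (p ^ e) c) ^ (p ^ e)"
    using mod_expo_box[of n e] by (simp add: finite_box)
  also have "\<dots> = Poly_Mapping.single n c"
    using div_mod_expo[of "p ^ e" n] by (simp add: single_power mult_single root_of_power add.commute)
  finally have s: "Poly_Mapping.single n c =
      (\<Sum>\<alpha>\<in>box (p ^ e - 1). Poly_Mapping.single \<alpha> 1 * cartier_coord (p ^ e) \<alpha> (Poly_Mapping.single n c) ^ (p ^ e))" ..
  have "(\<Sum>\<alpha>\<in>box (p ^ e - 1). Poly_Mapping.single \<alpha> 1 * cartier_coord (p ^ e) \<alpha> (u + Poly_Mapping.single n c) ^ (p ^ e))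
     = (\<Sum>\<alpha>\<in>box (p ^ e - 1). Poly_Mapping.single \<alpha> 1 * cartier_coord (p ^ e) \<alpha> u ^ (p ^ e) +
          Poly_Mapping.single \<alpha> 1 * cartier_coord (p ^ e) \<alpha> (Poly_Mapping.single n c) ^ (p ^ e))"
    by (intro sum.cong) (simp_all add: cartier_coord_add freshman distrib_left)
  also have "\<dots> = u + Poly_Mapping.single n c"
    unfolding sum.distrib using add s by simp
  finally show ?case ..
qed

text \<open>
  Composing a Cartier map with \<open>P\<close> gives one direction. For the other, each coordinate of \<open>u\<close> is the
  value at \<open>v\<close> of some Cartier map \<open>\<theta>\<close>, and \<open>x \<mapsto> \<theta> x ^ (p ^ e)\<close> is linear over the \<open>p ^ e\<close>-th powers.
\<close>

lemma cartier_ideal_subset_iff: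
  "cartier_ideal (p ^ e) u \<subseteq> cartier_ideal (p ^ e) v \<longleftrightarrow> (\<exists>P\<in>frob_linear (p ^ e). P v = u)"
  for u v :: "('n, 'k) mpoly"
proof
  assume "\<exists>P\<in>frob_linear (p ^ e). P v = u"
  then obtain P where P: "P \<in> frob_linear (p ^ e)" "P v = u" by blast
  show "cartier_ideal (p ^ e) u \<subseteq> cartier_ideal (p ^ e) v"
  proof
    fix x assume "x \<in> cartier_ideal (p ^ e) u"
    then obtain \<theta> where \<theta>: "\<theta> \<in> cartier (p ^ e)" "x = \<theta> u" by (rule cartier_idealE)
    show "x \<in> cartier_ideal (p ^ e) v"
      using cartier_idealI[OF cartier_closed(4)[OF \<theta>(1) P(1)], of v] by (simp add: P(2) \<theta>(2))
  qed
next
  assume sub: "cartier_ideal (p ^ e) u \<subseteq> cartier_ideal (p ^ e) v"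
  have "\<forall>\<alpha>\<in>box (p ^ e - 1). \<exists>\<theta>. \<theta> \<in> cartier (p ^ e) \<and> cartier_coord (p ^ e) \<alpha> u = \<theta> v"
  proof
    fix \<alpha> :: "'n \<Rightarrow>\<^sub>0 nat" assume "\<alpha> \<in> box (p ^ e - 1)"
    from subsetD[OF sub cartier_idealI[OF cartier_coord_cartier[OF this]]]
    show "\<exists>\<theta>. \<theta> \<in> cartier (p ^ e) \<and> cartier_coord (p ^ e) \<alpha> u = \<theta> v"
      by (rule cartier_idealE) (intro exI conjI)
  qed
  from bchoice[OF this] obtain \<theta> where \<theta>: "\<And>\<alpha>. \<alpha> \<in> box (p ^ e - 1) \<Longrightarrow> \<theta> \<alpha> \<in> cartier (p ^ e)"
    "\<And>\<alpha>. \<alpha> \<in> box (p ^ e - 1) \<Longrightarrow> cartier_coord (p ^ e) \<alpha> u = \<theta> \<alpha> v" by blast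
  define P where "P x = (\<Sum>\<alpha>\<in>box (p ^ e - 1). Poly_Mapping.single \<alpha> 1 * \<theta> \<alpha> x ^ (p ^ e))" for x
  have "P (x + y) = P x + P y" for x y
    unfolding P_def sum.distrib[symmetric]
    by (intro sum.cong) (simp_all add: cartierD(1)[OF \<theta>(1)] freshman distrib_left)
  moreover have "P (a ^ (p ^ e) * x) = a ^ (p ^ e) * P x" for a x
    unfolding P_def sum_distrib_left
    by (intro sum.cong) (simp_all add: cartierD(2)[OF \<theta>(1)] power_mult_distrib mult.left_commute)
  ultimately have "P \<in> frob_linear (p ^ e)" by (simp add: frob_linear_def)
  moreover have "P v = (\<Sum>\<alpha>\<in>box (p ^ e - 1). Poly_Mapping.single \<alpha> 1 * cartier_coord (p ^ e) \<alpha> u ^ (p ^ e))"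
    unfolding P_def by (intro sum.cong) (simp_all add: \<theta>(2))
  then have "P v = u" by (rule trans[OF _ cartier_expansion[symmetric]])
  ultimately show "\<exists>P\<in>frob_linear (p ^ e). P v = u" by (intro bexI[of _ P])
qed

lemma frob_root_principal:
  "frob_root p e (PIdl\<^bsub>ring_of_type_algebra\<^esub> u) = cartier_ideal (p ^ e) u" for u :: "('n, 'k) mpoly"
proof
  have PIdl: "PIdl\<^bsub>ring_of_type_algebra\<^esub> u = {x * u | x. True}"
    by (auto simp: cgenideal_def ring_of_type_algebra_def)
  let ?I = "frob_power p e (cartier_ideal (p ^ e) u)"
  have I: "ideal ?I ring_of_type_algebra" unfolding frob_power_def by (rule genideal_of_type)
  have coord: "cartier_coord (p ^ e) \<alpha> u ^ (p ^ e) \<in> ?I" if "\<alpha> \<in> box (p ^ e - 1)" for \<alpha>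
    unfolding frob_power_def
    by (rule subsetD[OF genideal_of_type(2)], rule imageI, rule cartier_idealI, rule cartier_coord_cartier[OF that])
  have "(\<Sum>\<alpha>\<in>A. Poly_Mapping.single \<alpha> 1 * cartier_coord (p ^ e) \<alpha> u ^ (p ^ e)) \<in> ?I"
    if "A \<subseteq> box (p ^ e - 1)" for A
    using that coord I unfolding ideal_of_type_iff
    by (induction A rule: infinite_finite_induct) auto
  from back_subst[of "\<lambda>w. w \<in> ?I", OF this[OF subset_refl] cartier_expansion[of u e, symmetric]]
  have "u \<in> ?I" .
  then have "x * u \<in> ?I" for x using I unfolding ideal_of_type_iff by blast
  then have "PIdl\<^bsub>ring_of_type_algebra\<^esub> u \<subseteq> ?I" unfolding PIdl by blast
  then show "frob_root p e (PIdl\<^bsub>ring_of_type_algebra\<^esub> u) \<subseteq> cartier_ideal (p ^ e) u"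
    unfolding frob_root_def using cartier_ideal_ideal by blast
  show "cartier_ideal (p ^ e) u \<subseteq> frob_root p e (PIdl\<^bsub>ring_of_type_algebra\<^esub> u)"
    unfolding frob_root_def
  proof (intro Inter_greatest, clarify)
    fix I assume I: "ideal I ring_of_type_algebra" "PIdl\<^bsub>ring_of_type_algebra\<^esub> u \<subseteq> frob_power p e I"
    have "u = 1 * u" by simp
    then have "u \<in> frob_power p e I" using I(2) unfolding PIdl by blast
    then show "x \<in> I" if "x \<in> cartier_ideal (p ^ e) u" for x
      using cartier_ideal_least[OF I(1)] that by blast
  qed
qed

end

section \<open>Jumps\<close>

context b_function_setup
begin
text \<open>
  At level \<open>e\<close> a jump \<open>a\<close> marks a strict inclusion between the Frobenius roots of \<open>f ^ (a + 1)\<close> and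
  \<open>f ^ a\<close>, which are the test ideals with exponents \<open>(a + 1) / p ^ e\<close> and \<open>a / p ^ e\<close>.
\<close>

definition jump :: "nat \<Rightarrow> nat \<Rightarrow> bool" where
  "jump e a \<longleftrightarrow> \<not> (\<exists>P\<in>frob_linear (p ^ e). P (f ^ Suc a) = f ^ a)"

abbreviation C :: "nat \<Rightarrow> ('n, 'k) mpoly \<Rightarrow> ('n, 'k) mpoly set" where
  "C e u \<equiv> cartier_ideal (p ^ e) u"

lemma jump_iff: "jump e a \<longleftrightarrow> \<not> C e (f ^ a) \<subseteq> C e (f ^ Suc a)"
  unfolding jump_def cartier_ideal_subset_iff ..

lemma C_mult: "C e (v * u) \<subseteq> C e u"
  using cartier_ideal_subset_iff[of e "v * u" u] frob_linear_mult[of v "p ^ e"] by blast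

lemma C_power_antimono: "a \<le> b \<Longrightarrow> C e (f ^ b) \<subseteq> C e (f ^ a)"
  using C_mult[of e "f ^ (b - a)" "f ^ a"] by (simp flip: power_add)

lemma cartier_splitting: "\<exists>\<kappa>\<in>cartier (p ^ k). \<kappa> 1 = (1 :: ('n, 'k) mpoly)"
proof
  have z: "(0 :: 'n \<Rightarrow>\<^sub>0 nat) \<in> box (p ^ k - 1)" by (simp add: box_def)
  show "(cartier_coord (p ^ k) 0 :: ('n, 'k) mpoly \<Rightarrow> _) \<in> cartier (p ^ k)" by (rule cartier_coord_cartier[OF z])
  have "mod_expo 0 (p ^ k) = (0 :: 'n \<Rightarrow>\<^sub>0 nat)" "div_expo 0 (p ^ k) = (0 :: 'n \<Rightarrow>\<^sub>0 nat)"
    by (auto intro!: poly_mapping_eqI simp: mod_expo_def div_expo_def)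
  moreover have "root_of (p ^ k) 1 = (1::'k)" using root_of_power(1)[of k 1] by simp
  ultimately have "cartier_coord (p ^ k) 0 (Poly_Mapping.single 0 1 :: ('n, 'k) mpoly) = Poly_Mapping.single 0 1"
    by (simp only: cartier_coord_single[OF z] if_True simp_thms)
  then show "cartier_coord (p ^ k) 0 1 = (1 :: ('n, 'k) mpoly)" by simp
qed
text \<open>
  A Cartier map of level \<open>e + k\<close> composed with the \<open>p ^ k\<close>-th power map has level \<open>e\<close>. Conversely, a
  splitting of the \<open>k\<close>-th iterate of the Frobenius extracts the root \<open>u\<close> again.
\<close>

lemma C_frobenius: "C (e + k) (u ^ (p ^ k)) = C e u"
proof
  show "C (e + k) (u ^ (p ^ k)) \<subseteq> C e u"
  proof
    fix x assume "x \<in> C (e + k) (u ^ (p ^ k))"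
    then obtain \<theta> where \<theta>: "\<theta> \<in> cartier (p ^ (e + k))" "x = \<theta> (u ^ (p ^ k))" by (rule cartier_idealE)
    have "\<theta> ((a ^ p ^ e * y) ^ p ^ k) = a * \<theta> (y ^ p ^ k)" for a y
      using cartierD(2)[OF \<theta>(1), of a "y ^ p ^ k"] by (simp only: power_mult_distrib power_mult[symmetric] power_add)
    then have "(\<lambda>y. \<theta> (y ^ (p ^ k))) \<in> cartier (p ^ e)"
      using cartierD(1)[OF \<theta>(1)] by (simp add: cartier_def freshman)
    from cartier_idealI[OF this, of u] show "x \<in> C e u" by (simp add: \<theta>(2))
  qed
  obtain \<kappa> where \<kappa>: "\<kappa> \<in> cartier (p ^ k)" "\<kappa> 1 = (1 :: ('n, 'k) mpoly)" using cartier_splitting by blast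
  show "C e u \<subseteq> C (e + k) (u ^ (p ^ k))"
  proof
    fix x assume "x \<in> C e u"
    then obtain \<theta> where \<theta>: "\<theta> \<in> cartier (p ^ e)" "x = \<theta> u" by (rule cartier_idealE)
    have "\<kappa> (u ^ (p ^ k)) = u" using cartierD(2)[OF \<kappa>(1), of u 1] \<kappa>(2) by simp
    then show "x \<in> C (e + k) (u ^ (p ^ k))"
      using cartier_idealI[OF cartier_closed(5)[OF \<theta>(1) \<kappa>(1)], of "u ^ (p ^ k)"] by (simp add: \<theta>(2) power_add)
  qed
qed

lemma C_frobenius_power: "C (e + k) (f ^ (a * p ^ k)) = C e (f ^ a)"
  using C_frobenius[of e k "f ^ a"] by (simp add: power_mult)
text \<open>
  An operator that commutes with \<open>p ^ e\<close>-th powers and maps \<open>f ^ (a + 1)\<close> to \<open>f ^ a\<close> maps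
  \<open>f ^ (a + 1 + p ^ e * m)\<close> to \<open>f ^ (a + p ^ e * m)\<close>.
\<close>

lemma jump_add_multiple: "jump (e + k) (a + p ^ e * m) \<Longrightarrow> jump e a"
proof (rule ccontr)
  assume j: "jump (e + k) (a + p ^ e * m)" and "\<not> jump e a"
  then obtain P where P: "P \<in> frob_linear (p ^ e)" "P (f ^ Suc a) = f ^ a" by (auto simp: jump_def)
  have "f ^ Suc (a + p ^ e * m) = (f ^ m) ^ p ^ e * f ^ Suc a"
    by (simp only: power_mult[symmetric] power_add[symmetric]) (simp add: ac_simps)
  then have "P (f ^ Suc (a + p ^ e * m)) = (f ^ m) ^ p ^ e * f ^ a"
    using P unfolding frob_linear_def by (simp only: mem_Collect_eq)
  also have "\<dots> = f ^ (a + p ^ e * m)"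
    by (simp only: power_mult[symmetric] power_add[symmetric]) (simp add: ac_simps)
  finally have "P (f ^ Suc (a + p ^ e * m)) = f ^ (a + p ^ e * m)" .
  moreover have "P \<in> frob_linear (p ^ (e + k))" by (rule frob_linear_dvd[OF P(1)]) (simp add: power_add)
  ultimately show False using j unfolding jump_def by blast
qed
text \<open>
  The interval from \<open>a / p ^ e\<close> to \<open>(a + 1) / p ^ e\<close> is divided at level \<open>e + k\<close> into the \<open>p ^ k\<close>
  intervals that start at \<open>(a * p ^ k + c) / p ^ (e + k)\<close>. A jump in a part is a jump in the whole,
  and a jump in the whole occurs in one of the parts.
\<close>

lemma jump_coarsen:
  assumes "jump (e + k) (a * p ^ k + c)" "c < p ^ k" shows "jump e a"
proof (rule ccontr)
  assume "\<not> jump e a"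
  then have "C e (f ^ a) \<subseteq> C e (f ^ Suc a)" by (simp only: jump_iff not_not)
  then have "C (e + k) (f ^ (a * p ^ k)) \<subseteq> C (e + k) (f ^ (Suc a * p ^ k))"
    by (simp only: C_frobenius_power)
  moreover have "C (e + k) (f ^ (a * p ^ k + c)) \<subseteq> C (e + k) (f ^ (a * p ^ k))"
    by (rule C_power_antimono) simp
  moreover have "C (e + k) (f ^ (Suc a * p ^ k)) \<subseteq> C (e + k) (f ^ Suc (a * p ^ k + c))"
    by (rule C_power_antimono) (use assms(2) in simp)
  ultimately show False using assms(1) unfolding jump_iff by blast
qed

lemma jump_refine:
  assumes "jump e a" shows "\<exists>c<p. jump (Suc e) (a * p + c)"
proof (rule ccontr)
  assume "\<not> ?thesis"
  then have step: "C (Suc e) (f ^ (a * p + c)) \<subseteq> C (Suc e) (f ^ Suc (a * p + c))" if "c < p" for c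
    using that unfolding jump_iff by blast
  have "C (Suc e) (f ^ (a * p)) \<subseteq> C (Suc e) (f ^ (a * p + c))" if "c \<le> p" for c
    using that
  proof (induction c)
    case (Suc c)
    then show ?case using step[of c] by auto
  qed simp
  from this[of p] have "C (e + 1) (f ^ (a * p ^ 1)) \<subseteq> C (e + 1) (f ^ (Suc a * p ^ 1))"
    by (simp add: add.commute)
  then show False using assms unfolding C_frobenius_power jump_iff by blast
qed

lemma exponents_bounded:
  obtains d where "Poly_Mapping.keys f \<subseteq> box d"
proof
  let ?E = "(\<lambda>(m, i). Poly_Mapping.lookup m i) ` (Poly_Mapping.keys f \<times> UNIV)"
  have fin: "finite ?E" by simp
  show "Poly_Mapping.keys f \<subseteq> box (Max ?E)"
  proof
    fix m assume m: "m \<in> Poly_Mapping.keys f"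
    have "Poly_Mapping.lookup m i \<le> Max ?E" for i
      by (rule Max_ge[OF fin]) (use m in force)
    then show "m \<in> box (Max ?E)" by (simp add: box_def)
  qed
qed

text \<open>
  The test ideals are right continuous: once \<open>p ^ k\<close> exceeds all exponents of \<open>f\<close>, some Cartier
  map of level \<open>k\<close> sends \<open>f\<close> to \<open>1\<close>.
\<close>

lemma no_jump_at_multiples:
  assumes "f \<noteq> 0" shows "\<exists>k. \<forall>e a. \<not> jump (e + k) (a * p ^ k)"
proof -
  obtain d where d: "Poly_Mapping.keys f \<subseteq> box d" by (rule exponents_bounded)
  have dk: "d < p ^ d" using prime_p by (intro power_gt_expt) (simp add: prime_gt_Suc_0_nat)
  obtain \<alpha> where \<alpha>: "\<alpha> \<in> Poly_Mapping.keys f" using assms by fastforce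
  have \<alpha>d: "Poly_Mapping.lookup \<alpha> i \<le> d" for i using \<alpha> d by (auto simp: box_def)
  have "d \<le> p ^ d - 1" using dk by simp
  then have box: "\<alpha> \<in> box (p ^ d - 1)"
    unfolding box_def using order_trans[OF \<alpha>d] by blast
  define c where "c = root_of (p ^ d) (Poly_Mapping.lookup f \<alpha>)"
  have c: "c \<noteq> 0" using \<alpha> by (simp add: c_def root_of_simps in_keys_iff)
  have "cartier_coord (p ^ d) \<alpha> f = mconst c"
  proof (rule poly_mapping_eqI)
    fix m
    show "Poly_Mapping.lookup (cartier_coord (p ^ d) \<alpha> f) m = Poly_Mapping.lookup (mconst c) m"
    proof (cases "m = 0")
      case True
      have "scale_expo (p ^ d) 0 = (0 :: 'n \<Rightarrow>\<^sub>0 nat)" by (rule poly_mapping_eqI) (simp add: scale_expo_def)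
      then show ?thesis using True by (simp add: lookup_cartier_coord[OF box] c_def mconst_def)
    next
      case False
      then obtain i where i: "Poly_Mapping.lookup m i \<noteq> 0" by (metis poly_mapping_eqI lookup_zero)
      have "d < p ^ d * 1" using dk by simp
      also have "\<dots> \<le> p ^ d * Poly_Mapping.lookup m i" using i by (intro mult_le_mono2) simp
      finally have "d < Poly_Mapping.lookup (scale_expo (p ^ d) m + \<alpha>) i"
        by (simp add: scale_expo_def lookup_add)
      then have "scale_expo (p ^ d) m + \<alpha> \<notin> Poly_Mapping.keys f"
        using d by (auto simp: box_def not_le[symmetric])
      then show ?thesis using False
        by (simp add: lookup_cartier_coord[OF box] in_keys_iff root_of_simps mconst_def lookup_single)
    qed
  qed
  then have kf: "mconst (inverse c) * cartier_coord (p ^ d) \<alpha> f = 1"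
    using c by (simp add: mconst_simps(4)[symmetric] mconst_simps(2))
  have K: "(\<lambda>x. mconst (inverse c) * cartier_coord (p ^ d) \<alpha> x) \<in> cartier (p ^ d)"
    by (rule cartier_closed(3)[OF cartier_coord_cartier[OF box]])
  have "C (e + d) (f ^ (a * p ^ d)) \<subseteq> C (e + d) (f ^ Suc (a * p ^ d))" for e a
  proof
    fix x assume "x \<in> C (e + d) (f ^ (a * p ^ d))"
    then have "x \<in> C e (f ^ a)" by (simp only: C_frobenius_power)
    then obtain \<theta> where \<theta>: "\<theta> \<in> cartier (p ^ e)" "x = \<theta> (f ^ a)" by (rule cartier_idealE)
    have "f ^ Suc (a * p ^ d) = (f ^ a) ^ p ^ d * f" by (simp add: power_mult mult.commute)
    then have "mconst (inverse c) * cartier_coord (p ^ d) \<alpha> (f ^ Suc (a * p ^ d)) = f ^ a"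
      using cartierD(2)[OF K, of "f ^ a" f] by (simp only: kf mult_1_right)
    then show "x \<in> C (e + d) (f ^ Suc (a * p ^ d))"
      using cartier_idealI[OF cartier_closed(5)[OF \<theta>(1) K], of "f ^ Suc (a * p ^ d)"]
      by (simp only: \<theta>(2) power_add)
  qed
  then show ?thesis by (intro exI[of _ d] allI) (simp only: jump_iff not_not)
qed

lemma cartier_ideal_coords:
  fixes u :: "('n, 'k) mpoly"
  assumes I: "ideal I ring_of_type_algebra" and "\<And>\<alpha>. \<alpha> \<in> box (p ^ e - 1) \<Longrightarrow> cartier_coord (p ^ e) \<alpha> u \<in> I"
  shows "C e u \<subseteq> I"
proof
  fix x assume "x \<in> C e u"
  then obtain \<theta> where \<theta>: "\<theta> \<in> cartier (p ^ e)" "x = \<theta> u" by (rule cartier_idealE)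
  have "\<theta> (\<Sum>\<alpha>\<in>A. Poly_Mapping.single \<alpha> 1 * cartier_coord (p ^ e) \<alpha> u ^ (p ^ e)) \<in> I"
    if "finite A" "A \<subseteq> box (p ^ e - 1)" for A
    using that
  proof (induction A rule: finite_induct)
    case empty
    then show ?case using I by (simp add: ideal_of_type_iff cartier_zero[OF \<theta>(1)])
  next
    case (insert \<alpha> A)
    have "\<theta> (Poly_Mapping.single \<alpha> 1 * cartier_coord (p ^ e) \<alpha> u ^ (p ^ e)) =
       \<theta> (Poly_Mapping.single \<alpha> 1) * cartier_coord (p ^ e) \<alpha> u"
      using cartierD(2)[OF \<theta>(1), of "cartier_coord (p ^ e) \<alpha> u" "Poly_Mapping.single \<alpha> 1"] by (simp add: mult.commute)
    moreover have "cartier_coord (p ^ e) \<alpha> u \<in> I" using assms(2) insert.prems by blast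
    ultimately show ?case
      using insert I unfolding ideal_of_type_iff by (simp add: cartierD(1)[OF \<theta>(1)])
  qed
  from this[OF finite_box subset_refl] show "x \<in> I"
    unfolding \<theta>(2) using cartier_expansion[of u e] by simp
qed
text \<open>
  The coordinates of \<open>f ^ a\<close> with \<open>a < p ^ e\<close> involve only monomials whose exponents are bounded
  by those of \<open>f\<close>. Each jump contributes a vector of the finite-dimensional space spanned by these
  monomials that is independent of the previous ones.
\<close>

lemma card_jumps_bounded: "\<exists>N. \<forall>e. card {a. a < p ^ e \<and> jump e a} \<le> N"
proof -
  obtain d where d: "Poly_Mapping.keys f \<subseteq> box d" by (rule exponents_bounded)
  interpret V: vector_space "\<lambda>(c::'k) (u::('n, 'k) mpoly). mconst c * u"
    by unfold_locales (simp_all add: mconst_simps algebra_simps)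
  define T where "T = (\<lambda>m. Poly_Mapping.single m 1 :: ('n, 'k) mpoly) ` box d"
  have T: "finite T" by (simp add: T_def finite_box)
  have span: "u \<in> V.span T" if u: "Poly_Mapping.keys u \<subseteq> box d" for u
  proof -
    have "u = (\<Sum>m\<in>Poly_Mapping.keys u. mconst (Poly_Mapping.lookup u m) * Poly_Mapping.single m 1)"
      by (rule poly_mapping_eqI)
        (auto simp: lookup_sum mconst_def mult_single lookup_single when_def in_keys_iff)
    also have "\<dots> \<in> V.span T"
      by (intro V.span_sum V.span_scale V.span_base) (use u in \<open>auto simp: T_def\<close>)
    finally show ?thesis .
  qed
  have keys_power: "Poly_Mapping.keys (f ^ a) \<subseteq> box (a * d)" for a
  proof (induction a)
    case (Suc a)
    show ?case
    proof
      fix m assume "m \<in> Poly_Mapping.keys (f ^ Suc a)"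
      then obtain m1 m2 where "m = m1 + m2" "m1 \<in> Poly_Mapping.keys f" "m2 \<in> Poly_Mapping.keys (f ^ a)"
        using keys_mult[of f "f ^ a"] by auto
      then show "m \<in> box (Suc a * d)"
        using d Suc by (auto simp: box_def lookup_add subset_iff intro!: add_mono)
    qed
  qed (auto simp: box_def)
  have "card {a. a < p ^ e \<and> jump e a} \<le> card T" for e
  proof -
    let ?q = "p ^ e" and ?J = "{a. a < p ^ e \<and> jump e a}"
    have "\<forall>a\<in>?J. \<exists>w. w \<in> C e (f ^ a) \<and> w \<notin> C e (f ^ Suc a) \<and> Poly_Mapping.keys w \<subseteq> box d"
    proof
      fix a assume a: "a \<in> ?J"
      have "\<not> C e (f ^ a) \<subseteq> C e (f ^ Suc a)" using a by (simp add: jump_iff)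
      then obtain \<alpha> where \<alpha>: "\<alpha> \<in> box (?q - 1)" "cartier_coord ?q \<alpha> (f ^ a) \<notin> C e (f ^ Suc a)"
        using cartier_ideal_coords[OF cartier_ideal_ideal, of e "f ^ a" ?q "f ^ Suc a"] by blast
      have "Poly_Mapping.keys (cartier_coord ?q \<alpha> (f ^ a)) \<subseteq> box d"
      proof
        fix m assume "m \<in> Poly_Mapping.keys (cartier_coord ?q \<alpha> (f ^ a))"
        then have "scale_expo ?q m + \<alpha> \<in> Poly_Mapping.keys (f ^ a)"
          by (simp add: in_keys_iff lookup_cartier_coord[OF \<alpha>(1)] root_of_simps)
        then have b: "?q * Poly_Mapping.lookup m i + Poly_Mapping.lookup \<alpha> i \<le> a * d" for i
          using keys_power[of a] by (auto simp: box_def scale_expo_def lookup_add)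
        have "Poly_Mapping.lookup m i \<le> d" for i
        proof -
          have "?q * Poly_Mapping.lookup m i \<le> a * d" using b[of i] by simp
          also have "\<dots> \<le> ?q * d" using a by (intro mult_le_mono1) simp
          finally show ?thesis using p_pos by simp
        qed
        then show "m \<in> box d" by (simp add: box_def)
      qed
      then show "\<exists>w. w \<in> C e (f ^ a) \<and> w \<notin> C e (f ^ Suc a) \<and> Poly_Mapping.keys w \<subseteq> box d"
        using \<alpha>(2) cartier_idealI[OF cartier_coord_cartier[OF \<alpha>(1)]] by blast
    qed
    from bchoice[OF this] obtain w where w: "\<And>a. a \<in> ?J \<Longrightarrow> w a \<in> C e (f ^ a)" "\<And>a. a \<in> ?J \<Longrightarrow> w a \<notin> C e (f ^ Suc a)"
      "\<And>a. a \<in> ?J \<Longrightarrow> Poly_Mapping.keys (w a) \<subseteq> box d" by blast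
    \<comment> \<open>a chain of strict inclusions gives independent vectors\<close>
    have "A \<subseteq> ?J \<longrightarrow> V.independent (w ` A) \<and> card (w ` A) = card A" if "finite A" for A
      using that
    proof (induction A rule: finite_linorder_min_induct)
      case empty
      then show ?case by (simp add: V.independent_empty)
    next
      case (insert b A)
      show ?case
      proof
        assume sub: "insert b A \<subseteq> ?J"
        have "V.subspace (C e (f ^ Suc b))"
          using cartier_ideal_ideal[of ?q "f ^ Suc b"] unfolding ideal_of_type_iff V.subspace_def by blast
        moreover have "w ` A \<subseteq> C e (f ^ Suc b)"
        proof clarify
          fix a assume a: "a \<in> A"
          then have "C e (f ^ a) \<subseteq> C e (f ^ Suc b)" using insert.hyps(2) by (intro C_power_antimono) (simp add: Suc_leI)
          then show "w a \<in> C e (f ^ Suc b)" using w(1)[of a] a sub by blast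
        qed
        ultimately have "V.span (w ` A) \<subseteq> C e (f ^ Suc b)" by (intro V.span_minimal)
        moreover have "w b \<notin> C e (f ^ Suc b)" using w(2)[of b] sub by simp
        ultimately have nb: "w b \<notin> V.span (w ` A)" by blast
        then have "w b \<notin> w ` A" using V.span_base by blast
        moreover have "b \<notin> A" using insert.hyps(2) by blast
        moreover have "V.independent (w ` A)" "card (w ` A) = card A" using insert.IH sub by auto
        ultimately show "V.independent (w ` insert b A) \<and> card (w ` insert b A) = card (insert b A)"
          unfolding image_insert V.independent_insert using insert.hyps(1) nb by simp
      qed
    qed
    then have "V.independent (w ` ?J)" "card (w ` ?J) = card ?J" by simp_all
    moreover have "w ` ?J \<subseteq> V.span T" using w(3) span by blast
    ultimately show ?thesis using V.independent_span_bound[OF T, of "w ` ?J"] by simp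
  qed
  then show ?thesis by blast
qed

section \<open>Roots and jumps\<close>
text \<open>
  If \<open>z e\<close> is not a jump, the indicator function of its residue class lies in the
  \<open>b\<close>-function and does not vanish at \<open>z\<close>.
\<close>

lemma Zp_roots_b_function:
  "Zp_roots p (b_function p f) = {z \<in> padic_ints p. \<forall>e. jump e (nat (z e))}"
proof -
  note mem = mem_max_ideal_at[OF prime_CHAR CHAR_p[symmetric]]
  have "b_function p f \<subseteq> max_ideal_at p z \<longleftrightarrow> (\<forall>e. jump e (nat (z e)))" if z: "z \<in> padic_ints p" for z
  proof (intro iffI allI)
    fix e
    assume sub: "b_function p f \<subseteq> max_ideal_at p z"
    define \<phi> :: "nat \<Rightarrow> 'k" where "\<phi> l = (if l mod p ^ e = nat (z e) then 1 else 0)" for l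
    have per: "periodic (p ^ e) \<phi>" by (simp add: periodic_def \<phi>_def)
    have "z e \<ge> 0" "z e < int (p ^ e)" using z by (simp_all add: padic_ints_def)
    then have ze: "nat (z e) < p ^ e" by (simp add: nat_less_iff)
    show "jump e (nat (z e))"
    proof (rule ccontr)
      assume "\<not> jump e (nat (z e))"
      then have "\<phi> \<in> b_function p f"
        unfolding b_function_iff jump_def using per by (intro exI[of _ e]) (auto simp: \<phi>_def)
      then have "\<phi> (nat (z e)) = 0" using sub mem[OF z per] by blast
      then show False using ze by (simp add: \<phi>_def)
    qed
  next
    assume j: "\<forall>e. jump e (nat (z e))"
    show "b_function p f \<subseteq> max_ideal_at p z"
    proof
      fix \<phi> assume "\<phi> \<in> b_function p f"
      then obtain e where per: "periodic (p ^ e) \<phi>"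
        and R: "\<And>a. a < p ^ e \<Longrightarrow> \<phi> a = 0 \<or> \<not> jump e a" unfolding b_function_iff jump_def by blast
      have "z e \<ge> 0" "z e < int (p ^ e)" using z by (simp_all add: padic_ints_def)
      then have ze: "nat (z e) < p ^ e" by (simp add: nat_less_iff)
      then show "\<phi> \<in> max_ideal_at p z" using R[OF ze] j mem[OF z per] by blast
    qed
  qed
  then show ?thesis unfolding Zp_roots_def by blast
qed

section \<open>\<open>F\<close>-jumping exponents\<close>

abbreviation ceil :: "real \<Rightarrow> nat \<Rightarrow> nat" where
  "ceil r e \<equiv> nat \<lceil>r * real p ^ e\<rceil>"

lemma test_ideal_eq: "test_ideal p f r = (\<Union>e. C e (f ^ ceil r e))"
  by (simp add: test_ideal_def frob_root_principal)

lemma ceil_eq_Suc: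
  assumes "real a < r * real p ^ e" "r * real p ^ e \<le> real a + 1" shows "ceil r e = Suc a"
proof -
  have "\<lceil>r * real p ^ e\<rceil> = int a + 1" using assms by (intro ceiling_unique) simp_all
  then show ?thesis by simp
qed

lemma ceil_bounds:
  assumes "r > 0"
  obtains a where "ceil r e = Suc a" "real a < r * real p ^ e" "r * real p ^ e \<le> real a + 1"
proof -
  have "r * real p ^ e > 0" using assms p_pos by simp
  then have pos: "\<lceil>r * real p ^ e\<rceil> > 0" by simp
  have "nat x = Suc (nat (x - 1))" if "x > 0" for x using that by linarith
  from this[OF pos] have a: "ceil r e = Suc (nat (\<lceil>r * real p ^ e\<rceil> - 1))" .
  have "real (nat (\<lceil>r * real p ^ e\<rceil> - 1)) = of_int \<lceil>r * real p ^ e\<rceil> - 1" using pos by simp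
  then show ?thesis using that[OF a] ceiling_correct[of "r * real p ^ e"] by simp
qed

lemma C_ceil_mono: "C e (f ^ ceil r e) \<subseteq> C (e + k) (f ^ ceil r (e + k))"
proof -
  have "r * real p ^ (e + k) = r * real p ^ e * real p ^ k" by (simp add: power_add)
  also have "\<dots> \<le> real (ceil r e) * real p ^ k" by (intro mult_right_mono real_nat_ceiling_ge) simp
  also have "\<dots> = real (ceil r e * p ^ k)" by simp
  finally have "ceil r (e + k) \<le> ceil r e * p ^ k" by (simp only: nat_ceiling_le_eq)
  then have "C (e + k) (f ^ (ceil r e * p ^ k)) \<subseteq> C (e + k) (f ^ ceil r (e + k))"
    by (rule C_power_antimono)
  then show ?thesis by (simp only: C_frobenius_power)
qed
text \<open>
  The condition determines \<open>a\<close> as \<open>\<lceil>r * p ^ e\<rceil> - 1\<close>. If this is not a jump at some level, the test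
  ideals are constant between \<open>a / p ^ e\<close> and \<open>r\<close>. Conversely, if \<open>r - \<epsilon>\<close> and \<open>r\<close> have the same
  test ideal, it contains the Frobenius root of \<open>f ^ a\<close> for a level \<open>e\<close> with \<open>1 / p ^ e < \<epsilon>\<close>, and at a
  sufficiently fine level this contradicts the jump.
\<close>

theorem F_jumping_iff:
  assumes r: "r > 0"
  shows "F_jumping p f r \<longleftrightarrow> (\<forall>e a. real a < r * real p ^ e \<and> r * real p ^ e \<le> real a + 1 \<longrightarrow> jump e a)"
proof
  assume F: "F_jumping p f r"
  show "\<forall>e a. real a < r * real p ^ e \<and> r * real p ^ e \<le> real a + 1 \<longrightarrow> jump e a"
  proof (intro allI impI)
    fix e a assume a: "real a < r * real p ^ e \<and> r * real p ^ e \<le> real a + 1"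
    show "jump e a"
    proof (rule ccontr)
      assume "\<not> jump e a"
      then have nj: "C e (f ^ a) \<subseteq> C e (f ^ Suc a)" by (simp add: jump_iff)
      define s where "s = (r + real a / real p ^ e) / 2"
      have P: "real p ^ e > 0" using p_pos by simp
      have ar: "real a / real p ^ e < r" using a P by (simp add: field_simps)
      have mid: "x \<le> (y + x) / 2" "(y + x) / 2 < y" "(y + x) / 2 > 0" if "x < y" "0 \<le> x" for x y :: real
        using that by auto
      have s: "real a / real p ^ e \<le> s" "s < r" "s > 0"
        unfolding s_def by (rule mid[OF ar], simp)+
      have "test_ideal p f r \<subseteq> test_ideal p f s"
      proof -
        have "ceil s e' \<le> ceil r e'" for e' using s(2) by (intro nat_mono ceiling_mono mult_right_mono) simp_all
        then show ?thesis unfolding test_ideal_eq using C_power_antimono by blast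
      qed
      moreover have "test_ideal p f s \<subseteq> test_ideal p f r"
      proof -
        have "C e' (f ^ ceil s e') \<subseteq> test_ideal p f r" for e'
        proof -
          have "C e' (f ^ ceil s e') \<subseteq> C (e + e') (f ^ ceil s (e + e'))"
            using C_ceil_mono[of e' s e] by (simp add: add.commute)
          also have "\<dots> \<subseteq> C (e + e') (f ^ (a * p ^ e'))"
          proof (rule C_power_antimono)
            have "real a \<le> s * real p ^ e" using s(1) P by (simp add: field_simps)
            then have "real a * real p ^ e' \<le> s * real p ^ e * real p ^ e'" by (rule mult_right_mono) simp
            then have "real (a * p ^ e') \<le> s * real p ^ (e + e')" by (simp add: power_add mult.assoc)
            also have "\<dots> \<le> real (ceil s (e + e'))" by (rule real_nat_ceiling_ge)
            finally show "a * p ^ e' \<le> ceil s (e + e')" by (simp only: of_nat_le_iff)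
          qed
          also have "\<dots> = C e (f ^ a)" by (rule C_frobenius_power)
          also note nj
          also have "Suc a = ceil r e" using ceil_eq_Suc[of a r e] a by simp
          finally show ?thesis unfolding test_ideal_eq by blast
        qed
        then show ?thesis unfolding test_ideal_eq[of s] by blast
      qed
      ultimately have "test_ideal p f (r - (r - s)) = test_ideal p f r" by simp
      moreover have "r - s > 0" "r - (r - s) > 0" using s by simp_all
      ultimately show False using F unfolding F_jumping_def by blast
    qed
  qed
next
  assume J: "\<forall>e a. real a < r * real p ^ e \<and> r * real p ^ e \<le> real a + 1 \<longrightarrow> jump e a"
  show "F_jumping p f r"
    unfolding F_jumping_def
  proof (intro conjI r allI impI notI)
    fix \<epsilon> :: real assume \<epsilon>: "\<epsilon> > 0" "r - \<epsilon> > 0" and eq: "test_ideal p f (r - \<epsilon>) = test_ideal p f r"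
    have "real p > 1" using prime_p by (simp add: prime_gt_Suc_0_nat)
    then obtain e where "1 / \<epsilon> < real p ^ e" using real_arch_pow by blast
    then have e: "1 < \<epsilon> * real p ^ e" using \<epsilon>(1) by (simp add: field_simps)
    obtain a where a: "ceil r e = Suc a" "real a < r * real p ^ e" "r * real p ^ e \<le> real a + 1"
      by (rule ceil_bounds[OF r])
    have "(r - \<epsilon>) * real p ^ e \<le> real a" using a(3) e by (simp add: algebra_simps)
    then have "ceil (r - \<epsilon>) e \<le> a" by (simp only: nat_ceiling_le_eq)
    then have "C e (f ^ a) \<subseteq> C e (f ^ ceil (r - \<epsilon>) e)" by (rule C_power_antimono)
    also have "\<dots> \<subseteq> test_ideal p f (r - \<epsilon>)"
      unfolding test_ideal_eq by (rule UN_upper[of e UNIV "\<lambda>e. C e (f ^ ceil (r - \<epsilon>) e)"]) simp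
    also note eq
    finally have sub: "C e (f ^ a) \<subseteq> (\<Union>e. C e (f ^ ceil r e))" unfolding test_ideal_eq .
    \<comment> \<open>\<open>C e (f ^ a)\<close> is generated by finitely many coordinates, hence lies in one member of the chain\<close>
    have "\<forall>\<alpha>\<in>box (p ^ e - 1). \<exists>e'. cartier_coord (p ^ e) \<alpha> (f ^ a) \<in> C e' (f ^ ceil r e')"
      using sub cartier_idealI[OF cartier_coord_cartier] by blast
    from bchoice[OF this] obtain lev where
      lev: "\<And>\<alpha>. \<alpha> \<in> box (p ^ e - 1) \<Longrightarrow> cartier_coord (p ^ e) \<alpha> (f ^ a) \<in> C (lev \<alpha>) (f ^ ceil r (lev \<alpha>))"
      by blast
    define k where "k = (\<Sum>\<alpha>\<in>box (p ^ e - 1). lev \<alpha>)"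
    have "C e (f ^ a) \<subseteq> C (e + k) (f ^ ceil r (e + k))"
    proof (rule cartier_ideal_coords[OF cartier_ideal_ideal])
      fix \<alpha> :: "'n \<Rightarrow>\<^sub>0 nat" assume \<alpha>: "\<alpha> \<in> box (p ^ e - 1)"
      have "lev \<alpha> \<le> k" unfolding k_def by (rule member_le_sum[OF \<alpha> _ finite_box]) simp
      then have "lev \<alpha> \<le> e + k" by simp
      then have "C (lev \<alpha>) (f ^ ceil r (lev \<alpha>)) \<subseteq> C (e + k) (f ^ ceil r (e + k))"
        using C_ceil_mono[of "lev \<alpha>" r "e + k - lev \<alpha>"] by simp
      then show "cartier_coord (p ^ e) \<alpha> (f ^ a) \<in> C (e + k) (f ^ ceil r (e + k))" using lev[OF \<alpha>] by blast
    qed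
    moreover obtain b where b: "ceil r (e + k) = Suc b" "real b < r * real p ^ (e + k)" "r * real p ^ (e + k) \<le> real b + 1"
      by (rule ceil_bounds[OF r])
    moreover have "C (e + k) (f ^ b) \<subseteq> C e (f ^ a)"
    proof -
      have "real a * real p ^ k < r * real p ^ e * real p ^ k" using a(2) p_pos by (intro mult_strict_right_mono) simp_all
      then have "real (a * p ^ k) < real (Suc b)" using b(3) by (simp add: power_add mult.assoc)
      then have "a * p ^ k \<le> b" by (simp only: of_nat_less_iff less_Suc_eq_le)
      then have "C (e + k) (f ^ b) \<subseteq> C (e + k) (f ^ (a * p ^ k))" by (rule C_power_antimono)
      then show ?thesis by (simp only: C_frobenius_power)
    qed
    ultimately have "C (e + k) (f ^ b) \<subseteq> C (e + k) (f ^ Suc b)" by simp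
    then show False using J b(2,3) by (auto simp: jump_iff)
  qed
qed

definition jumping_set :: "real set" where
  "jumping_set = {r. 0 < r \<and> r \<le> 1 \<and> F_jumping p f r}"

lemma jumping_setI:
  assumes "0 < r" "r \<le> 1"
    "\<And>e a. real a < r * real p ^ e \<Longrightarrow> r * real p ^ e \<le> real a + 1 \<Longrightarrow> jump e a"
  shows "r \<in> jumping_set"
  using assms by (simp add: jumping_set_def F_jumping_iff)

lemma jumping_setD:
  assumes "r \<in> jumping_set" "real a < r * real p ^ e" "r * real p ^ e \<le> real a + 1"
  shows "jump e a"
  using assms F_jumping_iff[of r] by (auto simp: jumping_set_def)

lemma p_gt_1: "real p > 1" "p > 1"
  using prime_p by (simp_all add: prime_gt_Suc_0_nat)

text \<open>A jump at some level refines to a nested sequence of jumps, whose limit is a jumping exponent.\<close>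

lemma jump_imp_jumping_exponent:
  assumes f: "f \<noteq> 0" and j: "jump e a" and a: "a < p ^ e"
  obtains r where "r \<in> jumping_set" "real a < r * real p ^ e" "r * real p ^ e \<le> real a + 1"
proof -
  have "\<exists>b. b 0 = a \<and> (\<forall>k. jump (e + k) (b k) \<and> (\<exists>c<p. b (Suc k) = b k * p + c))"
  proof -
    have "\<exists>b. \<forall>k. (jump (e + k) (b k) \<and> (k = 0 \<longrightarrow> b k = a)) \<and> (\<exists>c<p. b (Suc k) = b k * p + c)"
    proof (rule dependent_nat_choice)
      show "\<exists>x. jump (e + 0) x \<and> (0 = (0::nat) \<longrightarrow> x = a)" using j by simp
      show "\<exists>y. (jump (e + Suc k) y \<and> (Suc k = 0 \<longrightarrow> y = a)) \<and> (\<exists>c<p. y = x * p + c)"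
        if "jump (e + k) x \<and> (k = 0 \<longrightarrow> x = a)" for x k
        using jump_refine[of "e + k" x] that by auto
    qed
    then show ?thesis by blast
  qed
  then obtain b where b: "b 0 = a" "\<And>k. jump (e + k) (b k)" "\<And>k. \<exists>c<p. b (Suc k) = b k * p + c" by blast
  have nest: "b k * p ^ i \<le> b (k + i) \<and> b (k + i) < (b k + 1) * p ^ i" for k i
  proof (induction i)
    case (Suc i)
    obtain c where c: "c < p" "b (Suc (k + i)) = b (k + i) * p + c" using b(3) by blast
    have "b k * p ^ i * p \<le> b (k + i) * p" using Suc by (intro mult_le_mono1) simp
    then have "b k * p ^ Suc i \<le> b (k + i) * p" by (simp only: power_Suc2 mult.assoc)
    moreover have "(b (k + i) + 1) * p \<le> (b k + 1) * p ^ i * p" using Suc by (intro mult_le_mono1) simp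
    then have "b (k + i) * p + p \<le> (b k + 1) * p ^ Suc i" by (simp add: algebra_simps)
    ultimately have "b k * p ^ Suc i \<le> b (k + i) * p + c" "b (k + i) * p + c < (b k + 1) * p ^ Suc i"
      using c(1) by linarith+
    then show ?case by (simp only: add_Suc_right c(2) simp_thms)
  qed simp
  have P: "real p ^ i > 0" for i using p_pos by simp
  define x where "x k = real (b k) / real p ^ (e + k)" for k
  have upper: "x k \<le> (real (b j) + 1) / real p ^ (e + j)" for k j
  proof (cases "j \<le> k")
    case True
    then obtain i where i: "k = j + i" using le_Suc_ex by blast
    have "real (b k) \<le> (real (b j) + 1) * real p ^ i"
      using nest[of j i] unfolding i by (metis (mono_tags) less_imp_le of_nat_1 of_nat_add of_nat_le_iff of_nat_mult of_nat_power)
    then show ?thesis using P[of i] P[of "e + j"] by (simp add: x_def i power_add field_simps)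
  next
    case False
    then obtain i where i: "j = k + i" using le_Suc_ex nat_le_linear by blast
    have "real (b k) * real p ^ i \<le> real (b j) + 1"
      using nest[of k i] unfolding i by (metis (mono_tags) le_add1 le_trans of_nat_1 of_nat_add of_nat_le_iff of_nat_mult of_nat_power)
    then have "real (b k) * real p ^ i / real p ^ (e + j) \<le> (real (b j) + 1) / real p ^ (e + j)"
      by (rule divide_right_mono) simp
    moreover have "x k = real (b k) * real p ^ i / real p ^ (e + j)"
      using p_pos by (simp add: x_def i power_add)
    ultimately show ?thesis by (simp only:)
  qed
  define r where "r = (SUP k. x k)"
  have bdd: "bdd_above (range x)" using upper[of _ 0] by (intro bdd_aboveI) auto
  have lower: "x k \<le> r" for k unfolding r_def by (rule cSUP_upper[OF _ bdd]) simp
  have up: "r \<le> (real (b j) + 1) / real p ^ (e + j)" for j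
    unfolding r_def by (rule cSUP_least) (simp_all add: upper)
  obtain k0 where k0: "\<And>e a. \<not> jump (e + k0) (a * p ^ k0)" using no_jump_at_multiples[OF f] by blast
  \<comment> \<open>the limit is not the left end of an interval, where right continuity excludes fine jumps\<close>
  have strict: "x k < r" for k
  proof (rule ccontr)
    assume "\<not> x k < r"
    then have "x (k + k0) \<le> x k" using lower[of "k + k0"] lower[of k] by simp
    then have "x (k + k0) * real p ^ (e + (k + k0)) \<le> x k * real p ^ (e + (k + k0))"
      by (rule mult_right_mono) simp
    moreover have "x (k + k0) * real p ^ (e + (k + k0)) = real (b (k + k0))"
      using p_pos by (simp add: x_def)
    moreover have "x k * real p ^ (e + (k + k0)) = real (b k) * real p ^ k0"
      using p_pos by (simp add: x_def power_add)
    ultimately have "real (b (k + k0)) \<le> real (b k) * real p ^ k0" by (simp only:)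
    then have "b (k + k0) \<le> b k * p ^ k0" by (metis of_nat_le_iff of_nat_mult of_nat_power)
    then have "b (k + k0) = b k * p ^ k0" using nest[of k k0] by simp
    then show False using b(2)[of "k + k0"] k0[of "e + k" "b k"] by (simp add: add.assoc)
  qed
  have lo: "real (b k) < r * real p ^ (e + k)" for k
    using strict[of k] P[of "e + k"] by (simp add: x_def field_simps)
  have hi: "r * real p ^ (e + k) \<le> real (b k) + 1" for k
    using up[of k] P[of "e + k"] by (simp add: field_simps)
  have r0: "0 < r" using strict[of 0] by (rule order.strict_trans1[rotated]) (simp add: x_def)
  have "r * real p ^ e \<le> real p ^ e"
  proof -
    have "r * real p ^ e \<le> real a + 1" using hi[of 0] b(1) by simp
    also have "\<dots> \<le> real (p ^ e)" using a by (metis Suc_leI of_nat_Suc of_nat_le_iff add.commute)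
    finally show ?thesis by simp
  qed
  then have r1: "r \<le> 1" using P[of e] by simp
  have J: "jump e' a'" if a': "real a' < r * real p ^ e'" "r * real p ^ e' \<le> real a' + 1" for e' a'
  proof -
    have high: "jump e'' a''" if ee: "e \<le> e''" and a'': "real a'' < r * real p ^ e''" "r * real p ^ e'' \<le> real a'' + 1" for e'' a''
    proof -
      obtain k where k: "e'' = e + k" using ee le_Suc_ex by blast
      have "a'' = b k" using a'' lo[of k] hi[of k] unfolding k by linarith
      then show ?thesis using b(2)[of k] k by simp
    qed
    show ?thesis
    proof (cases "e \<le> e'")
      case True
      then show ?thesis using high a' by blast
    next
      case False
      then obtain k where k: "e = e' + k" using le_Suc_ex nat_le_linear by blast
      have eq: "r * real p ^ e = r * real p ^ e' * real p ^ k" by (simp add: k power_add)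
      have "real a' * real p ^ k < r * real p ^ e" unfolding eq using a'(1) P[of k] by simp
      also have "\<dots> \<le> real a + 1" using hi[of 0] b(1) by simp
      finally have "real (a' * p ^ k) < real (a + 1)" by simp
      then have l: "a' * p ^ k \<le> a" by (simp only: of_nat_less_iff)
      have "real a < r * real p ^ e" using lo[of 0] b(1) by simp
      also have "\<dots> \<le> (real a' + 1) * real p ^ k" unfolding eq using a'(2) P[of k] by simp
      also have "\<dots> = real ((a' + 1) * p ^ k)" by (simp add: distrib_right)
      finally have "real a < real ((a' + 1) * p ^ k)" .
      then have "a < (a' + 1) * p ^ k" by (simp only: of_nat_less_iff)
      then have "a < a' * p ^ k + p ^ k" by simp
      then have "a - a' * p ^ k < p ^ k" using l by linarith
      moreover have "jump (e' + k) (a' * p ^ k + (a - a' * p ^ k))" using j k l by simp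
      ultimately show ?thesis by (rule jump_coarsen[rotated])
    qed
  qed
  have "r \<in> jumping_set" by (rule jumping_setI[OF r0 r1 J])
  then show ?thesis by (rule that) (use lo[of 0] hi[of 0] b(1) in simp_all)
qed
text \<open>
  Distinct exponents lie in distinct intervals of a sufficiently fine level, and the number of jumps
  is bounded independently of the level.
\<close>

lemma finite_jumping_set: "finite jumping_set"
proof -
  obtain N where N: "\<And>e. card {a. a < p ^ e \<and> jump e a} \<le> N" using card_jumps_bounded by blast
  have "card Y \<le> N" if Y: "Y \<subseteq> jumping_set" "finite Y" for Y
  proof -
    \<comment> \<open>the element \<open>1\<close> only makes the set non-empty\<close>
    let ?D = "insert 1 ((\<lambda>(x, y). \<bar>x - y\<bar>) ` (Y \<times> Y) - {0})"
    have fin: "finite ?D" using Y(2) by simp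
    define \<delta> where "\<delta> = Min ?D"
    have "\<delta> \<in> ?D" unfolding \<delta>_def by (rule Min_in[OF fin]) simp
    then have \<delta>: "\<delta> > 0" by auto
    have sep: "\<delta> \<le> \<bar>x - y\<bar>" if "x \<in> Y" "y \<in> Y" "x \<noteq> y" for x y
    proof -
      have "\<bar>x - y\<bar> \<in> (\<lambda>(x, y). \<bar>x - y\<bar>) ` (Y \<times> Y)"
        by (rule image_eqI[of _ _ "(x, y)"]) (use that in auto)
      then have "\<bar>x - y\<bar> \<in> ?D" using that(3) by simp
      then show ?thesis unfolding \<delta>_def by (rule Min_le[OF fin])
    qed
    obtain e where "1 / \<delta> < real p ^ e" using real_arch_pow[OF p_gt_1(1)] by blast
    then have e: "1 < \<delta> * real p ^ e" using \<delta> by (simp add: field_simps)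
    have P: "real p ^ e > 0" using p_pos by simp
    have "\<forall>x\<in>Y. \<exists>a. real a < x * real p ^ e \<and> x * real p ^ e \<le> real a + 1"
    proof
      fix x assume "x \<in> Y"
      then have "0 < x" using Y(1) by (auto simp: jumping_set_def)
      then show "\<exists>a. real a < x * real p ^ e \<and> x * real p ^ e \<le> real a + 1"
        by (rule ceil_bounds[of x e]) blast
    qed
    from bchoice[OF this] obtain a
      where a: "\<And>x. x \<in> Y \<Longrightarrow> real (a x) < x * real p ^ e \<and> x * real p ^ e \<le> real (a x) + 1"
      by blast
    have "inj_on a Y"
    proof (rule inj_onI, rule ccontr)
      fix x y assume xy: "x \<in> Y" "y \<in> Y" "a x = a y" "x \<noteq> y"
      have "\<bar>x * real p ^ e - y * real p ^ e\<bar> < 1" using a[OF xy(1)] a[OF xy(2)] xy(3) by auto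
      then have "\<bar>x - y\<bar> * real p ^ e < 1" using P by (simp add: left_diff_distrib[symmetric] abs_mult)
      moreover have "\<delta> * real p ^ e \<le> \<bar>x - y\<bar> * real p ^ e" using sep[OF xy(1,2,4)] P by simp
      ultimately show False using e by simp
    qed
    moreover have "a ` Y \<subseteq> {a. a < p ^ e \<and> jump e a}"
    proof clarify
      fix x assume x: "x \<in> Y"
      then have xJ: "x \<in> jumping_set" using Y(1) by blast
      have "real (a x) < x * real p ^ e" using a[OF x] by simp
      also have "\<dots> \<le> 1 * real p ^ e" using xJ P by (intro mult_right_mono) (simp_all add: jumping_set_def)
      finally have "real (a x) < real (p ^ e)" by simp
      then have "a x < p ^ e" by (simp only: of_nat_less_iff)
      then show "a x < p ^ e \<and> jump e (a x)" using jumping_setD[OF xJ] a[OF x] by blast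
    qed
    moreover have "finite {a. a < p ^ e \<and> jump e a}" by simp
    ultimately have "card Y \<le> card {a. a < p ^ e \<and> jump e a}"
      by (simp only: card_image[symmetric] card_mono)
    then show ?thesis using N[of e] by simp
  qed
  then show ?thesis by (rule finite_if_finite_subsets_card_bdd[THEN conjunct1])
qed

text \<open>
  With the given \<open>a\<close>, the number \<open>r * p ^ e - a\<close> is the representative of \<open>r * p ^ e\<close> modulo \<open>1\<close> that is
  positive and at most \<open>1\<close>.
\<close>

lemma jumping_set_multiply:
  assumes r: "r \<in> jumping_set" and m: "real a < r * real p ^ e" "r * real p ^ e \<le> real a + 1"
  shows "r * real p ^ e - real a \<in> jumping_set"
proof (rule jumping_setI)
  show "0 < r * real p ^ e - real a" "r * real p ^ e - real a \<le> 1" using m by simp_all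
  fix e' b
  assume b: "real b < (r * real p ^ e - real a) * real p ^ e'" "(r * real p ^ e - real a) * real p ^ e' \<le> real b + 1"
  have eq: "(r * real p ^ e - real a) * real p ^ e' = r * real p ^ (e' + e) - real (p ^ e' * a)"
    by (simp add: power_add algebra_simps)
  have "jump (e' + e) (b + p ^ e' * a)"
    using b unfolding eq by (intro jumping_setD[OF r]) simp_all
  then show "jump e' b" by (rule jump_add_multiple)
qed

section \<open>\<open>p\<close>-adic expansions\<close>

lemma coprime_power_p:
  assumes "\<not> int p dvd b" shows "coprime b (int p ^ n)"
proof -
  have "Factorial_Ring.prime (int p)" using prime_p by simp
  then have "coprime (int p) b" using assms by (rule prime_imp_coprime)
  then show ?thesis by (simp add: coprime_commute)
qed

lemma padic_of_Z_loc_eq: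
  assumes "\<not> int p dvd b" "x = of_int a / of_int b" "c \<in> {0..<int p ^ n}" "[b * c = a] (mod int p ^ n)"
  shows "padic_of_Z_loc p x n = c"
  unfolding padic_of_Z_loc_def
proof (rule the_equality)
  show "c \<in> {0..<int p ^ n} \<and> (\<exists>a b. \<not> int p dvd b \<and> x = of_int a / of_int b \<and> [b * c = a] (mod int p ^ n))"
    using assms by blast
  fix c' assume "c' \<in> {0..<int p ^ n} \<and> (\<exists>a b. \<not> int p dvd b \<and> x = of_int a / of_int b \<and> [b * c' = a] (mod int p ^ n))"
  then obtain a' b' where c': "c' \<in> {0..<int p ^ n}" "\<not> int p dvd b'" "x = of_int a' / of_int b'" "[b' * c' = a'] (mod int p ^ n)"
    by blast
  have nz: "b \<noteq> 0" "b' \<noteq> 0" using assms(1) c'(2) by auto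
  have "(of_int a :: real) / of_int b = of_int a' / of_int b'" using assms(2) c'(3) by simp
  then have "(of_int (a * b') :: real) = of_int (a' * b)" using nz by (simp add: field_simps)
  then have ab: "a * b' = a' * b" by (simp only: of_int_eq_iff)
  have "[b' * (b * c) = b' * a] (mod int p ^ n)" using assms(4) by (rule cong_scalar_left)
  moreover have "[b * (b' * c') = b * a'] (mod int p ^ n)" using c'(4) by (rule cong_scalar_left)
  ultimately have "[(b * b') * c = (b * b') * c'] (mod int p ^ n)"
    using ab by (simp add: Cong.cong_def mult_ac)
  moreover have "coprime (b * b') (int p ^ n)"
    using coprime_power_p[OF assms(1)] coprime_power_p[OF c'(2)] by (simp only: coprime_mult_left_iff simp_thms)
  ultimately have "[c = c'] (mod int p ^ n)" by (simp add: cong_mult_lcancel)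
  then show "c' = c" using assms(3) c'(1) by (simp add: Cong.cong_def)
qed

lemma padic_of_Z_loc_props:
  assumes b: "\<not> int p dvd b" and x: "x = of_int a / of_int b"
  shows "padic_of_Z_loc p x n \<in> {0..<int p ^ n}" "[b * padic_of_Z_loc p x n = a] (mod int p ^ n)"
proof -
  obtain y where y: "[b * y = 1] (mod int p ^ n)" using cong_solve_coprime_int[OF coprime_power_p[OF b]] by blast
  define c where "c = (y * a) mod int p ^ n"
  have "[b * c = b * (y * a)] (mod int p ^ n)" unfolding c_def by (intro cong_scalar_left) simp
  also have "[b * (y * a) = 1 * a] (mod int p ^ n)"
    using cong_scalar_right[OF y, of a] by (simp add: mult.assoc)
  finally have bc: "[b * c = a] (mod int p ^ n)" by simp
  have "c \<in> {0..<int p ^ n}" using p_pos by (simp add: c_def)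
  then have "padic_of_Z_loc p x n = c" using padic_of_Z_loc_eq[OF b x _ bc] by blast
  then show "padic_of_Z_loc p x n \<in> {0..<int p ^ n}" "[b * padic_of_Z_loc p x n = a] (mod int p ^ n)"
    using bc \<open>c \<in> {0..<int p ^ n}\<close> by simp_all
qed

lemma padic_of_Z_loc_padic_int:
  assumes b: "\<not> int p dvd b" and x: "x = of_int a / of_int b"
  shows "padic_of_Z_loc p x \<in> padic_ints p"
proof -
  have "[padic_of_Z_loc p x (Suc n) = padic_of_Z_loc p x n] (mod int p ^ n)" for n
  proof -
    have "[b * padic_of_Z_loc p x (Suc n) = a] (mod int p ^ n)"
      by (rule cong_dvd_modulus[OF padic_of_Z_loc_props(2)[OF b x]]) (simp add: le_imp_power_dvd)
    then have "[b * padic_of_Z_loc p x (Suc n) = b * padic_of_Z_loc p x n] (mod int p ^ n)"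
      using padic_of_Z_loc_props(2)[OF b x, of n] by (metis cong_trans cong_sym)
    moreover have "coprime b (int p ^ n)" by (rule coprime_power_p[OF b])
    ultimately show ?thesis by (simp add: cong_mult_lcancel)
  qed
  then show ?thesis using padic_of_Z_loc_props(1)[OF b x] by (simp add: padic_ints_def)
qed

section \<open>Roots and jumping exponents\<close>

text \<open>
  If \<open>b\<close> divides \<open>p ^ E - 1\<close> and \<open>r = a / b\<close>, then \<open>p ^ E \<sqdot> r = A + r\<close> with the integer
  \<open>A = (p ^ E - 1) \<sqdot> r\<close>, which is congruent to \<open>- r\<close> modulo \<open>p ^ E\<close>.
\<close>

lemma jumping_exponent_imp_root:
  assumes r: "r \<in> jumping_set" and Z: "r \<in> Z_loc p"
  shows "padic_of_Z_loc p (- r) \<in> Zp_roots p (b_function p f)"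
proof -
  obtain a b where ab: "r = of_int a / of_int b" "\<not> int p dvd b" using Z by (auto simp: Z_loc_def)
  have x: "- r = of_int (- a) / of_int b" using ab(1) by simp
  have b0: "b \<noteq> 0" using ab(2) by auto
  have r01: "0 < r" "r \<le> 1" using r by (simp_all add: jumping_set_def)
  let ?z = "padic_of_Z_loc p (- r)"
  have "jump e (nat (?z e))" for e
  proof -
    \<comment> \<open>by Euler's theorem \<open>b\<close> divides \<open>p ^ d - 1\<close>, hence \<open>p ^ E - 1\<close>\<close>
    define d where "d = totient (nat \<bar>b\<bar>)"
    define E where "E = d * e"
    have d: "d > 0" using b0 by (simp add: d_def)
    then have "e \<le> E" by (simp add: E_def)
    then obtain k where k: "E = e + k" using le_Suc_ex by blast
    have "\<not> p dvd nat \<bar>b\<bar>" using ab(2) by (metis int_dvd_int_iff dvd_abs_iff nat_0_le abs_ge_zero)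
    then have "coprime p (nat \<bar>b\<bar>)" using prime_p by (simp add: prime_imp_coprime)
    then have "[p ^ d = 1] (mod nat \<bar>b\<bar>)" unfolding d_def by (rule euler_theorem)
    then have "[(p ^ d) ^ e = 1 ^ e] (mod nat \<bar>b\<bar>)" by (rule cong_pow)
    then have "[p ^ E = 1] (mod nat \<bar>b\<bar>)" by (simp add: E_def power_mult)
    then have "[int p ^ E = 1] (mod \<bar>b\<bar>)"
      using cong_int_iff[of "p ^ E" 1 "nat \<bar>b\<bar>"] by simp
    then have "b dvd int p ^ E - 1" by (simp add: cong_iff_dvd_diff)
    then obtain c where c: "int p ^ E - 1 = b * c" by (elim dvdE)
    define A where "A = a * c"
    have "(of_int (int p ^ E - 1) :: real) = of_int (b * c)" by (simp only: c)
    then have cr: "real p ^ E - 1 = of_int b * of_int c" by simp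
    have Ar: "of_int A = r * (real p ^ E - 1)" using b0 by (simp add: A_def cr ab(1))
    have "real p ^ E \<ge> 1" using p_gt_1(1) by (intro one_le_power) simp
    then have "(0::real) \<le> of_int A" unfolding Ar using r01(1) by simp
    then have A0: "A \<ge> 0" by simp
    then have nA: "real (nat A) = r * real p ^ E - r" using Ar by (simp add: algebra_simps)
    have "jump E (nat A)"
      by (rule jumping_setD[OF r]) (use nA r01 in simp_all)
    moreover have "nat A = nat A mod p ^ e + p ^ e * (nat A div p ^ e)" by simp
    ultimately have J: "jump e (nat A mod p ^ e)" unfolding k by (metis jump_add_multiple)
    have "int p ^ e dvd int p ^ E" using k by (simp add: le_imp_power_dvd)
    then have "[int p ^ E = 0] (mod int p ^ e)" by (simp add: cong_0_iff)
    moreover have "b * A = a * (int p ^ E - 1)" unfolding A_def c by (simp add: mult_ac)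
    ultimately have "[b * A = a * (0 - 1)] (mod int p ^ e)"
      by (metis cong_diff cong_refl cong_scalar_left)
    then have "[b * A = b * ?z e] (mod int p ^ e)"
      using padic_of_Z_loc_props(2)[OF ab(2) x, of e] by (simp add: Cong.cong_def)
    moreover have "coprime b (int p ^ e)" by (rule coprime_power_p[OF ab(2)])
    ultimately have "[A = ?z e] (mod int p ^ e)" by (simp add: cong_mult_lcancel)
    then have "A mod int p ^ e = ?z e"
      using padic_of_Z_loc_props(1)[OF ab(2) x, of e] by (simp add: Cong.cong_def)
    then have "nat (?z e) = nat A mod p ^ e" using A0 by (metis nat_mod_distrib of_nat_0_le_iff of_nat_power nat_int)
    then show ?thesis using J by simp
  qed
  then show ?thesis using padic_of_Z_loc_padic_int[OF ab(2) x] unfolding Zp_roots_b_function by blast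
qed

text \<open>
  A root \<open>z\<close> yields for every \<open>e\<close> a jumping exponent \<open>\<lambda>\<close> whose expansion begins with
  \<open>z mod p ^ e\<close>, and \<open>\<mu> = p ^ e \<sqdot> \<lambda> - z mod p ^ e\<close> is again one. As there are finitely many
  jumping exponents, one pair \<open>(\<lambda>, \<mu>)\<close> serves for infinitely many \<open>e\<close>; comparing two of
  these \<open>e\<close> identifies \<open>- \<mu>\<close> with \<open>z\<close>.
\<close>

lemma root_imp_jumping_exponent:
  assumes f: "f \<noteq> 0" and z: "z \<in> Zp_roots p (b_function p f)"
  shows "\<exists>r\<in>jumping_set \<inter> Z_loc p. z = padic_of_Z_loc p (- r)"
proof -
  have zp: "z \<in> padic_ints p" and j: "\<And>e. jump e (nat (z e))"
    using z unfolding Zp_roots_b_function by blast+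
  have zr: "0 \<le> z e" "z e < int p ^ e" for e using zp by (simp_all add: padic_ints_def)
  have "\<exists>r. r \<in> jumping_set \<and> of_int (z e) < r * real p ^ e \<and> r * real p ^ e \<le> of_int (z e) + 1" for e
  proof -
    have "nat (z e) < p ^ e" using zr[of e] by (simp add: nat_less_iff)
    from jump_imp_jumping_exponent[OF f j this]
    obtain r where "r \<in> jumping_set" "real (nat (z e)) < r * real p ^ e" "r * real p ^ e \<le> real (nat (z e)) + 1" .
    then show ?thesis using zr(1)[of e] by auto
  qed
  then obtain l where l: "\<And>e. l e \<in> jumping_set" "\<And>e. of_int (z e) < l e * real p ^ e"
    "\<And>e. l e * real p ^ e \<le> of_int (z e) + 1" by metis
  define m where "m e = l e * real p ^ e - of_int (z e)" for e
  have m: "m e \<in> jumping_set" for e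
    using jumping_set_multiply[OF l(1)[of e], of "nat (z e)" e] l(2,3)[of e] zr(1)[of e] by (simp add: m_def)
  have "finite (range (\<lambda>e. (l e, m e)))"
    by (rule finite_subset[of _ "jumping_set \<times> jumping_set"]) (use l(1) m finite_jumping_set in auto)
  then obtain e1 where e1: "infinite {e. (l e, m e) = (l e1, m e1)}"
    using pigeonhole_infinite[of UNIV "\<lambda>e. (l e, m e)"] by auto
  let ?m = "m e1"
  have later: "\<exists>d>0. n \<le> d \<and> - ?m = of_int (int p ^ d * z e1 - z (e1 + d)) / of_int (int p ^ d - 1)" for n
  proof -
    obtain e where e: "e > e1 + n" "l e = l e1" "m e = m e1"
      using e1 unfolding infinite_nat_iff_unbounded by blast
    define d where "d = e - e1"
    have d: "d > 0" "n \<le> d" "e = e1 + d" using e(1) by (simp_all add: d_def)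
    have "real p ^ d * (of_int (z e1) + ?m) = of_int (z e) + ?m"
    proof -
      have "of_int (z e1) + ?m = l e1 * real p ^ e1" by (simp add: m_def)
      moreover have "of_int (z e) + ?m = l e1 * real p ^ e" unfolding e(3)[symmetric] by (simp add: m_def e(2))
      ultimately show ?thesis by (simp add: d(3) power_add)
    qed
    then have "- ?m * (real p ^ d - 1) = real p ^ d * of_int (z e1) - of_int (z e)" by (simp add: algebra_simps)
    moreover have "real p ^ d > 1" using p_gt_1(1) d(1) by simp
    ultimately have "- ?m = (real p ^ d * of_int (z e1) - of_int (z e)) / (real p ^ d - 1)"
      by (simp add: field_simps)
    then show ?thesis using d by (intro exI[of _ d]) simp
  qed
  have ndvd: "\<not> int p dvd int p ^ d - 1" if "d > 0" for d
  proof
    assume "int p dvd int p ^ d - 1"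
    moreover have "int p dvd int p ^ d" using that by (simp add: dvd_power)
    ultimately have "int p dvd int p ^ d - (int p ^ d - 1)" by (rule dvd_diff[rotated])
    then show False using p_gt_1(2) by simp
  qed
  have "padic_of_Z_loc p (- ?m) n = z n" for n
  proof -
    obtain d where d: "d > 0" "n \<le> d"
      "- ?m = of_int (int p ^ d * z e1 - z (e1 + d)) / of_int (int p ^ d - 1)" using later by blast
    show ?thesis
    proof (rule padic_of_Z_loc_eq[OF ndvd[OF d(1)] d(3)])
      show "z n \<in> {0..<int p ^ n}" using zr[of n] by simp
      have "[int p ^ d = 0] (mod int p ^ n)" using d(2) by (simp add: cong_0_iff le_imp_power_dvd)
      then have "[(int p ^ d - 1) * z n = (0 - 1) * z n] (mod int p ^ n)"
        "[int p ^ d * z e1 - z (e1 + d) = 0 * z e1 - z (e1 + d)] (mod int p ^ n)"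
        by (intro cong_mult cong_diff cong_refl; assumption)+
      moreover have "[z (e1 + d) = z n] (mod int p ^ n)"
        using padic_mod[OF zp, of n "e1 + d"] padic_mod[OF zp, of n n] d(2) by (simp add: Cong.cong_def)
      then have "[0 * z e1 - z (e1 + d) = (0 - 1) * z n] (mod int p ^ n)" by (simp add: cong_minus_minus_iff)
      ultimately show "[(int p ^ d - 1) * z n = int p ^ d * z e1 - z (e1 + d)] (mod int p ^ n)"
        by (meson cong_trans cong_sym)
    qed
  qed
  then have "z = padic_of_Z_loc p (- ?m)" by (intro ext) simp
  moreover have "?m \<in> Z_loc p"
  proof -
    obtain d where d: "d > 0"
      "- ?m = of_int (int p ^ d * z e1 - z (e1 + d)) / of_int (int p ^ d - 1)" using later[of 0] by blast
    have "?m = of_int (- (int p ^ d * z e1 - z (e1 + d))) / of_int (int p ^ d - 1)"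
      using d(2) by (simp only: of_int_minus minus_divide_left[symmetric])
    then show ?thesis unfolding Z_loc_def using ndvd[OF d(1)] by blast
  qed
  ultimately show ?thesis using m by blast
qed

end

theorem theoremD:
  fixes p :: nat and g :: "('n::{finite,linorder}, 'k::field) mpoly"
  assumes "p > 0" and "CHAR('k) = p" and "perfect_field TYPE('k)"
    and "g \<notin> range mconst"
  shows "(\<forall>r \<in> {0<..1} \<inter> Z_loc p.
            F_jumping p g r \<longrightarrow> padic_of_Z_loc p (- r) \<in> Zp_roots p (b_function p g)) \<and>
         (\<forall>z \<in> Zp_roots p (b_function p g).
            \<exists>r \<in> {0<..1} \<inter> Z_loc p. F_jumping p g r \<and> z = padic_of_Z_loc p (- r))"
proof -
  have "Factorial_Ring.prime CHAR('k)"
    using assms(1,2) by (intro prime_CHAR_semidom) simp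
  then have prime: "Factorial_Ring.prime p" by (simp only: assms(2))
  have "surj (\<lambda>x::'k. x ^ p)"
    using assms(1-3) by (simp add: perfect_field_def)
  then interpret b_function_setup p g
    by (rule b_function_setup.intro[OF prime assms(2)])
  have "mconst 0 = (0 :: ('n, 'k) mpoly)" by (simp add: mconst_def)
  then have "g \<noteq> 0" using assms(4) by (metis rangeI)
  have J: "r \<in> jumping_set \<longleftrightarrow> r \<in> {0<..1} \<and> F_jumping p g r" for r
    by (auto simp: jumping_set_def)
  show ?thesis
  proof (intro conjI ballI impI)
    fix r assume "r \<in> {0<..1} \<inter> Z_loc p" "F_jumping p g r"
    then show "padic_of_Z_loc p (- r) \<in> Zp_roots p (b_function p g)"
      by (intro jumping_exponent_imp_root) (simp_all add: J)
  next
    fix z assume "z \<in> Zp_roots p (b_function p g)"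
    from root_imp_jumping_exponent[OF \<open>g \<noteq> 0\<close> this]
    obtain r where "r \<in> jumping_set" "r \<in> Z_loc p" "z = padic_of_Z_loc p (- r)" by blast
    then show "\<exists>r\<in>{0<..1} \<inter> Z_loc p. F_jumping p g r \<and> z = padic_of_Z_loc p (- r)"
      unfolding J by blast
  qed
qed

end
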